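(* For every tree $T\in\mathcal A$ there is a ccc forcing notion $\mathbb Q=\mathbb Q(T)$ and a family $\mathcal F$ of $\aleph_1$ many dense subsets of $\mathbb Q$ such that every filter $G\subseteq\mathbb Q$ meeting every member of $\mathcal F$ yields a tree $T^\ast\in\mathcal A$ and a function $c$ with $(T^\ast,T,c)\in\mathcal A_2^{\rm sp}$; in particular $T^\ast$ is not weakly embeddable into $T$. Consequently, assuming $MA(\omega_1)$, there is no Aronszajn tree which is universal under weak embeddings, i.e. no Aronszajn tree $U$ such that every Aronszajn tree weakly embeds into $U$.
   Context: An Aronszajn tree is a tree of height $\omega_1$ with all levels countable and no uncountable branch. A weak embedding from $T_1$ to $T_2$ is a map $f:T_1\to T_2$ with $x<_{T_1}y\Rightarrow f(x)<_{T_2}f(y)$. For an ordinal $\gamma<\omega_1$, ${\rm ht}(\gamma)$ denotes the unique $\alpha$ with $\gamma\in[\omega\alpha,\omega\alpha+\omega)$. $\mathcal A$ denotes the set of all trees $T$ whose underlying set is $\{\langle\rangle\}\cup X$ for some $X\subseteq\omega_1$, where $\langle\rangle$ is the root (below every other element; considered to be of level $-1$), such that $T$ has height $\omega_1$, has no uncountable branch, is normal (two distinct elements of the same limit level have different sets of predecessors), and for every $\alpha<\omega_1$ the $\alpha$-th level ${\rm lev}_\alpha(T)$ is a subset of $[\omega\alpha,\omega\alpha+\omega)$. For $x,y\in T$, $x\cap_T y$ denotes the meet; $x\perp_T y$ means incomparable. For $(x,y)\in{\rm lev}_\alpha(T_1)\times{\rm lev}_\alpha(T_2)$, $\alpha(x,y)=\alpha$.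 $\mathcal A_2^{\rm sp}$ is the set of all triples $(T_1,T_2,c)$ with $T_1,T_2\in\mathcal A$ and $c$ a function from $\bigcup_{\delta<\omega_1\text{ limit}}{\rm lev}_\delta(T_1)\times{\rm lev}_\delta(T_2)$ to $\omega$ such that whenever $c(x_1,y_1)=c(x_2,y_2)$ and $(x_1,y_1)\neq(x_2,y_2)$, then $\alpha(x_1,y_1)\ne\alpha(x_2,y_2)$, $x_1\perp_{T_1}x_2$, $y_1\perp_{T_2}y_2$, and ${\rm ht}(x_1\cap_{T_1}x_2)>{\rm ht}(y_1\cap_{T_2}y_2)$. $MA(\omega_1)$ is Martin's Axiom for $\aleph_1$ dense sets. *)

theory Defs
  imports Main "HOL-Library.Countable_Set"
begin

text \<open>Any type of this class is order-isomorphic to omega_1: an uncountable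
well-order all of whose proper initial segments are countable.\<close>

class omega1 = wellorder +
  assumes omega1_uncountable: "\<not> countable (UNIV :: 'a set)"
  and omega1_countable_below: "countable {y. y < x}"

definition is_limit :: "'a::wellorder \<Rightarrow> bool" where
  "is_limit a \<longleftrightarrow> (\<exists>b. b < a) \<and> (\<forall>b. b < a \<longrightarrow> (\<exists>c. b < c \<and> c < a))"

text \<open>A tree is a set N with a strict order lt whose predecessor sets are
linearly ordered; lv is its level function into omega_1: lv is strictly
monotone and maps the predecessors of x bijectively onto the ordinals below lv x
(so lv x is the order type of the predecessors of x).\<close>

definition tree_levels ::
  "'u set \<Rightarrow> ('u \<Rightarrow> 'u \<Rightarrow> bool) \<Rightarrow> ('u \<Rightarrow> 'w::wellorder) \<Rightarrow> bool" where
  "tree_levels N lt lv \<longleftrightarrow>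
     (\<forall>x y. lt x y \<longrightarrow> x \<in> N \<and> y \<in> N) \<and>
     (\<forall>x. \<not> lt x x) \<and>
     (\<forall>x y z. lt x y \<longrightarrow> lt y z \<longrightarrow> lt x z) \<and>
     (\<forall>x\<in>N. \<forall>y z. lt y x \<longrightarrow> lt z x \<longrightarrow> y = z \<or> lt y z \<or> lt z y) \<and>
     (\<forall>x y. lt x y \<longrightarrow> lv x < lv y) \<and>
     (\<forall>x\<in>N. bij_betw lv {y. lt y x} {b. b < lv x})"

definition is_chain :: "'u set \<Rightarrow> ('u \<Rightarrow> 'u \<Rightarrow> bool) \<Rightarrow> 'u set \<Rightarrow> bool" where
  "is_chain N lt B \<longleftrightarrow> B \<subseteq> N \<and> (\<forall>x\<in>B. \<forall>y\<in>B. x = y \<or> lt x y \<or> lt y x)"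

definition is_branch :: "'u set \<Rightarrow> ('u \<Rightarrow> 'u \<Rightarrow> bool) \<Rightarrow> 'u set \<Rightarrow> bool" where
  "is_branch N lt B \<longleftrightarrow> is_chain N lt B \<and> (\<forall>C. is_chain N lt C \<and> B \<subseteq> C \<longrightarrow> C = B)"

definition aronszajn :: "'w::omega1 itself \<Rightarrow> 'u set \<Rightarrow> ('u \<Rightarrow> 'u \<Rightarrow> bool) \<Rightarrow> bool" where
  "aronszajn _ N lt \<longleftrightarrow>
     (\<exists>lv :: 'u \<Rightarrow> 'w. tree_levels N lt lv \<and> lv ` N = UNIV \<and>
        (\<forall>a. countable {x\<in>N. lv x = a})) \<and>
     (\<forall>B. is_branch N lt B \<longrightarrow> countable B)"

definition weakly_embeds ::
  "'u set \<Rightarrow> ('u \<Rightarrow> 'u \<Rightarrow> bool) \<Rightarrow> 'v set \<Rightarrow> ('v \<Rightarrow> 'v \<Rightarrow> bool) \<Rightarrow> bool" where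
  "weakly_embeds N1 lt1 N2 lt2 \<longleftrightarrow>
     (\<exists>f. (\<forall>x\<in>N1. f x \<in> N2) \<and> (\<forall>x\<in>N1. \<forall>y\<in>N1. lt1 x y \<longrightarrow> lt2 (f x) (f y)))"

text \<open>The ordinal omega*a + n < omega_1 is coded as the pair (a, n); then
ht(omega*a+n) = a.  The root is None (level -1); a node Some (a,n) must lie on
level a, i.e. level a is a subset of [omega*a, omega*a+omega).\<close>

type_synonym 'w node = "('w \<times> nat) option"

definition ht :: "'w node \<Rightarrow> 'w" where
  "ht x = fst (the x)"

definition in_A :: "'w::omega1 node set \<Rightarrow> ('w node \<Rightarrow> 'w node \<Rightarrow> bool) \<Rightarrow> bool" where
  "in_A N lt \<longleftrightarrow>
     None \<in> N \<and>
     (\<forall>x y. lt x y \<longrightarrow> x \<in> N \<and> y \<in> N) \<and>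
     (\<forall>x. \<not> lt x x) \<and>
     (\<forall>x y z. lt x y \<longrightarrow> lt y z \<longrightarrow> lt x z) \<and>
     (\<forall>x\<in>N. x \<noteq> None \<longrightarrow> lt None x) \<and>
     tree_levels (N - {None}) (\<lambda>x y. lt x y \<and> x \<noteq> None) ht \<and>
     (\<forall>a. \<exists>n. Some (a, n) \<in> N) \<and>
     (\<forall>B. is_branch N lt B \<longrightarrow> countable B) \<and>
     (\<forall>x\<in>N. \<forall>y\<in>N. x \<noteq> None \<and> y \<noteq> None \<and> ht x = ht y \<and> is_limit (ht x) \<and> x \<noteq> y
        \<longrightarrow> {z. lt z x} \<noteq> {z. lt z y})"

definition meet :: "'u set \<Rightarrow> ('u \<Rightarrow> 'u \<Rightarrow> bool) \<Rightarrow> 'u \<Rightarrow> 'u \<Rightarrow> 'u" where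
  "meet N lt x y = (THE z. z \<in> N \<and> (z = x \<or> lt z x) \<and> (z = y \<or> lt z y) \<and>
      (\<forall>w\<in>N. (w = x \<or> lt w x) \<and> (w = y \<or> lt w y) \<longrightarrow> (w = z \<or> lt w z)))"

definition incomparable :: "('u \<Rightarrow> 'u \<Rightarrow> bool) \<Rightarrow> 'u \<Rightarrow> 'u \<Rightarrow> bool" where
  "incomparable lt x y \<longleftrightarrow> x \<noteq> y \<and> \<not> lt x y \<and> \<not> lt y x"

text \<open>ht of a node, with the root counted as level -1: ht_greater a b means ht a > ht b.\<close>
definition ht_greater :: "'w::wellorder node \<Rightarrow> 'w node \<Rightarrow> bool" where
  "ht_greater a b \<longleftrightarrow> (case a of None \<Rightarrow> False
      | Some p \<Rightarrow> (case b of None \<Rightarrow> True | Some q \<Rightarrow> fst q < fst p))"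

definition limit_pair :: "'w::omega1 node set \<Rightarrow> 'w node set \<Rightarrow> 'w node \<Rightarrow> 'w node \<Rightarrow> bool" where
  "limit_pair N1 N2 x y \<longleftrightarrow> x \<in> N1 \<and> y \<in> N2 \<and> x \<noteq> None \<and> y \<noteq> None \<and>
      ht x = ht y \<and> is_limit (ht x)"

definition A2sp ::
  "'w::omega1 node set \<Rightarrow> ('w node \<Rightarrow> 'w node \<Rightarrow> bool) \<Rightarrow>
   'w node set \<Rightarrow> ('w node \<Rightarrow> 'w node \<Rightarrow> bool) \<Rightarrow> ('w node \<Rightarrow> 'w node \<Rightarrow> nat) \<Rightarrow> bool" where
  "A2sp N1 lt1 N2 lt2 c \<longleftrightarrow> in_A N1 lt1 \<and> in_A N2 lt2 \<and>
     (\<forall>x1 y1 x2 y2. limit_pair N1 N2 x1 y1 \<and> limit_pair N1 N2 x2 y2 \<and>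
        c x1 y1 = c x2 y2 \<and> (x1, y1) \<noteq> (x2, y2) \<longrightarrow>
        ht x1 \<noteq> ht x2 \<and> incomparable lt1 x1 x2 \<and> incomparable lt2 y1 y2 \<and>
        ht_greater (meet N1 lt1 x1 x2) (meet N2 lt2 y1 y2))"

text \<open>le p q means p is stronger than q.\<close>
definition forcing_notion :: "'q set \<Rightarrow> ('q \<Rightarrow> 'q \<Rightarrow> bool) \<Rightarrow> bool" where
  "forcing_notion P le \<longleftrightarrow> P \<noteq> {} \<and> (\<forall>p\<in>P. le p p) \<and>
     (\<forall>p\<in>P. \<forall>q\<in>P. \<forall>r\<in>P. le p q \<longrightarrow> le q r \<longrightarrow> le p r)"

definition compatible :: "'q set \<Rightarrow> ('q \<Rightarrow> 'q \<Rightarrow> bool) \<Rightarrow> 'q \<Rightarrow> 'q \<Rightarrow> bool" where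
  "compatible P le p q \<longleftrightarrow> (\<exists>r\<in>P. le r p \<and> le r q)"

definition antichain :: "'q set \<Rightarrow> ('q \<Rightarrow> 'q \<Rightarrow> bool) \<Rightarrow> 'q set \<Rightarrow> bool" where
  "antichain P le A \<longleftrightarrow> A \<subseteq> P \<and> (\<forall>p\<in>A. \<forall>q\<in>A. p \<noteq> q \<longrightarrow> \<not> compatible P le p q)"

definition ccc :: "'q set \<Rightarrow> ('q \<Rightarrow> 'q \<Rightarrow> bool) \<Rightarrow> bool" where
  "ccc P le \<longleftrightarrow> (\<forall>A. antichain P le A \<longrightarrow> countable A)"

definition dense :: "'q set \<Rightarrow> ('q \<Rightarrow> 'q \<Rightarrow> bool) \<Rightarrow> 'q set \<Rightarrow> bool" where
  "dense P le D \<longleftrightarrow> D \<subseteq> P \<and> (\<forall>p\<in>P. \<exists>q\<in>D. le q p)"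

definition is_filter :: "'q set \<Rightarrow> ('q \<Rightarrow> 'q \<Rightarrow> bool) \<Rightarrow> 'q set \<Rightarrow> bool" where
  "is_filter P le G \<longleftrightarrow> G \<subseteq> P \<and> G \<noteq> {} \<and>
     (\<forall>p\<in>G. \<forall>q\<in>P. le p q \<longrightarrow> q \<in> G) \<and>
     (\<forall>p\<in>G. \<forall>q\<in>G. \<exists>r\<in>G. le r p \<and> le r q)"

definition MA_omega1 :: "'q itself \<Rightarrow> 'w::omega1 itself \<Rightarrow> bool" where
  "MA_omega1 _ _ \<longleftrightarrow>
     (\<forall>(P :: 'q set) le. forcing_notion P le \<and> ccc P le \<longrightarrow>
        (\<forall>D :: 'w \<Rightarrow> 'q set. (\<forall>i. dense P le (D i)) \<longrightarrow>
           (\<exists>G. is_filter P le G \<and> (\<forall>i. G \<inter> D i \<noteq> {}))))"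

end

theory Submission
  imports Defs
begin

text \<open>A condition is a finite tree order R on the nodes \<open>'w \<times> nat\<close> together with a finite
partial colouring C that obeys the demands of a specialising colouring inside R; a stronger
condition may not add common lower bounds above the old meets. For the countable chain
condition, a Delta-system argument gives conditions \<open>P d\<close> with a fixed root below d and all other
levels above d; after uniformising isomorphism types, a uniform ultrafilter produces \<open>d < e\<close> such
that no target node of \<open>P d\<close> meets a target node of \<open>P e\<close> at level d or higher. Putting a new
node at level d below corresponding components of the two conditions makes all relevant meets
in the new tree longer than those in the given tree, so the union is a condition.

A weak embedding would send the meet of two equally coloured nodes to a common lower bound in
the given tree that is too high. For the statement on universality, an arbitrary Aronszajn tree
is first embedded into a normal one.\<close>

section \<open>Infinite combinatorics\<close>

text \<open>The given tree is fixed, so equal colours in two different conditions are harmless only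
  if the meet of the new nodes can still be raised above that of their targets. Level
  \<open>d\<close> is free for this in both conditions, but the node put there must not join two
  components of one condition, because a stronger condition may not create common lower bounds. So
  components are matched along the isomorphism, and equally coloured nodes from unmatched components
  need another witness: the first is replaced by its twin in the second condition, which has the
  same colour, and the common lower bound that the colouring provides there is used. It lies on a
  root level; hence it suffices that the target and the target of the twin have the same
  predecessors on root levels, and these are recorded along with order and colours.

  Pairs are coloured on all levels, not only on limit levels: since equally coloured nodes are
  incomparable, this keeps uncountable chains out of the new tree. Its levels are countable by the
  coding of nodes as pairs with a natural number.\<close>

lemma uncountable_fiber:
  assumes "\<not> countable A" "f ` A \<subseteq> B" "countable B"
  obtains b where "b \<in> B" "\<not> countable {a \<in> A. f a = b}"
proof -
  have "A = (\<Union>b\<in>B. {a \<in> A. f a = b})"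
    using assms(2) by auto
  then show ?thesis
    using assms(1,3) that by (metis (no_types, lifting) countable_UN)
qed

text \<open>Induction on the common size \<open>n\<close>. A point lying in uncountably many of the
  sets is removed from them and joins the root. If there is none, a maximal pairwise disjoint
  subfamily works with empty root: every set meets a member of it, so if it were countable, the
  whole index set would be.\<close>

lemma delta_system:
  fixes f :: "'i \<Rightarrow> 'a set"
  assumes "\<not> countable I" "\<And>i. i \<in> I \<Longrightarrow> finite (f i) \<and> card (f i) = n"
  shows "\<exists>J\<subseteq>I. \<exists>\<rho>. \<not> countable J \<and> (\<forall>i\<in>J. \<rho> \<subseteq> f i) \<and>
    (\<forall>i\<in>J. \<forall>j\<in>J. i \<noteq> j \<longrightarrow> f i \<inter> f j = \<rho>)"
  using assms
proof (induction n arbitrary: I f)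
  case 0
  then show ?case
    by (intro exI[of _ I] conjI order_refl exI[of _ "{}"]) fastforce+
next
  case (Suc n)
  show ?case
  proof (cases "\<exists>a. \<not> countable {i \<in> I. a \<in> f i}")
    case True
    then obtain a where a: "\<not> countable {i \<in> I. a \<in> f i}" by blast
    have "\<exists>J\<subseteq>{i \<in> I. a \<in> f i}. \<exists>\<rho>. \<not> countable J \<and> (\<forall>i\<in>J. \<rho> \<subseteq> f i - {a}) \<and>
      (\<forall>i\<in>J. \<forall>j\<in>J. i \<noteq> j \<longrightarrow> (f i - {a}) \<inter> (f j - {a}) = \<rho>)"
    proof (rule Suc.IH[OF a])
      show "finite (f i - {a}) \<and> card (f i - {a}) = n" if "i \<in> {i \<in> I. a \<in> f i}" for i
        using Suc.prems(2) that by auto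
    qed
    then obtain J \<rho> where J: "J \<subseteq> {i \<in> I. a \<in> f i}" "\<not> countable J"
      "\<forall>i\<in>J. \<rho> \<subseteq> f i - {a}"
      "\<forall>i\<in>J. \<forall>j\<in>J. i \<noteq> j \<longrightarrow> (f i - {a}) \<inter> (f j - {a}) = \<rho>"
      by (elim exE conjE)
    have "f i \<inter> f j = insert a \<rho>" if "i \<in> J" "j \<in> J" "i \<noteq> j" for i j
    proof -
      have "a \<in> f i" "a \<in> f j" "(f i - {a}) \<inter> (f j - {a}) = \<rho>"
        using J that by auto
      then show ?thesis by blast
    qed
    moreover have "insert a \<rho> \<subseteq> f i" if "i \<in> J" for i
      using J(1,3) that by blast
    ultimately show ?thesis
      using J(1,2) by (intro exI[of _ J] conjI exI[of _ "insert a \<rho>"]) auto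
  next
    case False
    define \<A> where "\<A> = {J. J \<subseteq> I \<and> (\<forall>i\<in>J. \<forall>j\<in>J. i \<noteq> j \<longrightarrow> f i \<inter> f j = {})}"
    have "\<exists>M\<in>\<A>. \<forall>X\<in>\<A>. M \<subseteq> X \<longrightarrow> X = M"
    proof (rule subset_Zorn')
      fix C assume C: "subset.chain \<A> C"
      then have sub: "C \<subseteq> \<A>" and lin: "\<And>X Y. X \<in> C \<Longrightarrow> Y \<in> C \<Longrightarrow> X \<subseteq> Y \<or> Y \<subseteq> X"
        by (auto simp: subset_chain_def)
      have "f i \<inter> f j = {}" if "i \<in> \<Union>C" "j \<in> \<Union>C" "i \<noteq> j" for i j
      proof -
        from that obtain X Y where "X \<in> C" "i \<in> X" "Y \<in> C" "j \<in> Y" by blast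
        then obtain Z where "Z \<in> C" "i \<in> Z" "j \<in> Z" using lin by blast
        then show ?thesis using sub that(3) unfolding \<A>_def by blast
      qed
      then show "\<Union>C \<in> \<A>" using sub by (auto simp: \<A>_def)
    qed
    then obtain J where J: "J \<in> \<A>" and max: "\<And>X. X \<in> \<A> \<Longrightarrow> J \<subseteq> X \<Longrightarrow> X = J"
      by blast
    have "I \<subseteq> (\<Union>a\<in>(\<Union>j\<in>J. f j). {i \<in> I. a \<in> f i})"
    proof
      fix i assume i: "i \<in> I"
      have "\<exists>j\<in>J. f i \<inter> f j \<noteq> {}"
      proof (cases "i \<in> J")
        case True
        moreover have "f i \<noteq> {}" using Suc.prems(2)[OF i] by auto
        ultimately show ?thesis by blast
      next
        case False
        have "insert i J \<notin> \<A>" using max[of "insert i J"] False by blast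
        then show ?thesis using J i by (fastforce simp: \<A>_def)
      qed
      then show "i \<in> (\<Union>a\<in>(\<Union>j\<in>J. f j). {i \<in> I. a \<in> f i})" using i by blast
    qed
    moreover have "countable (\<Union>a\<in>(\<Union>j\<in>J. f j). {i \<in> I. a \<in> f i})" if "countable J"
    proof -
      have "countable (\<Union>j\<in>J. f j)"
        using that J Suc.prems(2) by (intro countable_UN) (auto simp: \<A>_def intro: countable_finite)
      then show ?thesis by (rule countable_UN) (use False in blast)
    qed
    ultimately have "\<not> countable J" using Suc.prems(1) countable_subset by blast
    then show ?thesis
      using J by (intro exI[of _ J] conjI exI[of _ "{}"]) (auto simp: \<A>_def)
  qed
qed

text \<open>Zorn gives a maximal family whose finite intersections all meet \<open>E\<close>
  uncountably. If neither \<open>X\<close> nor its complement belonged to it, finitely many members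
  would cut both \<open>E \<inter> X\<close> and \<open>E - X\<close> down to countable sets, hence
  also \<open>E\<close>.\<close>

lemma uniform_ultrafilter:
  fixes E :: "'a set"
  assumes "\<not> countable E"
  obtains U where "\<And>X Y. X \<in> U \<Longrightarrow> Y \<in> U \<Longrightarrow> X \<inter> Y \<in> U"
    "\<And>X. X \<in> U \<Longrightarrow> \<not> countable (E \<inter> X)" "\<And>X. X \<in> U \<or> - X \<in> U"
proof -
  define \<A> where "\<A> = {U :: 'a set set. \<forall>F\<subseteq>U. finite F \<longrightarrow> \<not> countable (E \<inter> \<Inter>F)}"
  have "\<exists>M\<in>\<A>. \<forall>X\<in>\<A>. M \<subseteq> X \<longrightarrow> X = M"
  proof (rule subset_Zorn')
    fix C assume C: "subset.chain \<A> C"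
    have "\<not> countable (E \<inter> \<Inter>F)" if F: "F \<subseteq> \<Union>C" "finite F" for F
    proof (cases "C = {}")
      case True
      then show ?thesis using F assms by auto
    next
      case False
      then obtain X where "X \<in> C" "F \<subseteq> X"
        using finite_subset_Union_chain[OF F(2,1) False C] by blast
      then show ?thesis using C F(2) by (auto simp: subset_chain_def \<A>_def)
    qed
    then show "\<Union>C \<in> \<A>" by (auto simp: \<A>_def)
  qed
  then obtain U where UA: "U \<in> \<A>" and max: "\<And>X. X \<in> \<A> \<Longrightarrow> U \<subseteq> X \<Longrightarrow> X = U"
    by blast
  then have U: "\<not> countable (E \<inter> \<Inter>F)" if "F \<subseteq> U" "finite F" for F
    using that unfolding \<A>_def by simp
  have add: "X \<in> U" if "\<And>F. F \<subseteq> U \<Longrightarrow> finite F \<Longrightarrow> \<not> countable (E \<inter> X \<inter> \<Inter>F)" for X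
  proof -
    have "insert X U \<in> \<A>" unfolding \<A>_def
    proof (intro CollectI allI impI)
      fix F assume F: "F \<subseteq> insert X U" "finite F"
      have "\<not> countable (E \<inter> X \<inter> \<Inter>(F - {X}))"
      proof (rule that)
        show "F - {X} \<subseteq> U" "finite (F - {X})" using F by auto
      qed
      moreover have "E \<inter> X \<inter> \<Inter>(F - {X}) \<subseteq> E \<inter> \<Inter>F" by auto
      ultimately show "\<not> countable (E \<inter> \<Inter>F)" using countable_subset by blast
    qed
    then show ?thesis using max[of "insert X U"] by blast
  qed
  show thesis
  proof (rule that)
    fix X Y assume XY: "X \<in> U" "Y \<in> U"
    show "X \<inter> Y \<in> U"
    proof (rule add)
      fix F assume "F \<subseteq> U" "finite F"
      then have "\<not> countable (E \<inter> \<Inter>(insert X (insert Y F)))"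
        using XY by (intro U) auto
      then show "\<not> countable (E \<inter> (X \<inter> Y) \<inter> \<Inter>F)" by (simp add: Int_assoc)
    qed
  next
    fix X assume "X \<in> U"
    then have "\<not> countable (E \<inter> \<Inter>{X})" by (intro U) auto
    then show "\<not> countable (E \<inter> X)" by simp
  next
    fix X show "X \<in> U \<or> - X \<in> U"
    proof (rule ccontr)
      assume "\<not> (X \<in> U \<or> - X \<in> U)"
      then obtain F G where F: "F \<subseteq> U" "finite F" "countable (E \<inter> X \<inter> \<Inter>F)"
        and G: "G \<subseteq> U" "finite G" "countable (E \<inter> - X \<inter> \<Inter>G)"
        using add[of X] add[of "- X"] by blast
      have "countable (E \<inter> X \<inter> \<Inter>F \<union> E \<inter> - X \<inter> \<Inter>G)" using F G by blast
      moreover have "E \<inter> \<Inter>(F \<union> G) \<subseteq> E \<inter> X \<inter> \<Inter>F \<union> E \<inter> - X \<inter> \<Inter>G" by auto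
      ultimately have "countable (E \<inter> \<Inter>(F \<union> G))" using countable_subset by blast
      moreover have "F \<union> G \<subseteq> U" "finite (F \<union> G)" using F G by auto
      ultimately show False using U by blast
    qed
  qed
qed

text \<open>The complements of the finitely many sets belong to the ultrafilter, and so does their
  intersection. This is the pigeonhole principle behind \<open>separated_pair\<close>.\<close>

lemma ultrafilter_finite_UN:
  assumes "\<And>X Y. X \<in> U \<Longrightarrow> Y \<in> U \<Longrightarrow> X \<inter> Y \<in> U"
    "\<And>X. X \<in> U \<Longrightarrow> \<not> countable (E \<inter> X)" "\<And>X. X \<in> U \<or> - X \<in> U"
  assumes "finite K" "\<And>k. k \<in> K \<Longrightarrow> A k \<notin> U" "\<not> countable E"
  shows "\<not> countable (E - (\<Union>k\<in>K. A k))"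
proof -
  have "- (\<Union>k\<in>K. A k) \<in> U" using assms(4,5)
  proof (induction K rule: finite_induct)
    case empty
    then show ?case using assms(2,3)[of "{}"] by fastforce
  next
    case (insert k K)
    have "- A k \<in> U" using insert.prems assms(3) by blast
    then have "- A k \<inter> - (\<Union>k\<in>K. A k) \<in> U" using insert by (intro assms(1)) auto
    then show ?case by (simp add: Compl_Un)
  qed
  from assms(2)[OF this] show ?thesis by (simp add: Diff_eq)
qed

text \<open>The definitions restrict only maximal chains; Zorn extends an arbitrary chain to a
  branch.\<close>

lemma countable_chain:
  assumes "\<And>B. is_branch N lt B \<Longrightarrow> countable B" "is_chain N lt B"
  shows "countable B"
proof -
  define \<A> where "\<A> = {C. is_chain N lt C \<and> B \<subseteq> C}"
  have "\<exists>M\<in>\<A>. \<forall>X\<in>\<A>. M \<subseteq> X \<longrightarrow> X = M"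
  proof (rule subset_Zorn_nonempty)
    show "\<A> \<noteq> {}" using assms(2) by (auto simp: \<A>_def)
    fix C assume C: "C \<noteq> {}" "subset.chain \<A> C"
    then have sub: "C \<subseteq> \<A>" and lin: "\<And>X Y. X \<in> C \<Longrightarrow> Y \<in> C \<Longrightarrow> X \<subseteq> Y \<or> Y \<subseteq> X"
      by (auto simp: subset_chain_def)
    have "x = y \<or> lt x y \<or> lt y x" if "x \<in> \<Union>C" "y \<in> \<Union>C" for x y
    proof -
      from that obtain X Y where "X \<in> C" "x \<in> X" "Y \<in> C" "y \<in> Y" by blast
      then obtain Z where "Z \<in> C" "x \<in> Z" "y \<in> Z" using lin by blast
      then show ?thesis using sub by (auto simp: \<A>_def is_chain_def)
    qed
    moreover have "B \<subseteq> \<Union>C" "\<Union>C \<subseteq> N"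
      using sub C(1) unfolding \<A>_def is_chain_def by blast+
    ultimately show "\<Union>C \<in> \<A>" by (auto simp: \<A>_def is_chain_def)
  qed
  then obtain M where M: "M \<in> \<A>" "\<forall>X\<in>\<A>. M \<subseteq> X \<longrightarrow> X = M" by blast
  then have "is_branch N lt M" unfolding is_branch_def \<A>_def by auto
  then show ?thesis using assms(1) M(1) countable_subset by (auto simp: \<A>_def)
qed

section \<open>Order on the non-root nodes of a tree in the class\<close>

definition tle :: "('w node \<Rightarrow> 'w node \<Rightarrow> bool) \<Rightarrow> 'w \<times> nat \<Rightarrow> 'w \<times> nat \<Rightarrow> bool" where
  "tle lt v y \<longleftrightarrow> v = y \<or> lt (Some v) (Some y)"

lemma ht_Some [simp]: "ht (Some s) = fst s"
  by (simp add: ht_def)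

locale normal_tree =
  fixes N :: "'w::omega1 node set" and lt
  assumes A: "in_A N lt"
begin

lemma None_in: "None \<in> N"
  and lt_in': "\<forall>x y. lt x y \<longrightarrow> x \<in> N \<and> y \<in> N"
  and lt_irrefl': "\<forall>x. \<not> lt x x"
  and lt_trans': "\<forall>x y z. lt x y \<longrightarrow> lt y z \<longrightarrow> lt x z"
  and lt_None: "\<forall>x\<in>N. x \<noteq> None \<longrightarrow> lt None x"
  and levels: "tree_levels (N - {None}) (\<lambda>x y. lt x y \<and> x \<noteq> None) ht"
  and level_nonempty: "\<forall>a. \<exists>n. Some (a, n) \<in> N"
  and branch_countable: "\<forall>B. is_branch N lt B \<longrightarrow> countable B"
  and normal: "\<forall>x\<in>N. \<forall>y\<in>N. x \<noteq> None \<and> y \<noteq> None \<and> ht x = ht y \<and> is_limit (ht x) \<and> x \<noteq> y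
        \<longrightarrow> {z. lt z x} \<noteq> {z. lt z y}"
  by (insert A, unfold in_A_def, elim conjE, assumption)+

lemmas lt_in = lt_in'[rule_format] and lt_trans = lt_trans'[rule_format] and lt_irrefl = lt_irrefl'[rule_format]

lemma not_lt_None: "\<not> lt x None"
proof
  assume x: "lt x None"
  then have "lt None x" using lt_None lt_in lt_irrefl by (cases "x = None") auto
  then show False using x lt_trans lt_irrefl by blast
qed

lemma lt_level: "lt (Some s) (Some t) \<Longrightarrow> fst s < fst t"
proof -
  assume "lt (Some s) (Some t)"
  moreover have "\<forall>x y. lt x y \<and> x \<noteq> None \<longrightarrow> ht x < ht y"
    using levels unfolding tree_levels_def by (elim conjE)
  ultimately show ?thesis by fastforce
qed

lemma lt_linear: "lt (Some s) x \<Longrightarrow> lt (Some t) x \<Longrightarrow> s = t \<or> lt (Some s) (Some t) \<or> lt (Some t) (Some s)"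
proof -
  assume st: "lt (Some s) x" "lt (Some t) x"
  then have "x \<in> N - {None}" using lt_in not_lt_None by blast
  moreover have "\<forall>x\<in>N - {None}. \<forall>y z. lt y x \<and> y \<noteq> None \<longrightarrow> lt z x \<and> z \<noteq> None \<longrightarrow>
      y = z \<or> (lt y z \<and> y \<noteq> None) \<or> (lt z y \<and> z \<noteq> None)"
    using levels unfolding tree_levels_def by (elim conjE)
  ultimately show ?thesis using st by blast
qed

lemma lt_restrict: "Some t \<in> N \<Longrightarrow> b < fst t \<Longrightarrow> \<exists>n. lt (Some (b, n)) (Some t)"
proof -
  assume t: "Some t \<in> N" "b < fst t"
  have "bij_betw ht {y. lt y (Some t) \<and> y \<noteq> None} {b. b < ht (Some t)}"
    using levels t(1) unfolding tree_levels_def by blast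
  then have "b \<in> ht ` {y. lt y (Some t) \<and> y \<noteq> None}" using t(2) by (simp add: bij_betw_def)
  then show ?thesis by fastforce
qed

abbreviation le (infix "\<preceq>" 50) where "s \<preceq> t \<equiv> tle lt s t"

lemma le_refl [simp]: "s \<preceq> s"
  by (simp add: tle_def)

lemma le_trans: "r \<preceq> s \<Longrightarrow> s \<preceq> t \<Longrightarrow> r \<preceq> t"
  by (auto simp: tle_def intro: lt_trans)

lemma le_level: "s \<preceq> t \<Longrightarrow> s = t \<or> fst s < fst t"
  by (auto simp: tle_def dest: lt_level)

lemma le_in: "s \<preceq> t \<Longrightarrow> Some t \<in> N \<Longrightarrow> Some s \<in> N"
  by (auto simp: tle_def dest: lt_in)

lemma le_linear: "s \<preceq> x \<Longrightarrow> t \<preceq> x \<Longrightarrow> s \<preceq> t \<or> t \<preceq> s"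
  by (auto simp: tle_def dest: lt_linear)

lemma le_linear_level: "s \<preceq> x \<Longrightarrow> t \<preceq> x \<Longrightarrow> fst s \<le> fst t \<Longrightarrow> s \<preceq> t"
  using le_linear[of s x t] le_level[of t s] by auto

lemma le_restrict:
  assumes "Some t \<in> N" "b \<le> fst t"
  obtains s where "fst s = b" "s \<preceq> t"
proof (cases "b = fst t")
  case False
  then obtain n where "lt (Some (b, n)) (Some t)"
    using lt_restrict[OF assms(1), of b] assms(2) by (meson order_le_neq_trans)
  then show ?thesis using that[of "(b, n)"] by (simp add: tle_def)
qed (use that[of t] in simp)

lemma node_chain_countable:
  assumes "\<And>s t. s \<in> B \<Longrightarrow> t \<in> B \<Longrightarrow> Some s \<in> N \<and> (s \<preceq> t \<or> t \<preceq> s)"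
  shows "countable B"
proof -
  have "is_chain N lt (Some ` B)" unfolding is_chain_def using assms by (fastforce simp: tle_def)
  then have "countable (Some ` B)" using countable_chain[of N lt] branch_countable by blast
  then show ?thesis by (simp add: countable_image_inj_eq)
qed

text \<open>For a uniform ultrafilter on E, every node set Y d contains a node below the same
coordinate of almost all later Y e; uncountably many d share that coordinate, which
yields an uncountable chain.\<close>

lemma separated_pair:
  fixes Y :: "'w \<Rightarrow> ('w \<times> nat) set"
  assumes E: "\<not> countable E" and fin: "\<And>d. d \<in> E \<Longrightarrow> finite (Y d)"
    and Y: "\<And>d y. d \<in> E \<Longrightarrow> y \<in> Y d \<Longrightarrow> Some y \<in> N"
  obtains d e where "d \<in> E" "e \<in> E" "d < e"
    "\<And>y y' v. y \<in> Y d \<Longrightarrow> y' \<in> Y e \<Longrightarrow> v \<preceq> y \<Longrightarrow> v \<preceq> y' \<Longrightarrow> fst v \<noteq> d"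
proof -
  note sep = that
  obtain n where n: "\<not> countable {d \<in> E. card (Y d) = n}"
    by (rule uncountable_fiber[OF E, of "\<lambda>d. card (Y d)" UNIV]) auto
  define E' where "E' = {d \<in> E. card (Y d) = n}"
  have unc: "\<not> countable E'" using n by (simp add: E'_def)
  \<comment> \<open>\<open>g d\<close> lists \<open>Y d\<close> with indices below the common size
    \<open>n\<close>; these indices are the coordinates.\<close>
  define g where "g d = inv_into (Y d) (to_nat_on (Y d))" for d
  have Yg: "Y d = g d ` {..<n}" if "d \<in> E'" for d
  proof -
    have "bij_betw (to_nat_on (Y d)) (Y d) {..<n}"
      using to_nat_on_finite[of "Y d"] fin that by (auto simp: E'_def)
    then show ?thesis using bij_betw_inv_into[of _ "Y d"] by (metis g_def bij_betw_imp_surj_on)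
  qed
  obtain U where U: "\<And>X Y. X \<in> U \<Longrightarrow> Y \<in> U \<Longrightarrow> X \<inter> Y \<in> U"
    "\<And>X. X \<in> U \<Longrightarrow> \<not> countable (E' \<inter> X)" "\<And>X. X \<in> U \<or> - X \<in> U"
    using uniform_ultrafilter[OF unc] by blast
  show ?thesis
  proof (rule ccontr)
    assume nt: "\<not> ?thesis"
    have bad: "\<exists>y\<in>Y d. \<exists>j<n. \<exists>v. v \<preceq> y \<and> v \<preceq> g e j \<and> fst v = d"
      if "d \<in> E'" and e: "e \<in> E'" and de: "d < e" for d e
    proof -
      have "d \<in> E" "e \<in> E" using that by (auto simp: E'_def)
      then obtain y y' v where *: "y \<in> Y d" "y' \<in> Y e" "v \<preceq> y" "v \<preceq> y'" "fst v = d"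
        using nt de sep by blast
      moreover from *(2) obtain j where "j < n" "y' = g e j" using Yg[OF e] by auto
      ultimately show ?thesis by blast
    qed
    \<comment> \<open>Otherwise, for this \<open>d\<close>, none of the finitely many sets
      \<open>A (y, j)\<close> is in the ultrafilter, although by \<open>bad\<close> they cover all
      of \<open>E'\<close> above \<open>d\<close>.\<close>
    have "\<exists>v. \<exists>j<n. fst v = d \<and> {e. v \<preceq> g e j} \<in> U" if d: "d \<in> E'" for d
    proof (rule ccontr)
      assume neg: "\<not> ?thesis"
      define A where "A = (\<lambda>(y, j). {e. \<exists>v. v \<preceq> y \<and> v \<preceq> g e j \<and> fst v = d})"
      have "A k \<notin> U" if "k \<in> Y d \<times> {..<n}" for k
      proof -
        from that obtain y j where k: "k = (y, j)" "y \<in> Y d" "j < n" by blast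
        then have yN: "Some y \<in> N" using Y[of d y] d by (simp add: E'_def)
        show ?thesis
        proof (cases "d \<le> fst y")
          case True
          then obtain s where s: "fst s = d" "s \<preceq> y" using le_restrict[OF yN] by blast
          have "A k = {e. s \<preceq> g e j}"
          proof -
            have "v = s" if "v \<preceq> y" "fst v = d" for v
              using le_linear[OF that(1) s(2)] le_level[of v s] le_level[of s v] that(2) s(1) by auto
            then have "(\<exists>v. v \<preceq> y \<and> v \<preceq> g e j \<and> fst v = d) \<longleftrightarrow> s \<preceq> g e j" for e
              using s by blast
            then show ?thesis by (simp add: A_def k)
          qed
          then show ?thesis using neg s k(3) by metis
        next
          case False
          then have "\<not> (\<exists>v. v \<preceq> y \<and> v \<preceq> g e j \<and> fst v = d)" for e
            using le_level by fastforce
          then have "A k = {}" by (simp add: A_def k)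
          then show ?thesis using U(2)[of "{}"] by auto
        qed
      qed
      then have "\<not> countable (E' - (\<Union>k\<in>Y d \<times> {..<n}. A k))"
        using fin d by (intro ultrafilter_finite_UN[OF U] unc) (auto simp: E'_def)
      moreover have "E' - (\<Union>k\<in>Y d \<times> {..<n}. A k) \<subseteq> {e. e < d} \<union> {d}"
      proof
        fix e assume e: "e \<in> E' - (\<Union>k\<in>Y d \<times> {..<n}. A k)"
        have "\<not> d < e" using bad[OF d, of e] e by (fastforce simp: A_def)
        then show "e \<in> {e. e < d} \<union> {d}" by auto
      qed
      ultimately show False
        using countable_subset omega1_countable_below by (metis countable_Un countable_finite finite.intros)
    qed
    then obtain v j where vj: "\<And>d. d \<in> E' \<Longrightarrow> j d < n \<and> fst (v d) = d \<and> {e. v d \<preceq> g e (j d)} \<in> U"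
      by metis
    obtain i :: nat where i: "\<not> countable {d \<in> E'. j d = i}"
      by (rule uncountable_fiber[OF unc, of j UNIV]) auto
    define F where "F = {d \<in> E'. j d = i}"
    have "Some s \<in> N \<and> (s \<preceq> t \<or> t \<preceq> s)" if "s \<in> v ` F" "t \<in> v ` F" for s t
    proof -
      from that obtain d d' where d: "d \<in> F" "s = v d" "d' \<in> F" "t = v d'" by blast
      \<comment> \<open>Both sets are in the ultrafilter, so a single \<open>g e i\<close> lies
        above \<open>s\<close> and \<open>t\<close>, which makes them comparable.\<close>
      have "{e. s \<preceq> g e i} \<in> U" "{e. t \<preceq> g e i} \<in> U" using vj d by (fastforce simp: F_def)+
      then have "\<not> countable (E' \<inter> ({e. s \<preceq> g e i} \<inter> {e. t \<preceq> g e i}))"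
        using U(1,2) by blast
      then have "E' \<inter> ({e. s \<preceq> g e i} \<inter> {e. t \<preceq> g e i}) \<noteq> {}"
        by (metis countable_empty)
      moreover have "i < n" using vj d by (auto simp: F_def)
      ultimately obtain e where e: "e \<in> E'" "s \<preceq> g e i" "t \<preceq> g e i"
        by blast
      have "Some (g e i) \<in> N" using Yg[OF e(1)] Y[of e] e(1) \<open>i < n\<close> by (auto simp: E'_def)
      then show ?thesis using e le_in le_linear by blast
    qed
    then have "countable (v ` F)" by (rule node_chain_countable)
    moreover have "inj_on v F" using vj by (metis (no_types, lifting) F_def inj_onI mem_Collect_eq)
    ultimately show False using i by (simp add: F_def countable_image_inj_eq)
  qed
qed

end

section \<open>Conditions\<close>

text \<open>The relation is reflexive on its field, so \<open>(x, x) \<in> R\<close> expresses that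
  \<open>x\<close> is a node. Levels are fixed by the first coordinate, and predecessors may skip
  levels; the missing ones are filled in by density.\<close>

definition finite_tree :: "('w::order \<times> nat) rel \<Rightarrow> bool" where
  "finite_tree R \<longleftrightarrow> finite R \<and> trans R \<and>
     (\<forall>x y. (x, y) \<in> R \<longrightarrow> (x, x) \<in> R \<and> (y, y) \<in> R \<and> (x = y \<or> fst x < fst y)) \<and>
     (\<forall>x y z. (y, x) \<in> R \<longrightarrow> (z, x) \<in> R \<longrightarrow> (y, z) \<in> R \<or> (z, y) \<in> R)"

lemma finite_treeI:
  assumes "finite R" "\<And>x y z. (x, y) \<in> R \<Longrightarrow> (y, z) \<in> R \<Longrightarrow> (x, z) \<in> R"
    "\<And>x y. (x, y) \<in> R \<Longrightarrow> (x, x) \<in> R \<and> (y, y) \<in> R \<and> (x = y \<or> fst x < fst y)"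
    "\<And>x y z. (y, x) \<in> R \<Longrightarrow> (z, x) \<in> R \<Longrightarrow> (y, z) \<in> R \<or> (z, y) \<in> R"
  shows "finite_tree R"
  unfolding finite_tree_def using assms by (metis transI)

context
  fixes R :: "('w::order \<times> nat) rel"
  assumes R: "finite_tree R"
begin

lemma ft_finite: "finite R"
  and ft_trans: "(x, y) \<in> R \<Longrightarrow> (y, z) \<in> R \<Longrightarrow> (x, z) \<in> R"
  and ft_refl: "(x, y) \<in> R \<Longrightarrow> (x, x) \<in> R" "(x, y) \<in> R \<Longrightarrow> (y, y) \<in> R"
  and ft_level: "(x, y) \<in> R \<Longrightarrow> x = y \<or> fst x < fst y"
  and ft_linear: "(y, x) \<in> R \<Longrightarrow> (z, x) \<in> R \<Longrightarrow> (y, z) \<in> R \<or> (z, y) \<in> R"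
  by (use R in \<open>unfold finite_tree_def, blast dest: transD\<close>)+

lemma ft_level_le: "(x, y) \<in> R \<Longrightarrow> fst x \<le> fst y"
  using ft_level by fastforce

end

lemma ft_below:
  fixes R :: "('w::linorder \<times> nat) rel"
  assumes R: "finite_tree R" and xy: "(x, z) \<in> R" "(y, z) \<in> R" "fst x \<le> fst y"
  shows "(x, y) \<in> R"
  using ft_linear[OF R xy(1,2)] ft_level[OF R, of y x] xy(3) by auto

type_synonym 'w cond = "('w \<times> nat) rel \<times> ((('w \<times> nat) \<times> ('w \<times> nat)) \<times> nat) set"

text \<open>The last clause has a consequence for components: two nodes of \<open>p\<close> without
  a common lower bound in \<open>p\<close> never get one, so their meet in the generic tree is the
  root.\<close>

definition stronger :: "'w cond \<Rightarrow> 'w cond \<Rightarrow> bool" where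
  "stronger q p \<longleftrightarrow> fst p \<subseteq> fst q \<and> snd p \<subseteq> snd q \<and>
     (\<forall>x y z. (x, x) \<in> fst p \<longrightarrow> (y, y) \<in> fst p \<longrightarrow> (z, x) \<in> fst q \<longrightarrow> (z, y) \<in> fst q \<longrightarrow>
        (\<exists>t. (t, x) \<in> fst p \<and> (t, y) \<in> fst p \<and> (z, t) \<in> fst q))"

text \<open>Incomparability of \<open>y1\<close> and \<open>y2\<close> is a consequence: if
  \<open>y1\<close> were below \<open>y2\<close>, then \<open>v = y1\<close> would give
  \<open>fst y1 < fst z\<close>, but \<open>z\<close> lies below \<open>x1\<close>, which has the
  level of \<open>y1\<close>.\<close>

definition colouring ::
  "('w::order node \<Rightarrow> 'w node \<Rightarrow> bool) \<Rightarrow> 'w node set \<Rightarrow> ('w \<times> nat) rel \<Rightarrow>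
    ((('w \<times> nat) \<times> ('w \<times> nat)) \<times> nat) set \<Rightarrow> bool" where
  "colouring lt N R C \<longleftrightarrow> finite C \<and> single_valued C \<and>
     (\<forall>x y k. ((x, y), k) \<in> C \<longrightarrow> (x, x) \<in> R \<and> Some y \<in> N \<and> fst y = fst x) \<and>
     (\<forall>x1 y1 x2 y2 k. ((x1, y1), k) \<in> C \<longrightarrow> ((x2, y2), k) \<in> C \<longrightarrow> (x1, y1) \<noteq> (x2, y2) \<longrightarrow>
        fst x1 \<noteq> fst x2 \<and> (x1, x2) \<notin> R \<and>
        (\<exists>z. (z, x1) \<in> R \<and> (z, x2) \<in> R \<and> (\<forall>v. tle lt v y1 \<longrightarrow> tle lt v y2 \<longrightarrow> fst v < fst z)))"

lemma colouringI:
  assumes "finite C" "\<And>x y k k'. ((x, y), k) \<in> C \<Longrightarrow> ((x, y), k') \<in> C \<Longrightarrow> k = k'"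
    "\<And>x y k. ((x, y), k) \<in> C \<Longrightarrow> (x, x) \<in> R \<and> Some y \<in> N \<and> fst y = fst x"
    "\<And>x1 y1 x2 y2 k. ((x1, y1), k) \<in> C \<Longrightarrow> ((x2, y2), k) \<in> C \<Longrightarrow> (x1, y1) \<noteq> (x2, y2) \<Longrightarrow>
        fst x1 \<noteq> fst x2 \<and> (x1, x2) \<notin> R \<and>
        (\<exists>z. (z, x1) \<in> R \<and> (z, x2) \<in> R \<and> (\<forall>v. tle lt v y1 \<longrightarrow> tle lt v y2 \<longrightarrow> fst v < fst z))"
  shows "colouring lt N R C"
  unfolding colouring_def
proof (intro conjI)
  show "single_valued C" using assms(2) by (auto simp: single_valued_def)
qed (use assms(1,3) in blast, use assms(3) in blast, intro allI impI, rule assms(4))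

context
  fixes lt and N and R :: "('w::order \<times> nat) rel" and C
  assumes C: "colouring lt N R C"
begin

lemma col_finite: "finite C"
  and col_unique: "((x, y), k) \<in> C \<Longrightarrow> ((x, y), k') \<in> C \<Longrightarrow> k = k'"
  and col_dom: "((x, y), k) \<in> C \<Longrightarrow> (x, x) \<in> R" "((x, y), k) \<in> C \<Longrightarrow> Some y \<in> N"
    "((x, y), k) \<in> C \<Longrightarrow> fst y = fst x"
  by (use C in \<open>unfold colouring_def, blast dest: single_valuedD\<close>)+

lemma col_same:
  assumes "((x1, y1), k) \<in> C" "((x2, y2), k) \<in> C" "(x1, y1) \<noteq> (x2, y2)"
  shows "fst x1 \<noteq> fst x2" "(x1, x2) \<notin> R"
    "\<exists>z. (z, x1) \<in> R \<and> (z, x2) \<in> R \<and> (\<forall>v. tle lt v y1 \<longrightarrow> tle lt v y2 \<longrightarrow> fst v < fst z)"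
  using C assms unfolding colouring_def by metis+

end

definition Cond :: "('w::order node \<Rightarrow> 'w node \<Rightarrow> bool) \<Rightarrow> 'w node set \<Rightarrow> 'w cond set" where
  "Cond lt N = {(R, C). finite_tree R \<and> colouring lt N R C}"

lemma stronger_trans:
  assumes "finite_tree (fst r)" "stronger r q" "stronger q p"
  shows "stronger r p"
  unfolding stronger_def
proof (intro conjI allI impI)
  show "fst p \<subseteq> fst r" "snd p \<subseteq> snd r" using assms by (auto simp: stronger_def)
  fix x y z
  assume *: "(x, x) \<in> fst p" "(y, y) \<in> fst p" "(z, x) \<in> fst r" "(z, y) \<in> fst r"
  then have "(x, x) \<in> fst q" "(y, y) \<in> fst q" using assms(3) by (auto simp: stronger_def)
  then obtain t where t: "(t, x) \<in> fst q" "(t, y) \<in> fst q" "(z, t) \<in> fst r"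
    using assms(2) * unfolding stronger_def by meson
  then obtain s where s: "(s, x) \<in> fst p" "(s, y) \<in> fst p" "(t, s) \<in> fst q"
    using assms(3) * unfolding stronger_def by meson
  then have "(t, s) \<in> fst r" using assms(2) by (auto simp: stronger_def)
  then show "\<exists>t. (t, x) \<in> fst p \<and> (t, y) \<in> fst p \<and> (z, t) \<in> fst r"
    using s t ft_trans[OF assms(1)] by blast
qed

text \<open>With \<open>z = x\<close>, the clause on lower bounds yields an old \<open>t\<close>
  with \<open>x\<close> below \<open>t\<close> and \<open>t\<close> below \<open>x\<close>, so
  \<open>t = x\<close>.\<close>

lemma stronger_reflects:
  assumes "finite_tree (fst q)" "stronger q p" "(x, x) \<in> fst p" "(y, y) \<in> fst p" "(x, y) \<in> fst q"
  shows "(x, y) \<in> fst p"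
proof -
  have "(x, x) \<in> fst q" using assms ft_refl by blast
  then obtain t where t: "(t, x) \<in> fst p" "(t, y) \<in> fst p" "(x, t) \<in> fst q"
    using assms unfolding stronger_def by meson
  then have "(t, x) \<in> fst q" using assms(2) by (auto simp: stronger_def)
  then have "t = x" using t(3) ft_level[OF assms(1)] by (metis order_less_asym)
  then show ?thesis using t by blast
qed

text \<open>Agreement up to level \<open>d\<close> and disjointness of the levels above it make both
  orders downward closed in the union, so neither condition receives new relations or new lower
  bounds among its nodes. Colours can then clash only between two pairs above \<open>d\<close>, one
  from each condition; \<open>cross\<close> takes care of these.\<close>

lemma amalgamation:
  fixes R1 :: "('w::linorder \<times> nat) rel"
  assumes R1: "finite_tree R1" and R2: "finite_tree R2"
    and C1: "colouring lt N R1 C1" and C2: "colouring lt N R2 C2"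
    and R: "\<And>x y. fst y \<le> d \<Longrightarrow> (x, y) \<in> R1 \<longleftrightarrow> (x, y) \<in> R2"
    and C: "\<And>x y k. fst x \<le> d \<Longrightarrow> ((x, y), k) \<in> C1 \<longleftrightarrow> ((x, y), k) \<in> C2"
    and disj: "\<And>x y. (x, x) \<in> R1 \<Longrightarrow> (y, y) \<in> R2 \<Longrightarrow> fst x = fst y \<Longrightarrow> fst x \<le> d"
    and cross: "\<And>x1 y1 x2 y2 k. ((x1, y1), k) \<in> C1 \<Longrightarrow> ((x2, y2), k) \<in> C2 \<Longrightarrow>
      d < fst x1 \<Longrightarrow> d < fst x2 \<Longrightarrow>
      \<exists>z. (z, x1) \<in> R1 \<and> (z, x2) \<in> R2 \<and> (\<forall>v. tle lt v y1 \<longrightarrow> tle lt v y2 \<longrightarrow> fst v < fst z)"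
  shows "(R1 \<union> R2, C1 \<union> C2) \<in> Cond lt N"
    and "stronger (R1 \<union> R2, C1 \<union> C2) (R1, C1)" "stronger (R1 \<union> R2, C1 \<union> C2) (R2, C2)"
proof -
  note ft1 = ft_trans[OF R1] ft_refl[OF R1] ft_level[OF R1] ft_linear[OF R1]
  note ft2 = ft_trans[OF R2] ft_refl[OF R2] ft_level[OF R2] ft_linear[OF R2]
  have both: "fst x \<le> d" if "(x, x) \<in> R1" "(x, x) \<in> R2" for x
    using disj that by blast
  have down1: "(x, y) \<in> R1" if "(x, y) \<in> R1 \<union> R2" "(y, y) \<in> R1" for x y
    using that R both ft2 by blast
  have down2: "(x, y) \<in> R2" if "(x, y) \<in> R1 \<union> R2" "(y, y) \<in> R2" for x y
    using that R both ft1 by blast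
  show "stronger (R1 \<union> R2, C1 \<union> C2) (R1, C1)" "stronger (R1 \<union> R2, C1 \<union> C2) (R2, C2)"
    unfolding stronger_def fst_conv snd_conv
    by (intro conjI allI impI Un_upper1 Un_upper2, use down1 ft1 in blast,
        intro conjI allI impI Un_upper1 Un_upper2, use down2 ft2 in blast)
  have "finite_tree (R1 \<union> R2)"
  proof (rule finite_treeI)
    show "finite (R1 \<union> R2)" using ft_finite R1 R2 by blast
  next
    fix x y z assume xyz: "(x, y) \<in> R1 \<union> R2" "(y, z) \<in> R1 \<union> R2"
    show "(x, z) \<in> R1 \<union> R2"
    proof (cases "(y, z) \<in> R1")
      case True
      then show ?thesis using down1[OF xyz(1)] ft1 by blast
    next
      case False
      then show ?thesis using down2[OF xyz(1)] xyz(2) ft2 by blast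
    qed
  next
    fix x y assume "(x, y) \<in> R1 \<union> R2"
    then show "(x, x) \<in> R1 \<union> R2 \<and> (y, y) \<in> R1 \<union> R2 \<and> (x = y \<or> fst x < fst y)"
      using ft1(2,3,4)[of x y] ft2(2,3,4)[of x y] by blast
  next
    fix x y z assume xyz: "(y, x) \<in> R1 \<union> R2" "(z, x) \<in> R1 \<union> R2"
    show "(y, z) \<in> R1 \<union> R2 \<or> (z, y) \<in> R1 \<union> R2"
    proof (cases "(x, x) \<in> R1")
      case True
      then show ?thesis using ft1(5)[OF down1[OF xyz(1)] down1[OF xyz(2)]] by blast
    next
      case False
      then have "(x, x) \<in> R2" using xyz(1) ft1(3)[of y x] ft2(3)[of y x] by blast
      then show ?thesis using ft2(5)[OF down2[OF xyz(1)] down2[OF xyz(2)]] by blast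
    qed
  qed
  moreover have "colouring lt N (R1 \<union> R2) (C1 \<union> C2)"
  proof (rule colouringI)
    show "finite (C1 \<union> C2)" using col_finite C1 C2 by blast
    have eq: "((x, y), k) \<in> C2" if "((x, y), k) \<in> C1" "(x, x) \<in> R2" for x y k
      using that both col_dom(1)[OF C1] C by blast
    have eq': "((x, y), k) \<in> C1" if "((x, y), k) \<in> C2" "(x, x) \<in> R1" for x y k
      using that both col_dom(1)[OF C2] C by blast
    show "k = k'" if "((x, y), k) \<in> C1 \<union> C2" "((x, y), k') \<in> C1 \<union> C2" for x y k k'
      using that eq eq' col_unique[OF C1] col_unique[OF C2] col_dom(1)[OF C1] col_dom(1)[OF C2] by blast
    show "(x, x) \<in> R1 \<union> R2 \<and> Some y \<in> N \<and> fst y = fst x" if "((x, y), k) \<in> C1 \<union> C2" for x y k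
      using that col_dom[OF C1] col_dom[OF C2] by blast
    fix x1 y1 x2 y2 k
    assume *: "((x1, y1), k) \<in> C1 \<union> C2" "((x2, y2), k) \<in> C1 \<union> C2" "(x1, y1) \<noteq> (x2, y2)"
    show "fst x1 \<noteq> fst x2 \<and> (x1, x2) \<notin> R1 \<union> R2 \<and> (\<exists>z. (z, x1) \<in> R1 \<union> R2 \<and>
        (z, x2) \<in> R1 \<union> R2 \<and> (\<forall>v. tle lt v y1 \<longrightarrow> tle lt v y2 \<longrightarrow> fst v < fst z))" (is ?thesis)
    proof -
      have in1: ?thesis if "((x1, y1), k) \<in> C1" "((x2, y2), k) \<in> C1"
        using col_same[OF C1 that *(3)] down1 col_dom(1)[OF C1] that by blast
      have in2: ?thesis if "((x1, y1), k) \<in> C2" "((x2, y2), k) \<in> C2"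
        using col_same[OF C2 that *(3)] down2 col_dom(1)[OF C2] that by blast
      have high: "d < fst x" if "(x, x) \<in> R1" "(x, x) \<notin> R2" for x
        using that R[of x x] by force
      have high': "d < fst x" if "(x, x) \<in> R2" "(x, x) \<notin> R1" for x
        using that R[of x x] by force
      have c12: ?thesis if "((x1, y1), k) \<in> C1" "((x2, y2), k) \<in> C2"
      proof (cases "(x1, x1) \<in> R2 \<or> (x2, x2) \<in> R1")
        case True
        then show ?thesis using in1 in2 eq eq' that by blast
      next
        case False
        have x: "(x1, x1) \<in> R1" "(x2, x2) \<in> R2" using that col_dom(1) C1 C2 by blast+
        then have d: "d < fst x1" "d < fst x2" using False high high' by blast+
        then have "fst x1 \<noteq> fst x2" using disj[OF x] by auto
        moreover have "(x1, x2) \<notin> R1 \<union> R2" using False ft1 ft2 by blast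
        ultimately show ?thesis using cross[OF that d] by blast
      qed
      have c21: ?thesis if "((x1, y1), k) \<in> C2" "((x2, y2), k) \<in> C1"
      proof (cases "(x1, x1) \<in> R1 \<or> (x2, x2) \<in> R2")
        case True
        then show ?thesis using in1 in2 eq eq' that by blast
      next
        case False
        have x: "(x1, x1) \<in> R2" "(x2, x2) \<in> R1" using that col_dom(1) C1 C2 by blast+
        then have d: "d < fst x1" "d < fst x2" using False high high' by blast+
        then have "fst x1 \<noteq> fst x2" using disj[OF x(2,1)] by auto
        moreover have "(x1, x2) \<notin> R1 \<union> R2" using False ft1 ft2 by blast
        ultimately show ?thesis using cross[OF that(2,1) d(2,1)] by blast
      qed
      show ?thesis using *(1,2) in1 in2 c12 c21 by blast
    qed
  qed
  ultimately show "(R1 \<union> R2, C1 \<union> C2) \<in> Cond lt N" by (simp add: Cond_def)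
qed

text \<open>Nodes x and y at level d or higher get the same new predecessor \<open>(d, L x)\<close>; the
labelling must therefore separate exactly the components of the part of R from level d on,
and respect nodes already at level d.\<close>

definition cut :: "'w::order \<Rightarrow> ('w \<times> nat \<Rightarrow> nat) \<Rightarrow> ('w \<times> nat) rel \<Rightarrow> ('w \<times> nat) rel" where
  "cut d L R = R \<union> {(a, b). \<exists>x. (x, x) \<in> R \<and> d \<le> fst x \<and>
     (a = (d, L x) \<and> (b = a \<or> b = x) \<or> b = (d, L x) \<and> (a, x) \<in> R \<and> fst a < d)}"

definition cut_label :: "'w::order \<Rightarrow> ('w \<times> nat) rel \<Rightarrow> ('w \<times> nat \<Rightarrow> nat) \<Rightarrow> bool" where
  "cut_label d R L \<longleftrightarrow>
     (\<forall>x y. (x, x) \<in> R \<longrightarrow> (y, y) \<in> R \<longrightarrow> d \<le> fst x \<longrightarrow> d \<le> fst y \<longrightarrow>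
        (L x = L y \<longleftrightarrow> (\<exists>t. d \<le> fst t \<and> (t, x) \<in> R \<and> (t, y) \<in> R))) \<and>
     (\<forall>n. ((d, n), (d, n)) \<in> R \<longrightarrow> L (d, n) = n)"

lemma cut_labelI:
  assumes "\<And>x y. (x, x) \<in> R \<Longrightarrow> d \<le> fst x \<Longrightarrow> (y, y) \<in> R \<Longrightarrow> d \<le> fst y \<Longrightarrow>
      L x = L y \<longleftrightarrow> (\<exists>t. d \<le> fst t \<and> (t, x) \<in> R \<and> (t, y) \<in> R)"
    "\<And>n. ((d, n), (d, n)) \<in> R \<Longrightarrow> L (d, n) = n"
  shows "cut_label d R L"
  unfolding cut_label_def using assms by presburger

lemma cut_labelD:
  assumes "cut_label d R L"
  shows "(x, x) \<in> R \<Longrightarrow> (y, y) \<in> R \<Longrightarrow> d \<le> fst x \<Longrightarrow> d \<le> fst y \<Longrightarrow>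
      L x = L y \<longleftrightarrow> (\<exists>t. d \<le> fst t \<and> (t, x) \<in> R \<and> (t, y) \<in> R)"
    "((d, n), (d, n)) \<in> R \<Longrightarrow> L (d, n) = n"
  using assms unfolding cut_label_def by presburger+

lemma cut_cases:
  assumes "(a, b) \<in> cut d L R"
  obtains (old) "(a, b) \<in> R" | (up) "(b, b) \<in> R" "d \<le> fst b" "a = (d, L b)"
  | (down) x where "(x, x) \<in> R" "d \<le> fst x" "b = (d, L x)" "(a, x) \<in> R" "fst a < d"
  | (new) x where "(x, x) \<in> R" "d \<le> fst x" "a = (d, L x)" "b = a"
  using assms unfolding cut_def by blast

lemma cut_intros:
  "(a, b) \<in> R \<Longrightarrow> (a, b) \<in> cut d L R"
  "(b, b) \<in> R \<Longrightarrow> d \<le> fst b \<Longrightarrow> ((d, L b), b) \<in> cut d L R"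
  "(x, x) \<in> R \<Longrightarrow> d \<le> fst x \<Longrightarrow> (a, x) \<in> R \<Longrightarrow> fst a < d \<Longrightarrow> (a, (d, L x)) \<in> cut d L R"
  "(x, x) \<in> R \<Longrightarrow> d \<le> fst x \<Longrightarrow> ((d, L x), (d, L x)) \<in> cut d L R"
  unfolding cut_def by blast+

text \<open>A new node is below both \<open>x\<close> and \<open>y\<close> only when these have an
  old common lower bound \<open>t\<close> at level \<open>d\<close> or higher, and then it is below
  \<open>t\<close> as well; this is what \<open>stronger\<close> demands. The order among old nodes
  does not change, so the colouring survives.\<close>

lemma cut:
  fixes R :: "('w::linorder \<times> nat) rel"
  assumes R: "finite_tree R" and C: "colouring lt N R C"
    and cl: "cut_label d R L"
  shows "finite_tree (cut d L R)" "colouring lt N (cut d L R) C" "stronger (cut d L R, C) (R, C)"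
proof -
  let ?S = "cut d L R"
  note L = cut_labelD(1)[OF cl] and L0 = cut_labelD(2)[OF cl]
  note ft = ft_trans[OF R] ft_refl[OF R] ft_linear[OF R] ft_below[OF R]
  \<comment> \<open>A node at level \<open>d\<close> is its own label, so equal labels give a common
    lower bound at level \<open>d\<close> or higher, which can only be that node itself.\<close>
  have old: "((d, L x), x) \<in> R" if "((d, L x), (d, L x)) \<in> R" "(x, x) \<in> R" "d \<le> fst x" for x
  proof -
    have "L (d, L x) = L x" using L0 that by blast
    with L[OF that(1,2)] that(3) obtain t where "d \<le> fst t" "(t, (d, L x)) \<in> R" "(t, x) \<in> R"
      by auto
    then show ?thesis using ft_level[OF R, of t "(d, L x)"] by auto
  qed
  have same: "L t = L x" if "(t, x) \<in> R" "d \<le> fst t" for t x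
  proof -
    have "d \<le> fst x" using ft_level_le[OF R that(1)] that(2) by auto
    then show ?thesis using L[of t x] that ft(2,3)[OF that(1)] by blast
  qed
  \<comment> \<open>Equal labels provide a common lower bound \<open>t\<close> of \<open>x\<close>
    and \<open>y\<close> at level \<open>d\<close> or higher; being lower, \<open>a\<close> is below
    \<open>t\<close> and thus below \<open>y\<close>.\<close>
  have below: "(a, y) \<in> R"
    if "fst a < d" "(a, x) \<in> R" "(y, y) \<in> R" "d \<le> fst x" "d \<le> fst y" "L x = L y" for a x y
  proof -
    from L[of x y] that ft(3)[OF that(2)] obtain t where t: "d \<le> fst t" "(t, x) \<in> R" "(t, y) \<in> R"
      by blast
    then have "fst a \<le> fst t" using that(1) by auto
    then show ?thesis using ft_below[OF R that(2) t(2)] t(3) ft(1) by blast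
  qed
  have restrict: "(a, b) \<in> R" if "(a, b) \<in> ?S" "(a, a) \<in> R" "(b, b) \<in> R" for a b
    using that(1)
  proof (cases rule: cut_cases)
    case (down x)
    then have "(b, x) \<in> R" using old that by blast
    then show ?thesis using ft_below[OF R down(4), of b] down by auto
  qed (use that old in blast)+
  show "stronger (?S, C) (R, C)" unfolding stronger_def fst_conv snd_conv
  proof (intro conjI allI impI order_refl)
    fix x y z assume xyz: "(x, x) \<in> R" "(y, y) \<in> R" "(z, x) \<in> ?S" "(z, y) \<in> ?S"
    show "\<exists>t. (t, x) \<in> R \<and> (t, y) \<in> R \<and> (z, t) \<in> ?S"
    proof (cases "(z, z) \<in> R")
      case True
      then show ?thesis using restrict xyz cut_intros(1) by blast
    next
      case False
      have zz: "d \<le> fst u \<and> z = (d, L u)" if "(z, u) \<in> ?S" "(u, u) \<in> R" for u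
        using that(1)
      proof (cases rule: cut_cases)
        case (new x) then show ?thesis using that False by blast
      qed (use False ft in blast)+
      have z: "d \<le> fst x" "z = (d, L x)" "d \<le> fst y" "z = (d, L y)" using zz xyz by blast+
      then obtain t where t: "d \<le> fst t" "(t, x) \<in> R" "(t, y) \<in> R"
        using L[OF xyz(1,2)] by auto
      then have "z = (d, L t)" using same z by auto
      then show ?thesis using t cut_intros(2)[of t R d L] ft by blast
    qed
  qed (auto simp: cut_def)
  show "finite_tree ?S"
  proof (rule finite_treeI)
    define V where "V = {x. (x, x) \<in> R}"
    have "finite V"
    proof (rule finite_subset)
      show "V \<subseteq> fst ` R" by (force simp: V_def)
    qed (simp add: ft_finite[OF R])
    have "(a, b) \<in> (V \<union> (\<lambda>x. (d, L x)) ` V) \<times> (V \<union> (\<lambda>x. (d, L x)) ` V)" if "(a, b) \<in> ?S" for a b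
      using that
    proof (cases rule: cut_cases)
      case old then show ?thesis using ft unfolding V_def by blast
    next
      case down then show ?thesis using ft unfolding V_def by blast
    qed (auto simp: V_def)
    then have "?S \<subseteq> (V \<union> (\<lambda>x. (d, L x)) ` V) \<times> (V \<union> (\<lambda>x. (d, L x)) ` V)" by (rule subrelI)
    then show "finite ?S" by (rule finite_subset) (simp add: \<open>finite V\<close>)
  next
    fix a b c assume "(a, b) \<in> ?S" "(b, c) \<in> ?S"
    from this(1) show "(a, c) \<in> ?S"
    proof (cases rule: cut_cases)
      case old1: old
      from \<open>(b, c) \<in> ?S\<close> show ?thesis
      proof (cases rule: cut_cases)
        case old show ?thesis using ft(1)[OF old1 old] cut_intros(1) by blast
      next
        case up
        then have "(b, c) \<in> R" using old ft(3)[OF old1] by blast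
        then show ?thesis using ft(1)[OF old1] cut_intros(1) by blast
      next
        case (down x)
        then have "fst a < d" using ft_level_le[OF R old1] by auto
        then show ?thesis using down old1 ft(1) cut_intros(3) by blast
      next
        case new then show ?thesis using old1 cut_intros(1) by blast
      qed
    next
      case up1: up
      from \<open>(b, c) \<in> ?S\<close> show ?thesis
      proof (cases rule: cut_cases)
        case old
        then have "L b = L c" "(c, c) \<in> R" "d \<le> fst c"
          using same[OF old] up1 ft(3)[OF old] ft_level_le[OF R old] by auto
        then show ?thesis using up1 cut_intros(2) by metis
      next
        case up
        then have "L b = L c" using L0 up1 by metis
        then show ?thesis using up1 up cut_intros(2) by metis
      next
        case down then show ?thesis using up1 by auto
      next
        case new then show ?thesis using up1 cut_intros(2) by blast
      qed
    next
      case (down x)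
      from \<open>(b, c) \<in> ?S\<close> show ?thesis
      proof (cases rule: cut_cases)
        case 1: old
        then have "(b, x) \<in> R" using old[of x] down(1-3) ft(2)[OF 1] by blast
        then have "(a, b) \<in> R" using ft_below[OF R down(4)] down by auto
        then show ?thesis using ft(1)[OF _ 1] cut_intros(1) by blast
      next
        case up
        then show ?thesis using below[of a x c] down cut_intros(1)[of a c R d L] by auto
      next
        case down': down then show ?thesis using down by auto
      next
        case new then show ?thesis using down cut_intros(3) by metis
      qed
    next
      case new then show ?thesis using \<open>(b, c) \<in> ?S\<close> by blast
    qed
  next
    fix a b assume "(a, b) \<in> ?S"
    then show "(a, a) \<in> ?S \<and> (b, b) \<in> ?S \<and> (a = b \<or> fst a < fst b)"
    proof (cases rule: cut_cases)
      case old then show ?thesis using ft(2,3)[OF old] ft_level[OF R old] cut_intros(1) by blast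
    next
      case up
      have "a = b \<or> fst a < fst b"
      proof (cases "fst b = d")
        case True
        then have "b = (d, snd b)" by (metis prod.collapse)
        then have "a = b" using L0 up by metis
        then show ?thesis ..
      qed (use up in auto)
      then show ?thesis using up cut_intros(1,4) by blast
    next
      case (down x)
      then show ?thesis using cut_intros(4)[of x R d L] cut_intros(1)[OF ft(2)[OF down(4)]] by auto
    next
      case new then show ?thesis using cut_intros(4) by blast
    qed
  next
    fix a b c assume "(b, a) \<in> ?S" "(c, a) \<in> ?S"
    \<comment> \<open>This settles every pair of predecessors one of which is an old relation. In
      the remaining cases the two predecessors are the same new node, or one of them is
      \<open>a\<close>, or both lie below \<open>d\<close> and \<open>below\<close> moves them under
      one old node.\<close>
    have wlog: "(b, c) \<in> ?S \<or> (c, b) \<in> ?S" if b: "(b, a) \<in> R" and c: "(c, a) \<in> ?S" for b c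
      using c
    proof (cases rule: cut_cases)
      case old then show ?thesis using ft(4)[OF b old] cut_intros(1) by blast
    next
      case up
      show ?thesis
      proof (cases "fst b < d")
        case True then show ?thesis using up b cut_intros(3) by blast
      next
        case False
        then have "L b = L a" using same b by auto
        then show ?thesis using up False ft(2)[OF b] cut_intros(2)[of b R d L] by auto
      qed
    next
      case (down x)
      then have "(a, x) \<in> R" using old ft(3)[OF b] by blast
      then have "(b, x) \<in> R" using ft(1)[OF b] by blast
      then have "(b, c) \<in> R \<or> (c, b) \<in> R" using ft(4)[OF _ down(4)] by blast
      then show ?thesis using cut_intros(1) by blast
    next
      case new then show ?thesis using b cut_intros(1) by blast
    qed
    from \<open>(b, a) \<in> ?S\<close> show "(b, c) \<in> ?S \<or> (c, b) \<in> ?S"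
    proof (cases rule: cut_cases)
      case old then show ?thesis using wlog \<open>(c, a) \<in> ?S\<close> by blast
    next
      case up1: up
      from \<open>(c, a) \<in> ?S\<close> show ?thesis
      proof (cases rule: cut_cases)
        case old then show ?thesis using wlog \<open>(b, a) \<in> ?S\<close> by blast
      next
        case up then show ?thesis using up1 cut_intros(4) by blast
      next
        case (down x)
        then have "b = a" using up1 L0 by metis
        then show ?thesis using \<open>(c, a) \<in> ?S\<close> by blast
      next
        case new then show ?thesis using \<open>(b, a) \<in> ?S\<close> by blast
      qed
    next
      case d1: (down x)
      from \<open>(c, a) \<in> ?S\<close> show ?thesis
      proof (cases rule: cut_cases)
        case old then show ?thesis using wlog \<open>(b, a) \<in> ?S\<close> by blast
      next
        case up
        then have "c = a" using d1 L0 by metis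
        then show ?thesis using \<open>(b, a) \<in> ?S\<close> by blast
      next
        case (down y)
        then have "(c, x) \<in> R" using below[of c y x] d1 by auto
        then have "(b, c) \<in> R \<or> (c, b) \<in> R" using ft(4) d1 by blast
        then show ?thesis using cut_intros(1) by blast
      next
        case new then show ?thesis using \<open>(b, a) \<in> ?S\<close> by blast
      qed
    next
      case new then show ?thesis using \<open>(c, a) \<in> ?S\<close> by blast
    qed
  qed
  show "colouring lt N ?S C"
  proof (rule colouringI)
    show "finite C" by (rule col_finite[OF C])
    show "k = k'" if "((x, y), k) \<in> C" "((x, y), k') \<in> C" for x y k k'
      by (rule col_unique[OF C that])
    show "(x, x) \<in> ?S \<and> Some y \<in> N \<and> fst y = fst x" if "((x, y), k) \<in> C" for x y k
      using col_dom[OF C that] cut_intros(1) by blast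
    fix x1 y1 x2 y2 k assume *: "((x1, y1), k) \<in> C" "((x2, y2), k) \<in> C" "(x1, y1) \<noteq> (x2, y2)"
    then show "fst x1 \<noteq> fst x2 \<and> (x1, x2) \<notin> ?S \<and> (\<exists>z. (z, x1) \<in> ?S \<and> (z, x2) \<in> ?S \<and>
        (\<forall>v. tle lt v y1 \<longrightarrow> tle lt v y2 \<longrightarrow> fst v < fst z))"
      using col_same[OF C *] restrict col_dom(1)[OF C] cut_intros(1) by (metis (no_types, lifting))
  qed
qed

section \<open>Extending conditions and density\<close>

definition nodes :: "'w cond \<Rightarrow> ('w \<times> nat) set" where
  "nodes p = {x. (x, x) \<in> fst p}"

definition targets :: "'w cond \<Rightarrow> ('w \<times> nat) set" where
  "targets p = {y. \<exists>x k. ((x, y), k) \<in> snd p}"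

lemma finite_nodes: "finite_tree (fst p) \<Longrightarrow> finite (nodes p)"
  using finite_subset[of "nodes p" "fst ` fst p"] ft_finite[of "fst p"]
  by (force simp: nodes_def)

lemma finite_targets: "colouring lt N R (snd p) \<Longrightarrow> finite (targets p)"
  using finite_subset[of "targets p" "(\<lambda>z. snd (fst z)) ` snd p"] col_finite[of lt N R "snd p"]
  by (force simp: targets_def)

lemma forcing_notion_Cond: "forcing_notion (Cond lt N) stronger"
  unfolding forcing_notion_def
proof (intro conjI ballI impI)
  have "({}, {}) \<in> Cond lt N"
    by (simp add: Cond_def finite_tree_def colouring_def trans_def)
  then show "Cond lt N \<noteq> {}" by blast
  show "stronger p p" if "p \<in> Cond lt N" for p
    using that ft_refl(1)[of "fst p"] unfolding stronger_def Cond_def by fastforce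
  show "stronger p r" if "p \<in> Cond lt N" "stronger p q" "stronger q r" for p q r
    using that stronger_trans[of p q r] by (auto simp: Cond_def)
qed

text \<open>A missing node is added without any relation to the others, so neither the colouring nor
  the lower bounds of old nodes are affected.\<close>

lemma Cond_add_node:
  assumes p: "p \<in> Cond lt N"
  obtains q where "q \<in> Cond lt N" "stronger q p" "(x, x) \<in> fst q"
proof (cases "(x, x) \<in> fst p")
  case True
  then show ?thesis using that[of p] p forcing_notion_Cond unfolding forcing_notion_def by blast
next
  case False
  obtain R C where RC: "p = (R, C)" by (cases p)
  then have R: "finite_tree R" and C: "colouring lt N R C" using p by (auto simp: Cond_def)
  have xx: "(x, x) \<notin> R" using False RC by simp
  have new: "(x, y) \<notin> R" "(y, x) \<notin> R" for y using ft_refl[OF R] xx by blast+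
  have "finite_tree (insert (x, x) R)"
  proof (rule finite_treeI)
    show "finite (insert (x, x) R)" using ft_finite[OF R] by simp
  next
    fix a b c assume "(a, b) \<in> insert (x, x) R" "(b, c) \<in> insert (x, x) R"
    then show "(a, c) \<in> insert (x, x) R" using ft_trans[OF R] new by blast
  next
    fix a b assume "(a, b) \<in> insert (x, x) R"
    then show "(a, a) \<in> insert (x, x) R \<and> (b, b) \<in> insert (x, x) R \<and> (a = b \<or> fst a < fst b)"
      using ft_refl[OF R, of a b] ft_level[OF R, of a b] by blast
  next
    fix a b c assume "(b, a) \<in> insert (x, x) R" "(c, a) \<in> insert (x, x) R"
    then show "(b, c) \<in> insert (x, x) R \<or> (c, b) \<in> insert (x, x) R"
      using ft_linear[OF R, of b a c] new by blast
  qed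
  moreover have "colouring lt N (insert (x, x) R) C"
  proof (rule colouringI)
    show "finite C" by (rule col_finite[OF C])
    show "k = k'" if "((a, b), k) \<in> C" "((a, b), k') \<in> C" for a b k k'
      by (rule col_unique[OF C that])
    show "(a, a) \<in> insert (x, x) R \<and> Some b \<in> N \<and> fst b = fst a" if "((a, b), k) \<in> C" for a b k
      using col_dom[OF C that] by blast
    fix x1 y1 x2 y2 k assume *: "((x1, y1), k) \<in> C" "((x2, y2), k) \<in> C" "(x1, y1) \<noteq> (x2, y2)"
    have "x1 \<noteq> x" using col_dom(1)[OF C *(1)] xx by blast
    then have "(x1, x2) \<notin> insert (x, x) R" using col_same(2)[OF C *] by blast
    then show "fst x1 \<noteq> fst x2 \<and> (x1, x2) \<notin> insert (x, x) R \<and>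
        (\<exists>z. (z, x1) \<in> insert (x, x) R \<and> (z, x2) \<in> insert (x, x) R \<and>
        (\<forall>v. tle lt v y1 \<longrightarrow> tle lt v y2 \<longrightarrow> fst v < fst z))"
      using col_same(1,3)[OF C *] by blast
  qed
  moreover have "stronger (insert (x, x) R, C) (R, C)"
    unfolding stronger_def fst_conv snd_conv
  proof (intro conjI allI impI)
    fix a b z assume *: "(a, a) \<in> R" "(b, b) \<in> R" "(z, a) \<in> insert (x, x) R" "(z, b) \<in> insert (x, x) R"
    then have "(z, a) \<in> R" "(z, b) \<in> R" using xx by blast+
    then show "\<exists>t. (t, a) \<in> R \<and> (t, b) \<in> R \<and> (z, t) \<in> insert (x, x) R"
      using ft_refl(1)[OF R] by blast
  qed auto
  ultimately show ?thesis using that[of "(insert (x, x) R, C)"] RC by (simp add: Cond_def)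
qed

text \<open>Only finitely many colours are in use, and a fresh one has no second pair to be compared
  with.\<close>

lemma Cond_add_colour:
  assumes p: "p \<in> Cond lt N" and x: "(x, x) \<in> fst p" and y: "Some y \<in> N" "fst y = fst x"
  obtains q k where "q \<in> Cond lt N" "stronger q p" "fst q = fst p" "((x, y), k) \<in> snd q"
proof (cases "\<exists>k. ((x, y), k) \<in> snd p")
  case True
  then show ?thesis using that[of p] p forcing_notion_Cond unfolding forcing_notion_def by blast
next
  case False
  obtain R C where RC: "p = (R, C)" by (cases p)
  then have R: "finite_tree R" and C: "colouring lt N R C" using p by (auto simp: Cond_def)
  have "finite (snd ` C)" using col_finite[OF C] by simp
  then obtain k where k: "k \<notin> snd ` C" using ex_new_if_finite[of "snd ` C"] by auto
  let ?C = "insert ((x, y), k) C"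
  have fresh: "(z, k) \<notin> C" "((x, y), l) \<notin> C" for z l using k False RC by (force, simp)
  have "colouring lt N R ?C"
  proof (rule colouringI)
    show "finite ?C" using col_finite[OF C] by simp
    show "i = j" if "((a, b), i) \<in> ?C" "((a, b), j) \<in> ?C" for a b i j
      using that fresh col_unique[OF C, of a b i j] by blast
    show "(a, a) \<in> R \<and> Some b \<in> N \<and> fst b = fst a" if "((a, b), i) \<in> ?C" for a b i
      using that col_dom[OF C, of a b i] x y RC by auto
    fix x1 y1 x2 y2 i assume *: "((x1, y1), i) \<in> ?C" "((x2, y2), i) \<in> ?C" "(x1, y1) \<noteq> (x2, y2)"
    then have "((x1, y1), i) \<in> C" "((x2, y2), i) \<in> C" using fresh by blast+
    then show "fst x1 \<noteq> fst x2 \<and> (x1, x2) \<notin> R \<and> (\<exists>z. (z, x1) \<in> R \<and> (z, x2) \<in> R \<and>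
        (\<forall>v. tle lt v y1 \<longrightarrow> tle lt v y2 \<longrightarrow> fst v < fst z))"
      using col_same[OF C _ _ *(3)] by blast
  qed
  moreover have "stronger (R, ?C) (R, C)"
    unfolding stronger_def fst_conv snd_conv using ft_refl(1)[OF R] by blast
  ultimately show ?thesis using that[of "(R, ?C)" k] RC R by (simp add: Cond_def)
qed

text \<open>The predecessors of \<open>x\<close> at level \<open>d\<close> or higher are linearly
  ordered, so they have a least one, \<open>r x\<close>; it is the same for all nodes of a component
  and serves as its name.\<close>

lemma cut_labels:
  fixes R :: "('w::wellorder \<times> nat) rel"
  assumes R: "finite_tree R"
  obtains L where "cut_label d R L"
proof -
  define V where "V = {x. (x, x) \<in> R}"
  have fin: "finite V" using finite_nodes[of "(R, {})"] R by (simp add: V_def nodes_def)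
  have "\<exists>t. d \<le> fst t \<and> (t, x) \<in> R \<and> (\<forall>s. d \<le> fst s \<longrightarrow> (s, x) \<in> R \<longrightarrow> (t, s) \<in> R)"
    if "(x, x) \<in> R" "d \<le> fst x" for x
  proof -
    define Q where "Q m \<longleftrightarrow> (\<exists>t. d \<le> fst t \<and> (t, x) \<in> R \<and> fst t = m)" for m
    have "Q (fst x)" using that unfolding Q_def by blast
    then have "Q (LEAST m. Q m)" by (rule LeastI)
    then obtain t where t: "d \<le> fst t" "(t, x) \<in> R" "fst t = (LEAST m. Q m)" by (auto simp: Q_def)
    have "(t, s) \<in> R" if "d \<le> fst s" "(s, x) \<in> R" for s
    proof -
      have "Q (fst s)" using that unfolding Q_def by blast
      then have "fst t \<le> fst s" using t(3) Least_le by metis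
      then show ?thesis using ft_below[OF R t(2) that(2)] by blast
    qed
    then show ?thesis using t by blast
  qed
  then obtain r where r: "\<And>x. (x, x) \<in> R \<Longrightarrow> d \<le> fst x \<Longrightarrow> d \<le> fst (r x) \<and> (r x, x) \<in> R \<and>
      (\<forall>s. d \<le> fst s \<longrightarrow> (s, x) \<in> R \<longrightarrow> (r x, s) \<in> R)"
    by metis
  have "finite (snd ` V)" using fin by simp
  \<comment> \<open>\<open>m\<close> exceeds every number occurring in a node. Components without a
    node at level \<open>d\<close> are numbered from \<open>m\<close> on, so they cannot collide
    with the nodes at level \<open>d\<close>, which keep their own number.\<close>
  then obtain m where m: "\<And>x. x \<in> V \<Longrightarrow> snd x < m"
    unfolding finite_nat_set_iff_bounded by auto
  define e where "e x = (if fst x = d then snd x else m + to_nat_on V x)" for x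
  have inj: "x = y" if "x \<in> V" "y \<in> V" "e x = e y" for x y
  proof (cases "fst x = d"; cases "fst y = d")
    assume "fst x = d" "fst y = d"
    then show ?thesis using that(3) by (simp add: e_def prod_eq_iff)
  next
    assume "fst x \<noteq> d" "fst y \<noteq> d"
    then show ?thesis using that fin by (simp add: e_def uncountable_def countable_finite)
  qed (use that m[of x] m[of y] in \<open>auto simp: e_def\<close>)
  have rV: "r x \<in> V" if "(x, x) \<in> R" "d \<le> fst x" for x
    using r[OF that] ft_refl(1)[OF R] unfolding V_def by blast
  show ?thesis
  proof (rule that[of "\<lambda>x. e (r x)"], rule cut_labelI)
    fix x y assume x: "(x, x) \<in> R" "d \<le> fst x" and y: "(y, y) \<in> R" "d \<le> fst y"
    show "e (r x) = e (r y) \<longleftrightarrow> (\<exists>t. d \<le> fst t \<and> (t, x) \<in> R \<and> (t, y) \<in> R)"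
    proof
      assume "e (r x) = e (r y)"
      then have "r x = r y" using inj rV x y by blast
      then show "\<exists>t. d \<le> fst t \<and> (t, x) \<in> R \<and> (t, y) \<in> R" using r[OF x] r[OF y] by metis
    next
      assume "\<exists>t. d \<le> fst t \<and> (t, x) \<in> R \<and> (t, y) \<in> R"
      then obtain t where t: "d \<le> fst t" "(t, x) \<in> R" "(t, y) \<in> R" by blast
      then have "(r x, t) \<in> R" "(r y, t) \<in> R" using r[OF x] r[OF y] by blast+
      then have "(r x, y) \<in> R" "(r y, x) \<in> R" using t ft_trans[OF R] by blast+
      then have "(r y, r x) \<in> R" "(r x, r y) \<in> R" using r[OF x] r[OF y] by blast+
      then have "r x = r y" using ft_level[OF R] by (metis order_less_asym)
      then show "e (r x) = e (r y)" by simp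
    qed
  next
    fix n assume n: "((d, n), (d, n)) \<in> R"
    have "r (d, n) = (d, n)" using r[of "(d, n)"] n ft_level[OF R, of "r (d, n)" "(d, n)"] by auto
    then show "e (r (d, n)) = n" by (simp add: e_def)
  qed
qed

text \<open>One index combines three tasks: to put \<open>x\<close> into the tree, to give it a
  predecessor at level \<open>d\<close>, and to colour \<open>(x, y)\<close>. Triples of this kind
  can be enumerated by \<open>'w\<close>.\<close>

definition generic_dense ::
  "('w::omega1 node \<Rightarrow> 'w node \<Rightarrow> bool) \<Rightarrow> 'w node set \<Rightarrow>
    ('w \<times> nat) \<times> ('w \<times> nat) \<times> 'w \<Rightarrow> 'w cond set" where
  "generic_dense lt N = (\<lambda>(x, y, d). {p \<in> Cond lt N. (x, x) \<in> fst p \<and>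
     (d < fst x \<longrightarrow> (\<exists>n. ((d, n), x) \<in> fst p)) \<and>
     (Some y \<in> N \<longrightarrow> fst y = fst x \<longrightarrow> (\<exists>k. ((x, y), k) \<in> snd p))})"

lemma dense_generic_dense: "dense (Cond lt N) stronger (generic_dense lt N i)"
proof -
  obtain x y d where i: "i = (x, y, d)" by (metis prod.exhaust)
  have "\<exists>q\<in>generic_dense lt N i. stronger q p" if p: "p \<in> Cond lt N" for p
  proof -
    obtain q where q: "q \<in> Cond lt N" "stronger q p" "(x, x) \<in> fst q"
      using Cond_add_node[OF p] by blast
    then have qt: "finite_tree (fst q)" "colouring lt N (fst q) (snd q)" by (auto simp: Cond_def)
    \<comment> \<open>The cut is made for every \<open>d\<close>; it supplies the predecessor of
      \<open>x\<close> when \<open>d < fst x\<close> and does no harm otherwise.\<close>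
    obtain L where L: "cut_label d (fst q) L"
      using cut_labels[OF qt(1)] by blast
    let ?R = "cut d L (fst q)"
    have r: "(?R, snd q) \<in> Cond lt N" "stronger (?R, snd q) q"
      using cut[OF qt L] by (simp_all add: Cond_def)
    have x: "(x, x) \<in> ?R" "d < fst x \<Longrightarrow> ((d, L x), x) \<in> ?R"
      using q(3) cut_intros(1,2) by (blast, metis order_less_imp_le)
    obtain s where s: "s \<in> Cond lt N" "stronger s (?R, snd q)" "fst s = ?R"
      "Some y \<in> N \<Longrightarrow> fst y = fst x \<Longrightarrow> \<exists>k. ((x, y), k) \<in> snd s"
    proof (cases "Some y \<in> N \<and> fst y = fst x")
      case True
      then show ?thesis using that Cond_add_colour[OF r(1), of x y] x by (metis fst_conv)
    next
      case False
      then show ?thesis using that[of "(?R, snd q)"] r forcing_notion_Cond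
        unfolding forcing_notion_def by auto
    qed
    have "stronger s p"
      using q s r p forcing_notion_Cond unfolding forcing_notion_def by meson
    moreover have "s \<in> generic_dense lt N i"
      using s x by (auto simp: generic_dense_def i)
    ultimately show ?thesis by blast
  qed
  then show ?thesis by (auto simp: dense_def generic_dense_def i)
qed

section \<open>The countable chain condition\<close>

text \<open>The labels of the components of a condition above its root are read off the
collapsed order alone, so isomorphic conditions get matching labels.\<close>

definition collapse_label ::
  "(nat + 'b) rel \<Rightarrow> nat + 'b \<Rightarrow> nat" where
  "collapse_label Q a = (LEAST n. \<exists>m. (Inl m, a) \<in> Q \<and> (Inl m, Inl n) \<in> Q)"

text \<open>\<open>e\<close> keeps the elements of \<open>S\<close> below level \<open>d\<close> and
  replaces those above by numbers; level \<open>d\<close> itself is free. The image \<open>Q\<close>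
  is the isomorphism type over the root. \<open>S\<close> is a superset of the nodes, because
  targets have to be collapsed as well.\<close>

locale collapsed =
  fixes R :: "('w::wellorder \<times> nat) rel" and d :: 'w and e :: "'w \<times> nat \<Rightarrow> nat + ('w \<times> nat)"
    and S Q
  assumes R: "finite_tree R"
    and S: "(x, x) \<in> R \<Longrightarrow> x \<in> S"
    and inj: "x \<in> S \<Longrightarrow> y \<in> S \<Longrightarrow> e x = e y \<Longrightarrow> x = y"
    and low: "x \<in> S \<Longrightarrow> fst x \<le> d \<Longrightarrow> fst x < d \<and> e x = Inr x"
    and high: "x \<in> S \<Longrightarrow> d \<le> fst x \<Longrightarrow> d < fst x \<and> (\<exists>n. e x = Inl n)"
    and Q: "Q = map_prod e e ` R"
begin

lemma in_Q: "(x, x) \<in> R \<Longrightarrow> (y, y) \<in> R \<Longrightarrow> (e x, e y) \<in> Q \<longleftrightarrow> (x, y) \<in> R"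
proof
  assume *: "(x, x) \<in> R" "(y, y) \<in> R" "(e x, e y) \<in> Q"
  then obtain a b where ab: "(a, b) \<in> R" "e x = e a" "e y = e b" by (auto simp: Q)
  then have "x = a" "y = b" using inj S ft_refl[OF R ab(1)] * by blast+
  then show "(x, y) \<in> R" using ab by blast
qed (force simp: Q)

lemma Q_cases:
  assumes "(a, b) \<in> Q"
  obtains x y where "a = e x" "b = e y" "(x, y) \<in> R"
  using assms by (auto simp: Q)

lemma Inr_low: "x \<in> S \<Longrightarrow> e x = Inr y \<Longrightarrow> x = y \<and> fst x < d"
  using low[of x] high[of x] linear[of "fst x" d] by auto

lemma Inl_high: "x \<in> S \<Longrightarrow> e x = Inl n \<Longrightarrow> d < fst x"
  using low[of x] by (cases "fst x \<le> d") auto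

text \<open>The label is the least number of a node in the component of \<open>x\<close>. It can be
  read off \<open>Q\<close> because the predecessors at level \<open>d\<close> or higher are exactly
  those collapsed to some \<open>Inl m\<close>; injectivity of \<open>e\<close> then separates the
  components.\<close>

lemma collapse_label_eq:
  assumes x: "(x, x) \<in> R" "d \<le> fst x" and y: "(y, y) \<in> R" "d \<le> fst y"
  shows "collapse_label Q (e x) = collapse_label Q (e y) \<longleftrightarrow>
    (\<exists>t. d \<le> fst t \<and> (t, x) \<in> R \<and> (t, y) \<in> R)"
proof -
  define rel where "rel x z \<longleftrightarrow> (\<exists>t. d \<le> fst t \<and> (t, x) \<in> R \<and> (t, z) \<in> R)" for x z
  \<comment> \<open>The two common lower bounds are both below \<open>v\<close>, hence comparable,
    and the lower one is below \<open>u\<close> and \<open>w\<close>.\<close>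
  have rel_trans: "rel u w" if "rel u v" "rel v w" for u v w
  proof -
    from that obtain s t where st: "d \<le> fst s" "(s, u) \<in> R" "(s, v) \<in> R"
      "d \<le> fst t" "(t, v) \<in> R" "(t, w) \<in> R"
      unfolding rel_def by blast
    then consider "(s, t) \<in> R" | "(t, s) \<in> R" using ft_linear[OF R] by blast
    then show ?thesis using st ft_trans[OF R] unfolding rel_def by cases blast+
  qed
  have rel_sym: "rel u v \<Longrightarrow> rel v u" for u v unfolding rel_def by blast
  have set: "(\<exists>m. (Inl m, e z) \<in> Q \<and> (Inl m, Inl n) \<in> Q) \<longleftrightarrow> (\<exists>v. rel z v \<and> e v = Inl n)"
    if z: "(z, z) \<in> R" for z n
  proof
    assume "\<exists>m. (Inl m, e z) \<in> Q \<and> (Inl m, Inl n) \<in> Q"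
    then obtain m where m: "(Inl m, e z) \<in> Q" "(Inl m, Inl n) \<in> Q" by blast
    obtain t v where tv: "Inl m = e t" "Inl n = e v" "(t, v) \<in> R" by (rule Q_cases[OF m(2)])
    have "(t, t) \<in> R" using ft_refl[OF R tv(3)] by blast
    then have "(t, z) \<in> R" "d \<le> fst t" using m(1) in_Q[OF _ z] tv(1) Inl_high[OF S, of t m] by auto
    then show "\<exists>v. rel z v \<and> e v = Inl n" using tv unfolding rel_def by metis
  next
    assume "\<exists>v. rel z v \<and> e v = Inl n"
    then obtain t v where tv: "d \<le> fst t" "(t, z) \<in> R" "(t, v) \<in> R" "e v = Inl n"
      unfolding rel_def by blast
    have "(t, t) \<in> R" "(v, v) \<in> R" using tv ft_refl[OF R] by blast+
    moreover obtain m where "e t = Inl m" using high[OF S] tv(1) calculation by blast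
    ultimately have "(Inl m, e z) \<in> Q" "(Inl m, Inl n) \<in> Q"
      using in_Q[of t z] in_Q[of t v] z tv by auto
    then show "\<exists>m. (Inl m, e z) \<in> Q \<and> (Inl m, Inl n) \<in> Q" by blast
  qed
  have label: "collapse_label Q (e z) = (LEAST n. \<exists>v. rel z v \<and> e v = Inl n)" if "(z, z) \<in> R" for z
    unfolding collapse_label_def using set[OF that] by simp
  have attained: "\<exists>v. rel z v \<and> e v = Inl (collapse_label Q (e z))" if z: "(z, z) \<in> R" "d \<le> fst z" for z
  proof -
    obtain n where "e z = Inl n" using high[OF S] z by blast
    then have "\<exists>v. rel z v \<and> e v = Inl n" using z unfolding rel_def by blast
    then have "\<exists>v. rel z v \<and> e v = Inl (LEAST n. \<exists>v. rel z v \<and> e v = Inl n)" by (rule LeastI)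
    then show ?thesis using label[OF z(1)] by simp
  qed
  have "collapse_label Q (e x) = collapse_label Q (e y) \<longleftrightarrow> rel x y"
  proof
    assume eq: "collapse_label Q (e x) = collapse_label Q (e y)"
    obtain u where u: "rel x u" "e u = Inl (collapse_label Q (e x))" using attained[OF x] by blast
    obtain v where v: "rel y v" "e v = Inl (collapse_label Q (e y))" using attained[OF y] by blast
    have "u \<in> S" "v \<in> S" using u(1) v(1) S ft_refl(2)[OF R] unfolding rel_def by blast+
    then have "u = v" using inj u v eq by simp
    then show "rel x y" using u v rel_trans rel_sym by blast
  next
    assume "rel x y"
    then have "rel x v \<longleftrightarrow> rel y v" for v using rel_trans rel_sym by blast
    then show "collapse_label Q (e x) = collapse_label Q (e y)" using label x y by simp
  qed
  then show ?thesis by (simp add: rel_def)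
qed

definition L where "L x = collapse_label Q (e x)"

lemma cut_label_L: "cut_label d R L"
proof (rule cut_labelI)
  show "L (d, n) = n" if "((d, n), (d, n)) \<in> R" for n
    using high[OF S[OF that]] by simp
qed (simp add: L_def collapse_label_eq)

text \<open>The right-hand side depends on \<open>Q\<close> and \<open>d\<close> only, so conditions
  with equal \<open>Q\<close> have cuts that coincide up to level \<open>d\<close>, as
  \<open>amalgamation\<close> demands.\<close>

lemma cut_low:
  assumes b: "fst b \<le> d"
  shows "(a, b) \<in> cut d L R \<longleftrightarrow> (Inr a, Inr b) \<in> Q \<or>
    fst b = d \<and> (\<exists>m. (Inl m, Inl m) \<in> Q \<and> snd b = collapse_label Q (Inl m) \<and>
      (a = b \<or> (Inr a, Inl m) \<in> Q))"
proof
  assume "(a, b) \<in> cut d L R"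
  then show "(Inr a, Inr b) \<in> Q \<or>
    fst b = d \<and> (\<exists>m. (Inl m, Inl m) \<in> Q \<and> snd b = collapse_label Q (Inl m) \<and>
      (a = b \<or> (Inr a, Inl m) \<in> Q))"
  proof (cases rule: cut_cases)
    case old
    note r = ft_refl[OF R old]
    have "fst a \<le> d" using ft_level_le[OF R old] b by auto
    then have "e a = Inr a" "e b = Inr b" using low S r b by blast+
    then show ?thesis using in_Q[OF r] old by simp
  next
    case up
    then have "d < fst b" using high[OF S] by blast
    then show ?thesis using b by auto
  next
    case (down x)
    obtain m where m: "e x = Inl m" using high[OF S] down by blast
    have "(a, a) \<in> R" using ft_refl[OF R] down by blast
    moreover have "e a = Inr a" using low[OF S] calculation down by simp
    ultimately have "(Inr a, Inl m) \<in> Q" "(Inl m, Inl m) \<in> Q"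
      using in_Q[of a x] in_Q[of x x] down m by auto
    then show ?thesis using down m by (auto simp: L_def)
  next
    case (new x)
    obtain m where m: "e x = Inl m" using high[OF S] new by blast
    then have "(Inl m, Inl m) \<in> Q" using in_Q[of x x] new by auto
    then show ?thesis using new m by (auto simp: L_def)
  qed
next
  assume "(Inr a, Inr b) \<in> Q \<or>
    fst b = d \<and> (\<exists>m. (Inl m, Inl m) \<in> Q \<and> snd b = collapse_label Q (Inl m) \<and>
      (a = b \<or> (Inr a, Inl m) \<in> Q))"
  then show "(a, b) \<in> cut d L R"
  proof (elim disjE conjE exE)
    assume "(Inr a, Inr b) \<in> Q"
    then obtain x y where xy: "Inr a = e x" "Inr b = e y" "(x, y) \<in> R" by (rule Q_cases)
    then have "x = a" "y = b" using Inr_low[OF S] ft_refl[OF R xy(3)] by metis+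
    then show ?thesis using xy cut_intros(1) by blast
  next
    fix m assume *: "fst b = d" "(Inl m, Inl m) \<in> Q" "snd b = collapse_label Q (Inl m)"
    obtain x where x: "e x = Inl m" "(x, x) \<in> R"
      using Q_cases[OF *(2)] ft_refl[OF R] by metis
    have "d < fst x" using Inl_high[OF S] x by blast
    then have bx: "d \<le> fst x" "b = (d, L x)"
      using x * by (auto simp: L_def prod_eq_iff)
    { assume "a = b" then show ?thesis using bx x cut_intros(4) by blast }
    { assume "(Inr a, Inl m) \<in> Q"
      then obtain u v where uv: "Inr a = e u" "Inl m = e v" "(u, v) \<in> R" by (rule Q_cases)
      then have "u = a" "fst u < d" "v = x"
        using Inr_low[OF S] inj S x ft_refl[OF R uv(3)] by metis+
      then show ?thesis using bx x uv cut_intros(3) by blast }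
  qed
qed

end

lemma omega1_countable_atMost: "countable {b. b \<le> (a :: 'w::omega1)}"
proof -
  have "{b. b \<le> a} = insert a {b. b < a}" by auto
  then show ?thesis using omega1_countable_below[of a] by simp
qed

context normal_tree
begin

lemma finite_restrictions:
  assumes "finite \<rho>"
  shows "finite {v. v \<preceq> y \<and> fst v \<in> \<rho>}"
proof (rule inj_on_finite[of fst _ \<rho>])
  show "inj_on fst {v. v \<preceq> y \<and> fst v \<in> \<rho>}"
  proof (rule inj_onI)
    fix s t assume "s \<in> {v. v \<preceq> y \<and> fst v \<in> \<rho>}" "t \<in> {v. v \<preceq> y \<and> fst v \<in> \<rho>}" "fst s = fst t"
    then show "s = t" using le_linear[of s y t] le_level[of s t] le_level[of t s] by auto
  qed
qed (use assms in auto)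

text \<open>Both trees are cut at \<open>d\<close> and then amalgamated. Only \<open>cross\<close>
  needs a real argument, which splits on whether \<open>x1\<close> and \<open>x2\<close> get the
  same new node at level \<open>d\<close>.\<close>

lemma ccc_amalgamation:
  assumes p: "(R1, C1) \<in> Cond lt N" and q: "(R2, C2) \<in> Cond lt N"
    and S1: "S1 = nodes (R1, C1) \<union> targets (R1, C1)" and S2: "S2 = nodes (R2, C2) \<union> targets (R2, C2)"
    and c1: "collapsed R1 d e1 S1 Q" and c2: "collapsed R2 d e2 S2 Q"
    and col: "(\<lambda>((x, y), k). ((e1 x, e1 y), k)) ` C1 = (\<lambda>((x, y), k). ((e2 x, e2 y), k)) ` C2"
    and res: "{(e1 y, v) |y v. y \<in> S1 \<and> v \<preceq> y \<and> fst v \<in> \<rho>} = {(e2 y, v) |y v. y \<in> S2 \<and> v \<preceq> y \<and> fst v \<in> \<rho>}"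
    and \<rho>: "\<And>x. x \<in> S1 \<union> S2 \<Longrightarrow> fst x < d \<Longrightarrow> fst x \<in> \<rho>"
    and disj: "\<And>x y. x \<in> S1 \<Longrightarrow> y \<in> S2 \<Longrightarrow> fst x = fst y \<Longrightarrow> fst x < d"
    and sep: "\<And>y y' v. y \<in> targets (R1, C1) \<Longrightarrow> y' \<in> targets (R2, C2) \<Longrightarrow> v \<preceq> y \<Longrightarrow> v \<preceq> y' \<Longrightarrow> fst v \<noteq> d"
  shows "compatible (Cond lt N) stronger (R1, C1) (R2, C2)"
proof -
  interpret c1: collapsed R1 d e1 S1 Q by (rule c1)
  interpret c2: collapsed R2 d e2 S2 Q by (rule c2)
  have R1: "finite_tree R1" and R2: "finite_tree R2"
    and C1: "colouring lt N R1 C1" and C2: "colouring lt N R2 C2"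
    using p q by (auto simp: Cond_def)
  have T1: "x \<in> S1" "y \<in> S1" "y \<in> targets (R1, C1)" if "((x, y), k) \<in> C1" for x y k
    using that col_dom(1)[OF C1 that] unfolding S1 nodes_def targets_def by fastforce+
  have T2: "x \<in> S2" "y \<in> S2" "y \<in> targets (R2, C2)" if "((x, y), k) \<in> C2" for x y k
    using that col_dom(1)[OF C2 that] unfolding S2 nodes_def targets_def by fastforce+
  let ?R1 = "cut d c1.L R1" and ?R2 = "cut d c2.L R2"
  note cut1 = cut[OF R1 C1 c1.cut_label_L] and cut2 = cut[OF R2 C2 c2.cut_label_L]
  have agreeC: "((x, y), k) \<in> C1 \<longleftrightarrow> ((x, y), k) \<in> C2" if x: "fst x \<le> d" for x y k
  proof
    assume k: "((x, y), k) \<in> C1"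
    have "e1 x = Inr x" "e1 y = Inr y"
      using c1.low T1[OF k] col_dom(3)[OF C1 k] x by auto
    then have "((Inr x, Inr y), k) \<in> (\<lambda>((x, y), k). ((e2 x, e2 y), k)) ` C2"
      using k unfolding col[symmetric] by force
    then obtain a b where ab: "((a, b), k) \<in> C2" "e2 a = Inr x" "e2 b = Inr y" by auto
    then have "a = x" "b = y" using c2.Inr_low T2[OF ab(1)] by blast+
    then show "((x, y), k) \<in> C2" using ab by blast
  next
    assume k: "((x, y), k) \<in> C2"
    have "e2 x = Inr x" "e2 y = Inr y"
      using c2.low T2[OF k] col_dom(3)[OF C2 k] x by auto
    then have "((Inr x, Inr y), k) \<in> (\<lambda>((x, y), k). ((e1 x, e1 y), k)) ` C1"
      using k unfolding col by force
    then obtain a b where ab: "((a, b), k) \<in> C1" "e1 a = Inr x" "e1 b = Inr y" by auto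
    then have "a = x" "b = y" using c1.Inr_low T1[OF ab(1)] by blast+
    then show "((x, y), k) \<in> C1" using ab by blast
  qed
  have agreeR: "(x, y) \<in> ?R1 \<longleftrightarrow> (x, y) \<in> ?R2" if "fst y \<le> d" for x y
    using c1.cut_low[OF that] c2.cut_low[OF that] by simp
  have disj': "fst x \<le> d" if "(x, x) \<in> ?R1" "(y, y) \<in> ?R2" "fst x = fst y" for x y
  proof (rule ccontr)
    assume "\<not> fst x \<le> d"
    then have "(x, x) \<in> R1" "(y, y) \<in> R2"
      using that by (auto elim!: cut_cases)
    then show False using disj[of x y] that(3) \<open>\<not> fst x \<le> d\<close> c1.S c2.S by auto
  qed
  have cross: "\<exists>z. (z, x1) \<in> ?R1 \<and> (z, x2) \<in> ?R2 \<and> (\<forall>v. tle lt v y1 \<longrightarrow> tle lt v y2 \<longrightarrow> fst v < fst z)"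
    if k: "((x1, y1), k) \<in> C1" "((x2, y2), k) \<in> C2" and d: "d < fst x1" "d < fst x2" for x1 y1 x2 y2 k
  proof -
    have x1: "(x1, x1) \<in> R1" "Some y1 \<in> N" and x2: "(x2, x2) \<in> R2"
      using col_dom[OF C1 k(1)] col_dom[OF C2 k(2)] by blast+
    \<comment> \<open>A common lower bound of \<open>y1\<close> and \<open>y2\<close> can be
      restricted to any smaller level, so it is enough to refute the existence of one on a suitable
      level.\<close>
    have low: "\<exists>s. fst s = b \<and> s \<preceq> y1 \<and> s \<preceq> y2 \<and> s \<preceq> v" if "v \<preceq> y1" "v \<preceq> y2" "b \<le> fst v" for v b
      using le_restrict[of v b] le_in[OF that(1) x1(2)] le_trans that by metis
    show ?thesis
    proof (cases "c1.L x1 = c2.L x2")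
      case True
      \<comment> \<open>The new node is the witness: a common lower bound of the targets at level
        \<open>d\<close> or higher would restrict to one on level \<open>d\<close>, against
        \<open>sep\<close>.\<close>
      let ?z = "(d, c1.L x1)"
      have "(?z, x1) \<in> ?R1" "(?z, x2) \<in> ?R2"
        using cut_intros(2)[OF x1(1), of d c1.L] cut_intros(2)[OF x2(1), of d c2.L] d True by auto
      moreover have "fst v < d" if "v \<preceq> y1" "v \<preceq> y2" for v
        using low[OF that, of d] sep[OF T1(3)[OF k(1)] T2(3)[OF k(2)]] by (metis not_le)
      ultimately show ?thesis by fastforce
    next
      case False
      \<comment> \<open>Equality of the collapsed colourings provides the twin \<open>(x, y)\<close>
        of \<open>(x1, y1)\<close> in the second condition, with the same colour.\<close>
      have "((e1 x1, e1 y1), k) \<in> (\<lambda>((x, y), k). ((e2 x, e2 y), k)) ` C2"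
        using k(1) unfolding col[symmetric] by force
      then obtain x y where xy: "((x, y), k) \<in> C2" "e2 x = e1 x1" "e2 y = e1 y1" by auto
      have x: "(x, x) \<in> R2" using col_dom[OF C2 xy(1)] by blast
      have dx: "d < fst x"
      proof -
        obtain n where "e1 x1 = Inl n" using c1.high T1[OF k(1)] d by (meson less_imp_le)
        then show ?thesis using c2.Inl_high T2[OF xy(1)] xy(2) by metis
      qed
      \<comment> \<open>Different labels make \<open>x\<close> and \<open>x2\<close> different
        nodes, so the equal colours yield a common lower bound \<open>z\<close> that is higher than
        those of the targets. Its level is below \<open>d\<close>, as otherwise the labels would
        agree; hence \<open>z\<close> is kept by the collapse and also lies below
        \<open>x1\<close>.\<close>
      have neq: "c2.L x \<noteq> c2.L x2" using False xy(2) by (simp add: c1.L_def c2.L_def)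
      then obtain z where z: "(z, x) \<in> R2" "(z, x2) \<in> R2" "\<forall>v. v \<preceq> y \<longrightarrow> v \<preceq> y2 \<longrightarrow> fst v < fst z"
        using col_same(3)[OF C2 xy(1) k(2)] by blast
      have zz: "(z, z) \<in> R2" using ft_refl[OF R2 z(1)] by blast
      have zd: "fst z < d"
      proof (rule ccontr)
        assume "\<not> fst z < d"
        then have "c2.L x = c2.L x2"
          using c2.collapse_label_eq[OF x _ x2] z dx d by (metis c2.L_def less_imp_le not_less)
        then show False using neq by blast
      qed
      have e2z: "e2 z = Inr z" using c2.low[OF c2.S[OF zz]] zd by simp
      have "(Inr z, e1 x1) \<in> Q" using c2.in_Q[OF zz x] z(1) e2z xy(2) by simp
      then obtain u w where uw: "Inr z = e1 u" "e1 x1 = e1 w" "(u, w) \<in> R1" by (rule c1.Q_cases)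
      then have "u = z" "w = x1"
        using c1.Inr_low c1.inj c1.S x1 ft_refl[OF R1 uw(3)] by metis+
      then have "(z, x1) \<in> R1" using uw by blast
      \<comment> \<open>Otherwise \<open>v\<close> restricts to some \<open>s\<close> on the level
        of \<open>z\<close>, which is in \<open>\<rho>\<close>. By \<open>res\<close>,
        \<open>s\<close> is also below the twin target \<open>y\<close>, so it is a common lower
        bound of \<open>y\<close> and \<open>y2\<close> as high as \<open>z\<close>.\<close>
      moreover have "fst v < fst z" if v: "v \<preceq> y1" "v \<preceq> y2" for v
      proof (rule ccontr)
        assume "\<not> fst v < fst z"
        then have "fst z \<le> fst v" by simp
        then obtain s where s: "fst s = fst z" "s \<preceq> y1" "s \<preceq> y2" using low[OF v] by blast
        have "fst s \<in> \<rho>" using \<rho>[of z] c2.S[OF zz] zd s(1) by auto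
        then have "(e1 y1, s) \<in> {(e2 y, v) |y v. y \<in> S2 \<and> v \<preceq> y \<and> fst v \<in> \<rho>}"
          using T1(2)[OF k(1)] s unfolding res[symmetric] by blast
        then obtain y' where "e2 y' = e1 y1" "y' \<in> S2" "s \<preceq> y'" by auto
        then have "s \<preceq> y" using c2.inj[OF _ T2(2)[OF xy(1)]] xy(3) by metis
        then show False using z(3) s by (metis order_less_irrefl)
      qed
      ultimately show ?thesis using z cut_intros(1) by metis
    qed
  qed
  let ?r = "(?R1 \<union> ?R2, C1 \<union> C2)"
  have amal: "?r \<in> Cond lt N" "stronger ?r (?R1, C1)" "stronger ?r (?R2, C2)"
    by (rule amalgamation[where d = d, OF cut1(1) cut2(1) cut1(2) cut2(2)];
        rule agreeR agreeC disj' cross; assumption)+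
  have "(?R1, C1) \<in> Cond lt N" "(?R2, C2) \<in> Cond lt N" using cut1 cut2 by (auto simp: Cond_def)
  then have "stronger ?r (R1, C1)" "stronger ?r (R2, C2)"
    using stronger_trans[OF _ amal(2) cut1(3)] stronger_trans[OF _ amal(3) cut2(3)] amal(1)
    by (simp_all add: Cond_def)
  then show ?thesis using amal(1) unfolding compatible_def by blast
qed

end

lemma omega1_uncountable_above: "\<not> countable {b. (a :: 'w::omega1) < b}"
proof
  assume "countable {b. a < b}"
  then have "countable ({b. b \<le> a} \<union> {b. a < b})" using omega1_countable_atMost by blast
  moreover have "{b. b \<le> a} \<union> {b. a < b} = UNIV" by auto
  ultimately show False using omega1_uncountable[where 'a = 'w] by simp
qed

context normal_tree
begin

text \<open>The Delta-system is formed from the sets of levels instead of the sets of nodes: equally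
  coloured pairs must lie on different levels, so amalgamation needs all levels outside the root to
  be disjoint.\<close>

lemma ccc_Cond: "ccc (Cond lt N) stronger"
  unfolding ccc_def
proof (intro allI impI, rule ccontr)
  fix A assume A: "antichain (Cond lt N) stronger A" and unc: "\<not> countable A"
  have AC: "p \<in> Cond lt N" if "p \<in> A" for p using A that by (auto simp: antichain_def)
  then have ft: "finite_tree (fst p)" and col: "colouring lt N (fst p) (snd p)" if "p \<in> A" for p
    using AC[OF that] by (auto simp: Cond_def)
  define S where "S p = nodes p \<union> targets p" for p :: "'w cond"
  define lev where "lev p = fst ` S p" for p :: "'w cond"
  have finS: "finite (S p)" if "p \<in> A" for p
    unfolding S_def using finite_nodes finite_targets ft col that by blast
  then have finl: "finite (lev p)" if "p \<in> A" for p using that by (simp add: lev_def)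
  have R_sub: "fst p \<subseteq> S p \<times> S p" if "p \<in> A" for p
    using ft_refl[OF ft[OF that]] unfolding S_def nodes_def by (intro subrelI) blast
  have C_sub: "snd p \<subseteq> (S p \<times> S p) \<times> UNIV" if "p \<in> A" for p
    using col_dom(1)[OF col[OF that]] unfolding S_def nodes_def targets_def by auto
  obtain n where n: "\<not> countable {p \<in> A. card (lev p) = n}"
    by (rule uncountable_fiber[OF unc, of "\<lambda>p. card (lev p)" UNIV]) auto
  obtain A2 \<rho> where A2: "A2 \<subseteq> A" "\<not> countable A2" and \<rho>: "\<And>p. p \<in> A2 \<Longrightarrow> \<rho> \<subseteq> lev p"
    "\<And>p q. p \<in> A2 \<Longrightarrow> q \<in> A2 \<Longrightarrow> p \<noteq> q \<Longrightarrow> lev p \<inter> lev q = \<rho>"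
    using delta_system[OF n, of lev n] finl by (smt (verit) mem_Collect_eq subset_iff)
  have fin\<rho>: "finite \<rho>"
  proof -
    have "A2 \<noteq> {}" using A2(2) by auto
    then obtain p where "p \<in> A2" by blast
    then show ?thesis using \<rho>(1) finl A2(1) finite_subset by blast
  qed
  define \<Lambda> where "\<Lambda> = \<rho> \<times> (UNIV :: nat set)"
  have \<Lambda>: "countable \<Lambda>" using fin\<rho> by (simp add: \<Lambda>_def countable_finite)
  \<comment> \<open>Conditions with all levels in the root live on the countable set
    \<open>\<Lambda>\<close> and are finite, so there are only countably many. Dropping them gives
    each remaining condition a level outside the root.\<close>
  define A3 where "A3 = {p \<in> A2. \<not> lev p \<subseteq> \<rho>}"
  have "{p \<in> A2. lev p \<subseteq> \<rho>} \<subseteq> Fpow (\<Lambda> \<times> \<Lambda>) \<times> Fpow ((\<Lambda> \<times> \<Lambda>) \<times> UNIV)"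
  proof
    fix p assume p: "p \<in> {p \<in> A2. lev p \<subseteq> \<rho>}"
    then have pA: "p \<in> A" using A2 by blast
    have "S p \<subseteq> \<Lambda>" using p by (force simp: lev_def \<Lambda>_def)
    then have "fst p \<subseteq> \<Lambda> \<times> \<Lambda>" "snd p \<subseteq> (\<Lambda> \<times> \<Lambda>) \<times> UNIV"
      using R_sub[OF pA] C_sub[OF pA] by blast+
    then show "p \<in> Fpow (\<Lambda> \<times> \<Lambda>) \<times> Fpow ((\<Lambda> \<times> \<Lambda>) \<times> UNIV)"
      using ft_finite[OF ft[OF pA]] col_finite[OF col[OF pA]] by (simp add: Fpow_def mem_Times_iff)
  qed
  moreover have "countable (Fpow (\<Lambda> \<times> \<Lambda>) \<times> Fpow ((\<Lambda> \<times> \<Lambda>) \<times> (UNIV :: nat set)))"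
    using \<Lambda> by (intro countable_SIGMA countable_Fpow) auto
  ultimately have "countable {p \<in> A2. lev p \<subseteq> \<rho>}" by (rule countable_subset)
  then have "\<not> countable (A2 - {p \<in> A2. lev p \<subseteq> \<rho>})"
    by (rule uncountable_minus_countable[OF A2(2)])
  moreover have "A2 - {p \<in> A2. lev p \<subseteq> \<rho>} = A3" unfolding A3_def by blast
  ultimately have A3: "\<not> countable A3" by simp
  \<comment> \<open>A level outside the root occurs in at most one condition of \<open>A3\<close>,
    so the countably many levels up to \<open>d\<close> exclude only countably many
    conditions.\<close>
  have "\<exists>p\<in>A3. \<forall>a\<in>lev p - \<rho>. d < a" for d
  proof -
    have "countable {p \<in> A3. a \<in> lev p - \<rho>}" for a
    proof (cases "\<exists>p\<in>A3. a \<in> lev p - \<rho>")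
      case True
      then obtain p where p: "p \<in> A3" "a \<in> lev p - \<rho>" by blast
      have "q = p" if "q \<in> A3" "a \<in> lev q - \<rho>" for q
        using that p \<rho>(2)[of p q] unfolding A3_def by blast
      then have "{p \<in> A3. a \<in> lev p - \<rho>} \<subseteq> {p}" by blast
      then show ?thesis by (rule countable_subset) simp
    next
      case False
      then have "{p \<in> A3. a \<in> lev p - \<rho>} = {}" by blast
      then show ?thesis by (simp only: countable_empty)
    qed
    then have cnt: "countable (\<Union>a\<in>{a. a \<le> d}. {p \<in> A3. a \<in> lev p - \<rho>})"
      by (intro countable_UN omega1_countable_atMost)
    have "\<not> A3 \<subseteq> (\<Union>a\<in>{a. a \<le> d}. {p \<in> A3. a \<in> lev p - \<rho>})"
      by (rule notI, rule notE[OF A3], erule countable_subset[OF _ cnt])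
    then obtain p where "p \<in> A3" "p \<notin> (\<Union>a\<in>{a. a \<le> d}. {p \<in> A3. a \<in> lev p - \<rho>})"
      unfolding subset_iff by meson
    then have "p \<in> A3" "\<And>a. a \<le> d \<Longrightarrow> a \<notin> lev p - \<rho>" by simp_all
    then show ?thesis by (metis not_le)
  qed
  then obtain P where P: "\<And>d. P d \<in> A3" "\<And>d a. a \<in> lev (P d) - \<rho> \<Longrightarrow> d < a" by metis
  have PA: "P d \<in> A" "P d \<in> A2" for d using P(1)[of d] A2(1) by (auto simp: A3_def)
  obtain g where g: "\<And>a. a \<in> \<rho> \<Longrightarrow> a \<le> g"
    using fin\<rho> by (cases "\<rho> = {}") (auto intro: that[of "Max \<rho>"])
  define E0 where "E0 = {d. g < d}"
  \<comment> \<open>Any level of \<open>p\<close> outside the root bounds all \<open>d\<close> with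
    \<open>P d = p\<close>. So \<open>P\<close> has uncountable range and can be made injective on
    an uncountable set.\<close>
  have fibers: "countable {d \<in> E0. P d = p}" if "p \<in> P ` E0" for p
  proof -
    have "p \<in> A3" using that P by blast
    then obtain a where a: "a \<in> lev p - \<rho>" by (auto simp: A3_def)
    have "{d \<in> E0. P d = p} \<subseteq> {d. d \<le> a}" using P(2)[of a] a by (auto intro: less_imp_le)
    then show ?thesis using omega1_countable_atMost by (rule countable_subset)
  qed
  have "\<not> countable (P ` E0)"
  proof
    assume "countable (P ` E0)"
    then have "countable (\<Union>p\<in>P ` E0. {d \<in> E0. P d = p})" by (rule countable_UN) (rule fibers)
    moreover have "(\<Union>p\<in>P ` E0. {d \<in> E0. P d = p}) = E0" by blast
    ultimately show False using omega1_uncountable_above[of g] by (simp add: E0_def)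
  qed
  moreover obtain E1 where E1: "E1 \<subseteq> E0" "inj_on P E1" "P ` E0 = P ` E1"
    using subset_image_inj[of "P ` E0" P E0] by blast
  ultimately have uncE1: "\<not> countable E1" by (metis countable_image)
  \<comment> \<open>Elements on root levels are kept, the others are numbered within their
    condition. All values lie in the countable set \<open>M\<close>, which leaves countably many
    isomorphism types.\<close>
  define e where "e d x = (if fst x \<in> \<rho> then Inr x else Inl (to_nat_on (S (P d)) x))" for d x
  define M where "M = range Inl \<union> (Inr ` \<Lambda> :: (nat + 'w \<times> nat) set)"
  have M: "countable M" using \<Lambda> by (simp add: M_def)
  have eM: "e d x \<in> M" for d x by (cases x) (auto simp: e_def M_def \<Lambda>_def)
  \<comment> \<open>The type to be uniformised has three parts: the order, the colouring, and the
    predecessors on root levels that nodes and targets have in the given tree.\<close>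
  define D1 where "D1 d = map_prod (e d) (e d) ` fst (P d)" for d
  define D2 where "D2 d = (\<lambda>((x, y), k). ((e d x, e d y), k)) ` snd (P d)" for d
  define D3 where "D3 d = {(e d y, v) |y v. y \<in> S (P d) \<and> v \<preceq> y \<and> fst v \<in> \<rho>}" for d
  have D1: "D1 d \<in> Fpow (M \<times> M)" for d
    using ft_finite[OF ft[OF PA(1)]] eM by (auto simp: D1_def Fpow_def)
  have D2: "D2 d \<in> Fpow ((M \<times> M) \<times> UNIV)" for d
    using col_finite[OF col[OF PA(1)]] eM by (auto simp: D2_def Fpow_def)
  have D3: "D3 d \<in> Fpow (M \<times> \<Lambda>)" for d
  proof -
    have "D3 d = (\<Union>y\<in>S (P d). (\<lambda>v. (e d y, v)) ` {v. v \<preceq> y \<and> fst v \<in> \<rho>})"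
      unfolding D3_def by blast
    moreover have "finite (\<Union>y\<in>S (P d). (\<lambda>v. (e d y, v)) ` {v. v \<preceq> y \<and> fst v \<in> \<rho>})"
      using finS[OF PA(1)] finite_restrictions[OF fin\<rho>] by blast
    ultimately show ?thesis using eM by (auto simp: Fpow_def D3_def \<Lambda>_def mem_Times_iff)
  qed
  have "(\<lambda>d. (D1 d, D2 d, D3 d)) ` E1 \<subseteq> Fpow (M \<times> M) \<times> Fpow ((M \<times> M) \<times> UNIV) \<times> Fpow (M \<times> \<Lambda>)"
    using D1 D2 D3 by (intro image_subsetI SigmaI)
  moreover have "countable (Fpow (M \<times> M) \<times> Fpow ((M \<times> M) \<times> (UNIV :: nat set)) \<times> Fpow (M \<times> \<Lambda>))"
    using M \<Lambda> by (intro countable_SIGMA countable_Fpow) auto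
  ultimately obtain z where "\<not> countable {d \<in> E1. (D1 d, D2 d, D3 d) = z}"
    by (rule uncountable_fiber[OF uncE1])
  moreover obtain Q1 Q2 Q3 where "z = (Q1, Q2, Q3)" by (rule prod_cases3)
  ultimately have z: "\<not> countable {d \<in> E1. (D1 d, D2 d, D3 d) = (Q1, Q2, Q3)}" by simp
  obtain d d' where d: "d \<in> {d \<in> E1. (D1 d, D2 d, D3 d) = (Q1, Q2, Q3)}"
      "d' \<in> {d \<in> E1. (D1 d, D2 d, D3 d) = (Q1, Q2, Q3)}" "d < d'"
    and sep: "\<And>y y' v. y \<in> targets (P d) \<Longrightarrow> y' \<in> targets (P d') \<Longrightarrow> v \<preceq> y \<Longrightarrow> v \<preceq> y' \<Longrightarrow> fst v \<noteq> d"
  proof (rule separated_pair[OF z, of "\<lambda>d. targets (P d)"])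
    show "finite (targets (P d))" for d using finite_targets[OF col[OF PA(1)]] .
    show "Some y \<in> N" if "y \<in> targets (P d)" for d y
      using that col_dom(2)[OF col[OF PA(1)]] unfolding targets_def by blast
  qed (use that in blast)
  have E: "d \<in> E1" "d' \<in> E1" "D1 d = Q1" "D1 d' = Q1" "D2 d = D2 d'" "D3 d = D3 d'"
    using d by auto
  have root: "a < d" if "a \<in> \<rho>" for a using g[OF that] E E1 by (force simp: E0_def)
  \<comment> \<open>Both conditions are collapsed at the smaller index \<open>d\<close>: the levels
    of \<open>P c\<close> outside the root exceed \<open>c\<close>, hence \<open>d\<close>, and the
    choice of \<open>g\<close> keeps the root below \<open>d\<close>.\<close>
  have coll: "collapsed (fst (P c)) d (e c) (S (P c)) Q1" if c: "d \<le> c" "D1 c = Q1" for c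
  proof
    show "finite_tree (fst (P c))" by (rule ft[OF PA(1)])
    show "x \<in> S (P c)" if "(x, x) \<in> fst (P c)" for x using that by (simp add: S_def nodes_def)
    show "Q1 = map_prod (e c) (e c) ` fst (P c)" using c by (simp add: D1_def)
    have cnt: "countable (S (P c))" using finS[OF PA(1)] by (rule countable_finite)
    show "x = y" if "x \<in> S (P c)" "y \<in> S (P c)" "e c x = e c y" for x y
      using that cnt by (auto simp: e_def split: if_splits)
    have *: "fst x \<in> \<rho> \<or> c < fst x" if "x \<in> S (P c)" for x
      using P(2)[of "fst x" c] that by (auto simp: lev_def)
    show "fst x < d \<and> e c x = Inr x" if "x \<in> S (P c)" "fst x \<le> d" for x
      using *[OF that(1)] that(2) root[of "fst x"] c(1) by (auto simp: e_def)
    show "d < fst x \<and> (\<exists>n. e c x = Inl n)" if "x \<in> S (P c)" "d \<le> fst x" for x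
      using *[OF that(1)] that(2) root[of "fst x"] c(1) by (auto simp: e_def)
  qed
  have neq: "P d \<noteq> P d'" using E1(2) E(1,2) d(3) by (auto dest: inj_onD)
  have "compatible (Cond lt N) stronger (fst (P d), snd (P d)) (fst (P d'), snd (P d'))"
  proof (rule ccc_amalgamation[where Q = Q1 and d = d and ?e1.0 = "e d" and ?e2.0 = "e d'"
        and ?S1.0 = "S (P d)" and ?S2.0 = "S (P d')" and \<rho> = \<rho>])
    show "(fst (P d), snd (P d)) \<in> Cond lt N" "(fst (P d'), snd (P d')) \<in> Cond lt N"
      using AC PA(1) by simp_all
    show "collapsed (fst (P d)) d (e d) (S (P d)) Q1" "collapsed (fst (P d')) d (e d') (S (P d')) Q1"
      using coll E d(3) by auto
    show "(\<lambda>((x, y), k). ((e d x, e d y), k)) ` snd (P d) = (\<lambda>((x, y), k). ((e d' x, e d' y), k)) ` snd (P d')"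
      using E(5) by (simp add: D2_def)
    show "{(e d y, v) |y v. y \<in> S (P d) \<and> v \<preceq> y \<and> fst v \<in> \<rho>} =
        {(e d' y, v) |y v. y \<in> S (P d') \<and> v \<preceq> y \<and> fst v \<in> \<rho>}"
      using E(6) by (simp add: D3_def)
    show "fst x \<in> \<rho>" if "x \<in> S (P d) \<union> S (P d')" "fst x < d" for x
      using P(2)[of "fst x"] that d(3) unfolding lev_def by force
    show "fst x < d" if "x \<in> S (P d)" "y \<in> S (P d')" "fst x = fst y" for x y
      using \<rho>(2)[OF PA(2) PA(2) neq] root that unfolding lev_def by (metis IntI imageI)
    show "fst v \<noteq> d" if "y \<in> targets (fst (P d), snd (P d))" "y' \<in> targets (fst (P d'), snd (P d'))"
      "v \<preceq> y" "v \<preceq> y'" for y y' v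
      using sep that by simp
  qed (simp_all add: S_def)
  then show False using A PA(1) neq unfolding antichain_def by simp
qed

end

section \<open>Meets and non-embeddability\<close>

lemma ex_greater: "\<exists>b. (a :: 'w::omega1) < b"
proof -
  have "{b. a < b} \<noteq> {}" using omega1_uncountable_above[of a] by (metis countable_empty)
  then show ?thesis by blast
qed

lemma countable_bounded:
  fixes X :: "'w::omega1 set"
  assumes "countable X"
  shows "\<exists>b. \<forall>x\<in>X. x < b"
proof -
  have cnt: "countable (\<Union>x\<in>X. {b. b \<le> x})"
    using assms omega1_countable_atMost by (intro countable_UN)
  have "(\<Union>x\<in>X. {b. b \<le> x}) \<noteq> UNIV"
  proof
    assume "(\<Union>x\<in>X. {b. b \<le> x}) = UNIV"
    then show False using cnt omega1_uncountable[where 'a = 'w] by simp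
  qed
  then obtain b where "b \<notin> (\<Union>x\<in>X. {b. b \<le> x})" by blast
  then have "\<forall>x\<in>X. x < b" by (simp add: not_le)
  then show ?thesis ..
qed

text \<open>The limit is the least strict upper bound of the sequence obtained from \<open>a\<close>
  by iterating the successor \<open>sc\<close>.\<close>

lemma ex_limit_greater:
  fixes a :: "'w::omega1"
  obtains l where "a < l" "is_limit l"
proof -
  define sc where "sc b = (LEAST c. b < c)" for b :: 'w
  have sc: "b < sc b" for b unfolding sc_def using ex_greater by (rule LeastI_ex)
  define s where "s n = (sc ^^ n) a" for n
  have s: "s n < s (Suc n)" for n using sc by (simp add: s_def)
  obtain u where u: "\<forall>n. s n < u" using countable_bounded[of "range s"] by auto
  define l where "l = (LEAST l. \<forall>n. s n < l)"
  have "\<forall>n. s n < l" unfolding l_def using u by (rule LeastI)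
  then have l: "s n < l" for n by blast
  have "\<exists>c. b < c \<and> c < l" if "b < l" for b
  proof -
    have "\<not> (\<forall>n. s n < b)" using that not_less_Least unfolding l_def by blast
    then obtain n where "b \<le> s n" by (auto simp: not_less)
    then show ?thesis using s[of n] l[of "Suc n"] by (intro exI[of _ "s (Suc n)"]) auto
  qed
  then have "is_limit l" unfolding is_limit_def using l by blast
  moreover have "a < l" using l[of 0] by (simp add: s_def)
  ultimately show ?thesis using that by blast
qed

lemma uncountable_limits: "\<not> countable {l :: 'w::omega1. is_limit l}"
proof
  assume "countable {l :: 'w. is_limit l}"
  then obtain b :: 'w where b: "\<forall>l\<in>{l. is_limit l}. l < b" using countable_bounded by metis
  obtain l where "b < l" "is_limit l" by (rule ex_limit_greater)
  then show False using b order_less_asym[of l b] by blast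
qed

lemma uncountable_two:
  assumes "\<not> countable A"
  obtains a b where "a \<in> A" "b \<in> A" "a \<noteq> b"
proof -
  have "A \<noteq> {}" using assms by auto
  then obtain a where "a \<in> A" by blast
  moreover have "A \<noteq> {a}" using assms by auto
  ultimately show ?thesis using that by blast
qed

section \<open>Meets in a normal tree\<close>

context normal_tree
begin

abbreviation leq :: "'w node \<Rightarrow> 'w node \<Rightarrow> bool" where
  "leq x y \<equiv> x = y \<or> lt x y"

lemma leq_Some: "leq (Some s) (Some t) \<longleftrightarrow> s \<preceq> t"
  by (auto simp: tle_def)

lemma leq_None: "Some s \<in> N \<Longrightarrow> leq None (Some s)"
  using lt_None by blast

lemma meet_eqI:
  assumes "z \<in> N" "leq z x" "leq z y" "\<And>w. w \<in> N \<Longrightarrow> leq w x \<Longrightarrow> leq w y \<Longrightarrow> leq w z"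
  shows "meet N lt x y = z"
  unfolding meet_def
proof (rule the_equality)
  fix u assume "u \<in> N \<and> leq u x \<and> leq u y \<and> (\<forall>w\<in>N. leq w x \<and> leq w y \<longrightarrow> leq w u)"
  then have "leq u z" "leq z u" using assms by blast+
  then show "u = z" using lt_trans[of u z u] lt_irrefl by blast
qed (use assms in blast)

text \<open>Existence rests on normality. The levels of common lower bounds form an initial segment
  \<open>W\<close>. If \<open>W\<close> is nonempty and has no maximum, the least level
  \<open>g\<close> outside it is a limit, and the restrictions of \<open>x\<close> and
  \<open>y\<close> to level \<open>g\<close> have the same predecessors. So they coincide, which
  puts \<open>g\<close> into \<open>W\<close>.\<close>

lemma meet_exists:
  assumes x: "Some x \<in> N" and y: "Some y \<in> N" and inc: "\<not> x \<preceq> y" "\<not> y \<preceq> x"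
  obtains z where "z \<in> N" "leq z (Some x)" "leq z (Some y)"
    "\<And>w. w \<in> N \<Longrightarrow> leq w (Some x) \<Longrightarrow> leq w (Some y) \<Longrightarrow> leq w z"
proof -
  define W where "W = {b. \<exists>v. v \<preceq> x \<and> v \<preceq> y \<and> fst v = b}"
  have notin: "fst x \<notin> W" "fst y \<notin> W"
  proof -
    have same: "v = w" if "v \<preceq> w" "fst v = fst w" for v w using le_level[OF that(1)] that(2) by simp
    show "fst x \<notin> W" "fst y \<notin> W" using inc same unfolding W_def by blast+
  qed
  have down: "b \<in> W" if c: "c \<in> W" "b \<le> c" for b c
  proof -
    from c(1) obtain v where v: "v \<preceq> x" "v \<preceq> y" "fst v = c" unfolding W_def by blast
    then obtain s where "fst s = b" "s \<preceq> v" using le_restrict[of v b] le_in[OF v(1) x] c(2) by blast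
    then show ?thesis using v le_trans unfolding W_def by blast
  qed
  consider (empty) "W = {}" | (max) b where "b \<in> W" "\<forall>c\<in>W. c \<le> b"
    | (lim) "W \<noteq> {}" "\<forall>b\<in>W. \<exists>c\<in>W. b < c"
    by (metis not_le)
  then show ?thesis
  proof cases
    case empty
    have none: "\<not> (v \<preceq> x \<and> v \<preceq> y)" for v using empty unfolding W_def by blast
    show ?thesis
    proof (rule that[of None])
      fix w assume "leq w (Some x)" "leq w (Some y)"
      then show "leq w None" using none leq_Some by (cases w) blast+
    qed (use None_in leq_None x y in blast)+
  next
    case (max b)
    then obtain v where v: "v \<preceq> x" "v \<preceq> y" "fst v = b" unfolding W_def by blast
    show ?thesis
    proof (rule that[of "Some v"])
      show vN: "Some v \<in> N" using le_in[OF v(1) x] .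
      show "leq (Some v) (Some x)" "leq (Some v) (Some y)" using v leq_Some by blast+
      fix w assume w: "leq w (Some x)" "leq w (Some y)"
      show "leq w (Some v)"
      proof (cases w)
        case None then show ?thesis using leq_None vN by blast
      next
        case (Some s)
        then have s: "s \<preceq> x" "s \<preceq> y" using w leq_Some by blast+
        then have "fst s \<in> W" unfolding W_def by blast
        then have "fst s \<le> fst v" using max v by blast
        then show ?thesis using le_linear_level[OF s(1) v(1)] leq_Some Some by blast
      qed
    qed
  next
    case lim
    define g where "g = (LEAST b. b \<notin> W)"
    have g: "g \<notin> W" unfolding g_def using notin(1) by (rule LeastI)
    have below: "b \<in> W \<longleftrightarrow> b < g" for b
      using g down[of b g] down[of _ b] not_less_Least[of b "\<lambda>b. b \<notin> W"] unfolding g_def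
      by (metis down g g_def not_le)
    have "is_limit g" unfolding is_limit_def using lim below by blast
    have "g \<le> fst x" "g \<le> fst y" using notin below not_le by blast+
    then obtain s t where s: "fst s = g" "s \<preceq> x" and t: "fst t = g" "t \<preceq> y"
      using le_restrict x y by metis
    have st: "Some s \<in> N" "Some t \<in> N" using le_in s t x y by blast+
    have common: "v \<preceq> y" if "v \<preceq> x" "fst v < g" for v
    proof -
      have "fst v \<in> W" using that below by blast
      then obtain u where u: "u \<preceq> x" "u \<preceq> y" "fst u = fst v" unfolding W_def by blast
      have "u = v" using le_linear[OF that(1) u(1)] le_level[of u v] le_level[of v u] u(3) by auto
      then show ?thesis using u by blast
    qed
    have common': "v \<preceq> x" if "v \<preceq> y" "fst v < g" for v
    proof -
      have "fst v \<in> W" using that below by blast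
      then obtain u where u: "u \<preceq> x" "u \<preceq> y" "fst u = fst v" unfolding W_def by blast
      have "u = v" using le_linear[OF that(1) u(2)] le_level[of u v] le_level[of v u] u(3) by auto
      then show ?thesis using u by blast
    qed
    have pred: "lt (Some v) (Some s) \<longleftrightarrow> v \<preceq> x \<and> fst v < g" if s: "fst s = g" "s \<preceq> x" for v s x
    proof
      assume v: "lt (Some v) (Some s)"
      then have "v \<preceq> s" by (simp add: tle_def)
      then show "v \<preceq> x \<and> fst v < g" using le_trans s lt_level[OF v] by blast
    next
      assume v: "v \<preceq> x \<and> fst v < g"
      then have "v \<preceq> s" using le_linear_level[of v x s] s by (simp add: less_imp_le)
      then show "lt (Some v) (Some s)" using v s(1) by (auto simp: tle_def)
    qed
    have "lt z (Some s) \<longleftrightarrow> lt z (Some t)" for z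
    proof (cases z)
      case None then show ?thesis using lt_None st by blast
    next
      case (Some v) then show ?thesis using pred[OF s] pred[OF t] common common' by blast
    qed
    then have "s = t" using normal st s t \<open>is_limit g\<close> by fastforce
    then have "g \<in> W" using s t unfolding W_def by blast
    then show ?thesis using g by blast
  qed
qed

lemma meet_props:
  assumes "Some x \<in> N" "Some y \<in> N" "\<not> x \<preceq> y" "\<not> y \<preceq> x"
  shows "leq (meet N lt (Some x) (Some y)) (Some x)" "leq (meet N lt (Some x) (Some y)) (Some y)"
    "v \<preceq> x \<Longrightarrow> v \<preceq> y \<Longrightarrow> leq (Some v) (meet N lt (Some x) (Some y))"
proof -
  obtain z where z: "z \<in> N" "leq z (Some x)" "leq z (Some y)"
    "\<And>w. w \<in> N \<Longrightarrow> leq w (Some x) \<Longrightarrow> leq w (Some y) \<Longrightarrow> leq w z"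
    using meet_exists[OF assms] by blast
  have m: "meet N lt (Some x) (Some y) = z" by (rule meet_eqI[OF z])
  show "leq (meet N lt (Some x) (Some y)) (Some x)" "leq (meet N lt (Some x) (Some y)) (Some y)"
    unfolding m by (rule z)+
  assume v: "v \<preceq> x" "v \<preceq> y"
  then have "leq (Some v) z" using z(4)[of "Some v"] le_in[OF v(1) assms(1)] leq_Some by blast
  then show "leq (Some v) (meet N lt (Some x) (Some y))" unfolding m .
qed

lemma incomparable_iff: "incomparable lt (Some s) (Some t) \<longleftrightarrow> \<not> s \<preceq> t \<and> \<not> t \<preceq> s"
  by (auto simp: incomparable_def tle_def)

end

text \<open>A weak embedding may raise levels but cannot lower them. So the image of a node
  \<open>x d\<close> on level \<open>d\<close> can be cut back to a node \<open>y d\<close> on the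
  same level, and two limit levels \<open>d\<close> and \<open>e\<close> get the same
  colour.\<close>

lemma A2sp_not_weakly_embeds:
  assumes A: "A2sp N1 lt1 N2 lt2 c"
  shows "\<not> weakly_embeds N1 lt1 N2 lt2"
proof
  assume "weakly_embeds N1 lt1 N2 lt2"
  then obtain f where f: "\<And>x. x \<in> N1 \<Longrightarrow> f x \<in> N2"
    "\<And>x y. x \<in> N1 \<Longrightarrow> y \<in> N1 \<Longrightarrow> lt1 x y \<Longrightarrow> lt2 (f x) (f y)"
    unfolding weakly_embeds_def by blast
  interpret t1: normal_tree N1 lt1 by unfold_locales (use A in \<open>simp add: A2sp_def\<close>)
  interpret t2: normal_tree N2 lt2 by unfold_locales (use A in \<open>simp add: A2sp_def\<close>)
  define g where "g s = the (f (Some s))" for s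
  have g: "f (Some s) = Some (g s)" if s: "Some s \<in> N1" for s
  proof -
    have "lt1 None (Some s)" using t1.lt_None s by blast
    then have "lt2 (f None) (f (Some s))" using f(2) t1.None_in s by blast
    then have "f (Some s) \<noteq> None" using t2.not_lt_None by metis
    then show ?thesis by (simp add: g_def)
  qed
  have gN: "Some (g s) \<in> N2" if "Some s \<in> N1" for s using g f(1) that by metis
  have mono: "tle lt2 (g s) (g t)" if "tle lt1 s t" "Some t \<in> N1" for s t
    using that t1.le_in[OF that] f(2)[of "Some s" "Some t"] g by (auto simp: tle_def)
  \<comment> \<open>If the level dropped, the predecessor of \<open>s\<close> on level
    \<open>fst (g s)\<close> would by induction have an image at least that high, but this image is
    strictly below \<open>g s\<close>.\<close>
  have lev: "fst s \<le> fst (g s)" if "Some s \<in> N1" for s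
    using that
  proof (induction "fst s" arbitrary: s rule: less_induct)
    case less
    show ?case
    proof (rule ccontr)
      assume "\<not> fst s \<le> fst (g s)"
      then have lt: "fst (g s) < fst s" by simp
      then obtain n where n: "lt1 (Some (fst (g s), n)) (Some s)" using t1.lt_restrict less.prems by blast
      let ?t = "(fst (g s), n)"
      have "Some ?t \<in> N1" using n t1.lt_in by blast
      then have "fst ?t \<le> fst (g ?t)" "lt2 (Some (g ?t)) (Some (g s))"
        using less.hyps[of ?t] lt f(2)[OF _ _ n] g less.prems by auto
      then show False using t2.lt_level by fastforce
    qed
  qed
  have "\<exists>x y. Some x \<in> N1 \<and> fst x = d \<and> Some y \<in> N2 \<and> fst y = d \<and> tle lt2 y (g x)" for d
  proof -
    obtain n where n: "Some (d, n) \<in> N1" using t1.level_nonempty by blast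
    then have "d \<le> fst (g (d, n))" using lev by fastforce
    then obtain y where "fst y = d" "tle lt2 y (g (d, n))" using t2.le_restrict[OF gN[OF n]] by blast
    then show ?thesis using n t2.le_in gN[OF n] by fastforce
  qed
  then obtain x y where xy: "\<And>d. Some (x d) \<in> N1" "\<And>d. fst (x d) = d" "\<And>d. Some (y d) \<in> N2"
    "\<And>d. fst (y d) = d" "\<And>d. tle lt2 (y d) (g (x d))"
    by metis
  obtain k where k: "\<not> countable {d \<in> {d. is_limit d}. c (Some (x d)) (Some (y d)) = k}"
    by (rule uncountable_fiber[OF uncountable_limits, of "\<lambda>d. c (Some (x d)) (Some (y d))" UNIV]) auto
  obtain d e where de: "is_limit d" "is_limit e" "d \<noteq> e"
    "c (Some (x d)) (Some (y d)) = c (Some (x e)) (Some (y e))"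
    by (rule uncountable_two[OF k]) auto
  have lp: "limit_pair N1 N2 (Some (x d)) (Some (y d))" if "is_limit d" for d
    using that xy by (simp add: limit_pair_def)
  have "(Some (x d), Some (y d)) \<noteq> (Some (x e), Some (y e))" using de(3) xy(2) by (metis Pair_inject option.inject)
  then have sp: "incomparable lt1 (Some (x d)) (Some (x e))" "incomparable lt2 (Some (y d)) (Some (y e))"
    "ht_greater (meet N1 lt1 (Some (x d)) (Some (x e))) (meet N2 lt2 (Some (y d)) (Some (y e)))"
    using A lp[OF de(1)] lp[OF de(2)] de(4) unfolding A2sp_def by blast+
  note m1 = t1.meet_props[OF xy(1) xy(1), of d e] and m2 = t2.meet_props[OF xy(3) xy(3), of d e]
  have inc: "\<not> tle lt1 (x d) (x e)" "\<not> tle lt1 (x e) (x d)" "\<not> tle lt2 (y d) (y e)" "\<not> tle lt2 (y e) (y d)"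
    using sp t1.incomparable_iff t2.incomparable_iff by blast+
  obtain z where z: "meet N1 lt1 (Some (x d)) (Some (x e)) = Some z"
    using sp(3) unfolding ht_greater_def by (metis option.exhaust option.simps(4))
  then have zle: "tle lt1 z (x d)" "tle lt1 z (x e)"
    using m1(1,2)[OF inc(1,2)] t1.leq_Some by metis+
  have zN: "Some z \<in> N1" using t1.le_in[OF zle(1) xy(1)] .
  \<comment> \<open>\<open>s\<close> is the image of the meet \<open>z\<close>, cut back to the
    level of \<open>z\<close>. It lies below \<open>y d\<close> and \<open>y e\<close>, as all of
    them are predecessors of images of nodes above \<open>z\<close>; so the meet of the targets is
    at least as high as \<open>z\<close>.\<close>
  obtain s where s: "fst s = fst z" "tle lt2 s (g z)" using t2.le_restrict[OF gN[OF zN] lev[OF zN]] by blast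
  have "tle lt2 s (y c)" if "tle lt1 z (x c)" for c
  proof -
    have "tle lt2 s (g (x c))" using t2.le_trans[OF s(2) mono[OF that xy(1)]] .
    moreover have "fst s \<le> fst (y c)" using t1.le_level[OF that] s(1) xy(2,4) by force
    ultimately show ?thesis using t2.le_linear_level xy(5) by blast
  qed
  then have "Some s = meet N2 lt2 (Some (y d)) (Some (y e)) \<or> lt2 (Some s) (meet N2 lt2 (Some (y d)) (Some (y e)))"
    using m2(3)[OF inc(3,4)] zle by blast
  then obtain v where v: "meet N2 lt2 (Some (y d)) (Some (y e)) = Some v" "tle lt2 s v"
    using t2.not_lt_None t2.leq_Some by (cases "meet N2 lt2 (Some (y d)) (Some (y e))") auto
  have "fst v < fst z" using sp(3) unfolding z v(1) by (simp add: ht_greater_def)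
  then show False using t2.le_level[OF v(2)] s(1) by auto
qed

section \<open>The generic tree\<close>

locale generic_tree = normal_tree +
  fixes G
  assumes filter: "is_filter (Cond lt N) stronger G"
    and generic: "G \<inter> generic_dense lt N i \<noteq> {}"
begin

definition R where "R = (\<Union>p\<in>G. fst p)"

text \<open>Density puts every pair into some condition of the filter, so the node set is
  \<open>UNIV\<close> and each level is a whole block of pairs; the root \<open>None\<close> is
  added below.\<close>

definition ltG :: "'a node \<Rightarrow> 'a node \<Rightarrow> bool" where
  "ltG a b \<longleftrightarrow> (case b of None \<Rightarrow> False
     | Some y \<Rightarrow> (case a of None \<Rightarrow> True | Some x \<Rightarrow> x \<noteq> y \<and> (x, y) \<in> R))"

definition colourG :: "'a node \<Rightarrow> 'a node \<Rightarrow> nat" where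
  "colourG a b = (THE k. \<exists>p\<in>G. ((the a, the b), k) \<in> snd p)"

lemma G_cond: "p \<in> G \<Longrightarrow> finite_tree (fst p)" "p \<in> G \<Longrightarrow> colouring lt N (fst p) (snd p)"
  using filter unfolding is_filter_def Cond_def by auto

lemma G_directed:
  assumes "p \<in> G" "q \<in> G"
  obtains r where "r \<in> G" "stronger r p" "stronger r q"
  using assms filter unfolding is_filter_def by meson

lemma fst_mono: "stronger r p \<Longrightarrow> x \<in> fst p \<Longrightarrow> x \<in> fst r"
  and snd_mono: "stronger r p \<Longrightarrow> y \<in> snd p \<Longrightarrow> y \<in> snd r"
  unfolding stronger_def by blast+

lemma G_node: "\<exists>p\<in>G. (x, x) \<in> fst p"
  and G_below: "d < fst x \<Longrightarrow> \<exists>n. ((d, n), x) \<in> R"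
  and G_colour: "Some y \<in> N \<Longrightarrow> fst y = fst x \<Longrightarrow> \<exists>k. \<exists>p\<in>G. ((x, y), k) \<in> snd p"
  using generic[of "(x, y, d)"] unfolding generic_dense_def R_def by auto

lemma mem_R: "p \<in> G \<Longrightarrow> (x, y) \<in> fst p \<Longrightarrow> (x, y) \<in> R"
  unfolding R_def by blast

lemma G_node2:
  obtains p where "p \<in> G" "(x, x) \<in> fst p" "(y, y) \<in> fst p"
proof -
  obtain p q where "p \<in> G" "(x, x) \<in> fst p" "q \<in> G" "(y, y) \<in> fst q" using G_node by meson
  then show ?thesis using G_directed[of p q] that fst_mono by metis
qed

text \<open>A common extension of \<open>p\<close> and of the condition that contributes the pair
  lies in the filter, and it reflects the relation to the nodes of \<open>p\<close>.\<close>

lemma R_in: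
  assumes "p \<in> G" "(x, x) \<in> fst p" "(y, y) \<in> fst p" "(x, y) \<in> R"
  shows "(x, y) \<in> fst p"
proof -
  obtain q where q: "q \<in> G" "(x, y) \<in> fst q" using assms(4) by (auto simp: R_def)
  obtain r where r: "r \<in> G" "stronger r p" "stronger r q" by (rule G_directed[OF assms(1) q(1)])
  then show ?thesis using stronger_reflects[OF G_cond(1) r(2)] assms q fst_mono by blast
qed

lemma R_iff:
  assumes "p \<in> G" "(x, x) \<in> fst p" "(y, y) \<in> fst p"
  shows "(x, y) \<in> R \<longleftrightarrow> (x, y) \<in> fst p"
  using R_in[OF assms] mem_R[OF assms(1)] by blast

lemma R_level: "(x, y) \<in> R \<Longrightarrow> x = y \<or> fst x < fst y"
  using ft_level[OF G_cond(1)] unfolding R_def by blast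

lemma R_refl: "(x, x) \<in> R"
  using G_node unfolding R_def by blast

lemma R_common:
  obtains p where "p \<in> G" "(x, x) \<in> fst p" "(y, y) \<in> fst p" "(z, z) \<in> fst p"
proof -
  obtain p where p: "p \<in> G" "(x, x) \<in> fst p" "(y, y) \<in> fst p" by (rule G_node2)
  obtain q where q: "q \<in> G" "(z, z) \<in> fst q" using G_node by blast
  obtain r where "r \<in> G" "stronger r p" "stronger r q" by (rule G_directed[OF p(1) q(1)])
  then show ?thesis using that p q fst_mono by blast
qed

lemma R_trans: "(x, z) \<in> R" if "(x, y) \<in> R" "(y, z) \<in> R"
proof -
  obtain p where p: "p \<in> G" "(x, x) \<in> fst p" "(y, y) \<in> fst p" "(z, z) \<in> fst p" by (rule R_common)
  then show ?thesis using that R_iff ft_trans[OF G_cond(1)[OF p(1)]] by blast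
qed

lemma R_linear: "(y, z) \<in> R \<or> (z, y) \<in> R" if "(y, x) \<in> R" "(z, x) \<in> R"
proof -
  obtain p where p: "p \<in> G" "(x, x) \<in> fst p" "(y, y) \<in> fst p" "(z, z) \<in> fst p" by (rule R_common)
  then show ?thesis using that R_iff ft_linear[OF G_cond(1)[OF p(1)]] by blast
qed

text \<open>Each condition of the filter fixes the meets of its nodes once and for all; normality of
  the generic tree at limit levels rests on this.\<close>

lemma R_meet:
  assumes p: "p \<in> G" "(x, x) \<in> fst p" "(y, y) \<in> fst p" and z: "(z, x) \<in> R" "(z, y) \<in> R"
  obtains t where "(t, x) \<in> fst p" "(t, y) \<in> fst p" "(z, t) \<in> R"
proof -
  obtain q where q: "q \<in> G" "(z, z) \<in> fst q" using G_node by blast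
  obtain r where r: "r \<in> G" "stronger r p" "stronger r q" by (rule G_directed[OF p(1) q(1)])
  have "(z, x) \<in> fst r" "(z, y) \<in> fst r"
    using R_in[OF r(1)] fst_mono[OF r(2)] fst_mono[OF r(3)] p q z by blast+
  then obtain t where "(t, x) \<in> fst p" "(t, y) \<in> fst p" "(z, t) \<in> fst r"
    using r(2) p(2,3) unfolding stronger_def by meson
  then show ?thesis using that r(1) unfolding R_def by blast
qed

lemma colour_common:
  assumes "p \<in> G" "((x, y), k) \<in> snd p" "q \<in> G" "((x', y'), l) \<in> snd q"
  obtains r where "r \<in> G" "((x, y), k) \<in> snd r" "((x', y'), l) \<in> snd r"
proof -
  obtain r where "r \<in> G" "stronger r p" "stronger r q" by (rule G_directed[OF assms(1,3)])
  then show ?thesis using that assms snd_mono by blast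
qed

lemma colourG:
  assumes "Some y \<in> N" "fst y = fst x"
  shows "\<exists>p\<in>G. ((x, y), colourG (Some x) (Some y)) \<in> snd p"
proof -
  have "\<exists>!k. \<exists>p\<in>G. ((x, y), k) \<in> snd p"
  proof (rule ex_ex1I)
    show "\<exists>k. \<exists>p\<in>G. ((x, y), k) \<in> snd p" using G_colour[OF assms] .
    fix k l assume "\<exists>p\<in>G. ((x, y), k) \<in> snd p" "\<exists>p\<in>G. ((x, y), l) \<in> snd p"
    then obtain p q where "p \<in> G" "((x, y), k) \<in> snd p" "q \<in> G" "((x, y), l) \<in> snd q" by blast
    then obtain r where r: "r \<in> G" "((x, y), k) \<in> snd r" "((x, y), l) \<in> snd r" by (rule colour_common)
    show "k = l" by (rule col_unique[OF G_cond(2)[OF r(1)] r(2,3)])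
  qed
  then show ?thesis unfolding colourG_def option.sel by (rule theI')
qed

lemma colourG_same:
  assumes "Some y1 \<in> N" "fst y1 = fst x1" "Some y2 \<in> N" "fst y2 = fst x2"
    "colourG (Some x1) (Some y1) = colourG (Some x2) (Some y2)" "(x1, y1) \<noteq> (x2, y2)"
  shows "fst x1 \<noteq> fst x2" "(x1, x2) \<notin> R" "(x2, x1) \<notin> R"
    "\<exists>z. (z, x1) \<in> R \<and> (z, x2) \<in> R \<and> (\<forall>v. v \<preceq> y1 \<longrightarrow> v \<preceq> y2 \<longrightarrow> fst v < fst z)"
proof -
  obtain p q where "p \<in> G" "((x1, y1), colourG (Some x1) (Some y1)) \<in> snd p"
    "q \<in> G" "((x2, y2), colourG (Some x1) (Some y1)) \<in> snd q"
    using colourG[OF assms(1,2)] colourG[OF assms(3,4)] assms(5) by metis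
  then obtain r where r: "r \<in> G" "((x1, y1), colourG (Some x1) (Some y1)) \<in> snd r"
    "((x2, y2), colourG (Some x1) (Some y1)) \<in> snd r" by (rule colour_common)
  note c = G_cond(2)[OF r(1)]
  have x: "(x1, x1) \<in> fst r" "(x2, x2) \<in> fst r" using col_dom(1)[OF c] r by blast+
  show "fst x1 \<noteq> fst x2" "(x1, x2) \<notin> R"
    using col_same(1,2)[OF c r(2,3) assms(6)] R_in[OF r(1)] x by blast+
  show "(x2, x1) \<notin> R"
    using col_same(2)[OF c r(3,2)] assms(6) R_in[OF r(1)] x by blast
  show "\<exists>z. (z, x1) \<in> R \<and> (z, x2) \<in> R \<and> (\<forall>v. v \<preceq> y1 \<longrightarrow> v \<preceq> y2 \<longrightarrow> fst v < fst z)"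
    using col_same(3)[OF c r(2,3) assms(6)] r(1) mem_R by meson
qed

lemma ltG_simps [simp]: "\<not> ltG a None" "ltG None (Some y)"
  "ltG (Some x) (Some y) \<longleftrightarrow> x \<noteq> y \<and> (x, y) \<in> R"
  by (simp_all add: ltG_def)

lemma R_antisym: "(x, y) \<in> R \<Longrightarrow> (y, x) \<in> R \<Longrightarrow> x = y"
  using R_level[of x y] R_level[of y x] by auto

lemma ltG_trans: "ltG a b \<Longrightarrow> ltG b c \<Longrightarrow> ltG a c"
proof -
  assume ab: "ltG a b" and bc: "ltG b c"
  from ab obtain y where y: "b = Some y" by (cases b) auto
  from bc obtain z where z: "c = Some z" by (cases c) auto
  show "ltG a c"
  proof (cases a)
    case (Some x)
    then have "x \<noteq> y" "(x, y) \<in> R" "(y, z) \<in> R" using ab bc y z by auto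
    then show ?thesis using R_trans[of x y z] R_antisym[of x y] Some z by auto
  qed (simp add: z)
qed

lemma ltG_levels: "tree_levels (UNIV - {None}) (\<lambda>x y. ltG x y \<and> x \<noteq> None) ht"
  unfolding tree_levels_def
proof (intro conjI allI impI ballI)
  fix x y z assume "ltG x y \<and> x \<noteq> None" "ltG y z \<and> y \<noteq> None"
  then show "ltG x z" using ltG_trans by blast
next
  fix x y z assume "ltG y x \<and> y \<noteq> None" "ltG z x \<and> z \<noteq> None"
  then show "y = z \<or> ltG y z \<and> y \<noteq> None \<or> ltG z y \<and> z \<noteq> None"
    using R_linear[of "the y" "the x" "the z"] by (cases x; cases y; cases z) auto
next
  fix x y assume "ltG x y \<and> x \<noteq> None"
  then show "ht x < ht y" using R_level[of "the x" "the y"] by (cases x; cases y) auto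
next
  fix x y assume "ltG x y \<and> x \<noteq> None"
  then show "y \<in> UNIV - {None}" by (cases y) auto
next
  fix x :: "'a node" assume "x \<in> UNIV - {None}"
  then obtain s where s: "x = Some s" by auto
  show "bij_betw ht {y. ltG y x \<and> y \<noteq> None} {b. b < ht x}"
    unfolding bij_betw_def
  proof
    show "inj_on ht {y. ltG y x \<and> y \<noteq> None}"
    proof (rule inj_onI)
      fix y z assume y: "y \<in> {y. ltG y x \<and> y \<noteq> None}" and z: "z \<in> {y. ltG y x \<and> y \<noteq> None}"
        and h: "ht y = ht z"
      obtain t u where tu: "y = Some t" "z = Some u" using y z by auto
      then have "(t, u) \<in> R \<or> (u, t) \<in> R" using y z R_linear[of t s u] s by auto
      then show "y = z" using R_level[of t u] R_level[of u t] h tu by auto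
    qed
    show "ht ` {y. ltG y x \<and> y \<noteq> None} = {b. b < ht x}"
    proof (intro equalityI subsetI)
      fix b assume "b \<in> ht ` {y. ltG y x \<and> y \<noteq> None}"
      then obtain y where "b = ht y" "ltG y x" "y \<noteq> None" by blast
      then show "b \<in> {b. b < ht x}" using R_level[of "the y" s] s by (cases y) auto
    next
      fix b assume "b \<in> {b. b < ht x}"
      then obtain n where "((b, n), s) \<in> R" "b < fst s" using G_below[of b s] s by auto
      then show "b \<in> ht ` {y. ltG y x \<and> y \<noteq> None}"
        using s by (intro image_eqI[of _ _ "Some (b, n)"]) auto
    qed
  qed
qed auto

text \<open>Each \<open>s\<close> in the chain is coloured together with a chosen node
  \<open>y s\<close> of the given tree on its level. On an uncountable chain two elements get equal
  colours, which forces them to be incomparable.\<close>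

lemma ltG_chain_countable:
  assumes B: "is_chain UNIV ltG B"
  shows "countable B"
proof (rule ccontr)
  assume unc: "\<not> countable B"
  define B' where "B' = {s. Some s \<in> B}"
  have "B \<subseteq> insert None (Some ` B')"
  proof
    fix x assume "x \<in> B" then show "x \<in> insert None (Some ` B')" by (cases x) (auto simp: B'_def)
  qed
  then have unc': "\<not> countable B'"
    using unc countable_subset by (metis countable_image countable_insert)
  have "\<exists>y. Some y \<in> N \<and> fst y = fst s" for s :: "'a \<times> nat" using level_nonempty by (metis fst_conv)
  then have "\<exists>y. \<forall>s :: 'a \<times> nat. Some (y s) \<in> N \<and> fst (y s) = fst s" by (intro choice allI)
  then obtain y where y: "\<And>s. Some (y s) \<in> N" "\<And>s :: 'a \<times> nat. fst (y s) = fst s" by blast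
  obtain k where "\<not> countable {s \<in> B'. colourG (Some s) (Some (y s)) = k}"
    by (rule uncountable_fiber[OF unc', of "\<lambda>s. colourG (Some s) (Some (y s))" UNIV]) auto
  then obtain s t where st: "s \<in> B'" "t \<in> B'" "s \<noteq> t"
    "colourG (Some s) (Some (y s)) = colourG (Some t) (Some (y t))"
    by (rule uncountable_two) auto
  then have "(s, t) \<notin> R" "(t, s) \<notin> R" using colourG_same[OF y y st(4)] by blast+
  then show False using st B unfolding is_chain_def B'_def by fastforce
qed

lemma in_A_ltG: "in_A UNIV ltG"
  unfolding in_A_def
proof (intro conjI allI ballI impI)
  show "\<not> ltG x x" for x by (cases x) auto
  show "ltG x y \<Longrightarrow> ltG y z \<Longrightarrow> ltG x z" for x y z by (rule ltG_trans)
  show "tree_levels (UNIV - {None}) (\<lambda>x y. ltG x y \<and> x \<noteq> None) ht" by (rule ltG_levels)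
  show "countable B" if "is_branch UNIV ltG B" for B
    using that ltG_chain_countable unfolding is_branch_def by blast
  fix a b :: "'a node"
  assume ab: "a \<noteq> None \<and> b \<noteq> None \<and> ht a = ht b \<and> is_limit (ht a) \<and> a \<noteq> b"
  then obtain x y where sxy: "a = Some x" "b = Some y" by blast
  have xy: "a = Some x" "b = Some y" "fst x = fst y" "is_limit (fst x)" "x \<noteq> y"
    using ab unfolding sxy ht_Some by blast+
  obtain p where p: "p \<in> G" "(x, x) \<in> fst p" "(y, y) \<in> fst p" by (rule G_node2)
  note ft = G_cond(1)[OF p(1)]
  \<comment> \<open>For normality, \<open>M\<close> collects the levels of the common lower bounds
    known to \<open>p\<close>, finitely many below the limit level. With \<open>d\<close> between
    them and the limit, the predecessor of \<open>x\<close> on level \<open>d\<close> cannot be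
    below \<open>y\<close>, as \<open>R_meet\<close> would put it below a node of level less than
    \<open>d\<close>.\<close>
  define M where "M = fst ` {t. (t, x) \<in> fst p \<and> (t, y) \<in> fst p}"
  have M: "m < fst x" if "m \<in> M" for m
  proof -
    obtain t where t: "m = fst t" "(t, x) \<in> fst p" "(t, y) \<in> fst p" using \<open>m \<in> M\<close> by (auto simp: M_def)
    then show ?thesis using ft_level[OF ft t(2)] ft_level[OF ft t(3)] xy(3,5) by auto
  qed
  have "{t. (t, x) \<in> fst p \<and> (t, y) \<in> fst p} \<subseteq> fst ` fst p" by force
  then have finM: "finite M" unfolding M_def using ft_finite[OF ft] finite_subset by blast
  obtain d where d: "d < fst x" "\<And>m. m \<in> M \<Longrightarrow> m < d"
  proof (cases "M = {}")
    case True
    obtain d where "d < fst x" using xy(4) unfolding is_limit_def by blast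
    then show ?thesis using that True by blast
  next
    case False
    then obtain d where "Max M < d" "d < fst x"
      using xy(4) M[OF Max_in[OF finM False]] unfolding is_limit_def by blast
    then show ?thesis using that finM False by (meson Max_ge le_less_trans)
  qed
  obtain n where n: "((d, n), x) \<in> R" using G_below d(1) by blast
  have "((d, n), y) \<notin> R"
  proof
    assume "((d, n), y) \<in> R"
    then obtain t where t: "(t, x) \<in> fst p" "(t, y) \<in> fst p" "((d, n), t) \<in> R" by (rule R_meet[OF p n])
    have "fst t < d" using t d(2) unfolding M_def by blast
    then show False using R_level[OF t(3)] by auto
  qed
  then have "ltG (Some (d, n)) a" "\<not> ltG (Some (d, n)) b" using n xy d(1) by auto
  then show "{z. ltG z a} \<noteq> {z. ltG z b}" by blast
next
  show "ltG None x" if "x \<noteq> None" for x using that by (cases x) auto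
qed auto

sublocale T: normal_tree UNIV ltG
  by unfold_locales (rule in_A_ltG)

lemma tle_ltG: "tle ltG x y \<longleftrightarrow> (x, y) \<in> R"
  by (auto simp: tle_def R_refl)

lemma A2sp_ltG: "A2sp UNIV ltG N lt colourG"
  unfolding A2sp_def
proof (intro conjI allI impI)
  show "in_A UNIV ltG" by (rule in_A_ltG)
  show "in_A N lt" by (rule A)
  fix a1 b1 a2 b2
  assume *: "limit_pair UNIV N a1 b1 \<and> limit_pair UNIV N a2 b2 \<and> colourG a1 b1 = colourG a2 b2 \<and>
    (a1, b1) \<noteq> (a2, b2)"
  then obtain x1 y1 x2 y2 where
    ab: "a1 = Some x1" "b1 = Some y1" "a2 = Some x2" "b2 = Some y2"
    unfolding limit_pair_def by blast
  have y: "Some y1 \<in> N" "fst y1 = fst x1" "Some y2 \<in> N" "fst y2 = fst x2"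
    and c: "colourG (Some x1) (Some y1) = colourG (Some x2) (Some y2)" "(x1, y1) \<noteq> (x2, y2)"
    using * unfolding ab limit_pair_def by simp_all
  note same = colourG_same[OF y c]
  obtain z where z: "(z, x1) \<in> R" "(z, x2) \<in> R" "\<And>v. v \<preceq> y1 \<Longrightarrow> v \<preceq> y2 \<Longrightarrow> fst v < fst z"
    using same(4) by blast
  have zl: "fst z \<le> fst x1" "fst z \<le> fst x2" using R_level[OF z(1)] R_level[OF z(2)] by auto
  \<comment> \<open>If one target were below the other, it would itself be a common lower bound, on
    a level not less than that of \<open>z\<close>.\<close>
  have inc: "\<not> y1 \<preceq> y2" "\<not> y2 \<preceq> y1"
    using z(3)[of y1] z(3)[of y2] zl y by (auto dest: leD)
  have incx: "\<not> tle ltG x1 x2" "\<not> tle ltG x2 x1" using same tle_ltG by blast+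
  have "T.leq (Some z) (meet UNIV ltG (Some x1) (Some x2))"
    using T.meet_props(3)[OF _ _ incx] z tle_ltG by blast
  then obtain m where m: "meet UNIV ltG (Some x1) (Some x2) = Some m" "(z, m) \<in> R"
    using R_refl by (cases "meet UNIV ltG (Some x1) (Some x2)") auto
  have "ht_greater (Some m) (meet N lt (Some y1) (Some y2))"
  proof (cases "meet N lt (Some y1) (Some y2)")
    case (Some v)
    then have "v \<preceq> y1" "v \<preceq> y2" using meet_props(1,2)[OF y(1,3) inc] leq_Some by metis+
    then have "fst v < fst m" using z(3)[of v] R_level[OF m(2)] by auto
    then show ?thesis using Some by (simp add: ht_greater_def)
  qed (simp add: ht_greater_def)
  then show "ht_greater (meet UNIV ltG a1 a2) (meet N lt b1 b2)" using m ab by simp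
  show "ht a1 \<noteq> ht a2" using same(1) ab by simp
  show "incomparable ltG a1 a2" using incx T.incomparable_iff ab by simp
  show "incomparable lt b1 b2" using inc incomparable_iff ab by simp
qed

end

section \<open>Coding and normalisation\<close>

lemma ex_inj_pair: "\<exists>f :: 'w::omega1 \<times> 'w \<Rightarrow> 'w. inj f"
proof -
  have "infinite (UNIV :: 'w set)" using omega1_uncountable countable_finite by blast
  then have "\<exists>f. bij_betw f ((UNIV :: 'w set) \<times> (UNIV :: 'w set)) (UNIV :: 'w set)"
    unfolding card_of_ordIso by (rule card_of_Times_same_infinite)
  then show ?thesis unfolding UNIV_Times_UNIV bij_betw_def by blast
qed

lemma ex_inj_node: "\<exists>f :: 'w::omega1 \<times> nat \<Rightarrow> 'w. inj f"
proof -
  have "infinite (UNIV :: 'w set)" using omega1_uncountable countable_finite by blast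
  then obtain g :: "nat \<Rightarrow> 'w" where g: "inj g" using infinite_countable_subset by blast
  obtain f :: "'w \<times> 'w \<Rightarrow> 'w" where f: "inj f" using ex_inj_pair by blast
  have "inj (\<lambda>(a, n). f (a, g n))" by (auto intro!: injI simp: inj_eq[OF f] inj_eq[OF g])
  then show ?thesis by blast
qed

text \<open>Pairs of the order get the tag \<open>0\<close> and pairs of colour \<open>k\<close> the
  tag \<open>Suc k\<close>, so one set over \<open>'w \<times> nat\<close> carries both components
  of a condition.\<close>

lemma ex_inj_cond: "\<exists>e :: 'w::omega1 cond \<Rightarrow> ('w \<times> nat) set. inj e"
proof -
  obtain f :: "'w \<times> 'w \<Rightarrow> 'w" where f: "inj f" using ex_inj_pair by blast
  obtain g :: "'w \<times> nat \<Rightarrow> 'w" where g: "inj g" using ex_inj_node by blast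
  define J where "J = (\<lambda>((x, y), k :: nat). (f (g x, g y), k))"
  have J: "inj J" by (auto intro!: injI simp: J_def inj_eq[OF f] inj_eq[OF g])
  define e where "e p = J ` ((\<lambda>r. (r, 0)) ` fst p \<union> (\<lambda>(r, k). (r, Suc k)) ` snd p)" for p
  have "inj e"
  proof (rule injI)
    fix p q assume "e p = e q"
    then have eq: "(\<lambda>r. (r, 0)) ` fst p \<union> (\<lambda>(r, k). (r, Suc k)) ` snd p =
        (\<lambda>r. (r, 0)) ` fst q \<union> (\<lambda>(r, k). (r, Suc k)) ` snd q"
      unfolding e_def inj_image_eq_iff[OF J] .
    have 1: "r \<in> fst p \<longleftrightarrow> (r, 0) \<in> (\<lambda>r. (r, 0)) ` fst p \<union> (\<lambda>(r, k). (r, Suc k)) ` snd p" for r p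
      by auto
    have 2: "(r, k) \<in> snd p \<longleftrightarrow> (r, Suc k) \<in> (\<lambda>r. (r, 0)) ` fst p \<union> (\<lambda>(r, k). (r, Suc k)) ` snd p" for r k p
      by force
    have "r \<in> fst p \<longleftrightarrow> r \<in> fst q" for r unfolding 1[of r p] 1[of r q] eq ..
    moreover have "(r, k) \<in> snd p \<longleftrightarrow> (r, k) \<in> snd q" for r k unfolding 2[of r k p] 2[of r k q] eq ..
    ultimately show "p = q" by (intro prod_eqI set_eqI) auto
  qed
  then show ?thesis by blast
qed

lemma ex_surj_index: "\<exists>s :: 'w::omega1 \<Rightarrow> ('w \<times> nat) \<times> ('w \<times> nat) \<times> 'w. surj s"
proof -
  obtain f :: "'w \<times> 'w \<Rightarrow> 'w" where f: "inj f" using ex_inj_pair by blast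
  obtain g :: "'w \<times> nat \<Rightarrow> 'w" where g: "inj g" using ex_inj_node by blast
  have "inj (\<lambda>(x, y, d). f (g x, f (g y, d)))" by (auto intro!: injI simp: inj_eq[OF f] inj_eq[OF g])
  then show ?thesis using inj_imp_surj_inv by blast
qed

text \<open>Martin's Axiom is assumed for one particular type of conditions and families indexed by
  \<open>'w\<close>, so the forcing notion is copied along \<open>e\<close> and the dense sets are
  reindexed along \<open>s\<close>. A filter on the copy pulls back to one on the original.\<close>

lemma forcing_transfer:
  fixes P :: "'a set" and e :: "'a \<Rightarrow> 'q" and s :: "'w \<Rightarrow> 'i" and E :: "'i \<Rightarrow> 'a set"
  assumes e: "inj e" and s: "surj s"
    and P: "forcing_notion P le" "ccc P le" "\<And>i. dense P le (E i)"
    and \<Phi>: "\<And>H. is_filter P le H \<Longrightarrow> \<forall>i. H \<inter> E i \<noteq> {} \<Longrightarrow> \<Phi>"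
  shows "\<exists>(Q :: 'q set) leQ (D :: 'w \<Rightarrow> 'q set).
    forcing_notion Q leQ \<and> ccc Q leQ \<and> (\<forall>i. dense Q leQ (D i)) \<and>
    (\<forall>G. is_filter Q leQ G \<and> (\<forall>i. G \<inter> D i \<noteq> {}) \<longrightarrow> \<Phi>)"
proof -
  define leQ where "leQ x y \<longleftrightarrow> le (inv e x) (inv e y)" for x y
  have le: "leQ (e p) (e q) \<longleftrightarrow> le p q" for p q using e by (simp add: leQ_def)
  have "forcing_notion (e ` P) leQ"
    unfolding forcing_notion_def
  proof (intro conjI ballI impI)
    show "e ` P \<noteq> {}" using P(1) by (simp add: forcing_notion_def)
    show "leQ x x" if "x \<in> e ` P" for x
      using that P(1) le by (auto simp: forcing_notion_def)
    fix x y z assume "x \<in> e ` P" "y \<in> e ` P" "z \<in> e ` P" and xyz: "leQ x y" "leQ y z"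
    then obtain p q r where "x = e p" "p \<in> P" "y = e q" "q \<in> P" "z = e r" "r \<in> P" by blast
    then show "leQ x z" using xyz P(1) le unfolding forcing_notion_def by metis
  qed
  moreover have "ccc (e ` P) leQ"
    unfolding ccc_def
  proof (intro allI impI)
    fix A assume A: "antichain (e ` P) leQ A"
    then obtain B where B: "B \<subseteq> P" "A = e ` B" unfolding antichain_def by (meson subset_imageE)
    have "antichain P le B"
      using A B e unfolding antichain_def compatible_def by (simp add: le inj_eq)
    then show "countable A" using P(2) B(2) unfolding ccc_def by simp
  qed
  moreover have "dense (e ` P) leQ (e ` E (s i))" for i
    using P(3)[of "s i"] unfolding dense_def by (simp add: le image_mono)
  moreover have \<Phi>
    if G: "is_filter (e ` P) leQ G" "\<forall>i. G \<inter> e ` E (s i) \<noteq> {}" for G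
  proof -
    have "G \<subseteq> e ` P" using G(1) by (simp add: is_filter_def)
    then obtain H where H: "H \<subseteq> P" "G = e ` H" by (meson subset_imageE)
    have "is_filter P le H"
      using G(1) H(1) e unfolding is_filter_def H(2) by (simp add: le inj_image_mem_iff)
    moreover have "H \<inter> E i \<noteq> {}" for i
    proof -
      obtain j where "i = s j" using s by (metis surjD)
      then have "e ` H \<inter> e ` E i \<noteq> {}" using G(2) H(2) by blast
      then show ?thesis using e by (metis image_Int image_empty)
    qed
    ultimately show ?thesis using \<Phi> by blast
  qed
  ultimately show ?thesis by (intro exI[of _ "e ` P"] exI[of _ leQ] exI[of _ "\<lambda>i. e ` E (s i)"] conjI allI impI) blast+
qed

lemma weakly_embeds_trans:
  "weakly_embeds N1 lt1 N2 lt2 \<Longrightarrow> weakly_embeds N2 lt2 N3 lt3 \<Longrightarrow> weakly_embeds N1 lt1 N3 lt3"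
  unfolding weakly_embeds_def
proof (elim exE conjE)
  fix f g
  assume "\<forall>x\<in>N1. f x \<in> N2" "\<forall>x\<in>N1. \<forall>y\<in>N1. lt1 x y \<longrightarrow> lt2 (f x) (f y)"
    "\<forall>x\<in>N2. g x \<in> N3" "\<forall>x\<in>N2. \<forall>y\<in>N2. lt2 x y \<longrightarrow> lt3 (g x) (g y)"
  then show "\<exists>f. (\<forall>x\<in>N1. f x \<in> N3) \<and> (\<forall>x\<in>N1. \<forall>y\<in>N1. lt1 x y \<longrightarrow> lt3 (f x) (f y))"
    by (intro exI[of _ "g \<circ> f"]) simp
qed

text \<open>Trees in the class carry an extra root of level -1, which has no counterpart in the
  definition of an Aronszajn tree. The root is stripped for the comparison with such trees and here
  sent to the root again.\<close>

lemma weakly_embeds_add_root: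
  assumes "in_A N1 lt1" "in_A N2 lt2" "weakly_embeds (N1 - {None}) lt1 (N2 - {None}) lt2"
  shows "weakly_embeds N1 lt1 N2 lt2"
proof -
  interpret t1: normal_tree N1 lt1 by unfold_locales (rule assms)
  interpret t2: normal_tree N2 lt2 by unfold_locales (rule assms)
  obtain f where f: "\<And>x. x \<in> N1 - {None} \<Longrightarrow> f x \<in> N2 - {None}"
    "\<And>x y. x \<in> N1 - {None} \<Longrightarrow> y \<in> N1 - {None} \<Longrightarrow> lt1 x y \<Longrightarrow> lt2 (f x) (f y)"
    using assms(3) unfolding weakly_embeds_def by blast
  define g where "g x = (if x = None then None else f x)" for x
  have "g x \<in> N2" if "x \<in> N1" for x using that f(1)[of x] t2.None_in by (auto simp: g_def)
  moreover have "lt2 (g x) (g y)" if "x \<in> N1" "y \<in> N1" "lt1 x y" for x y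
  proof -
    have y: "y \<noteq> None" using that(3) t1.not_lt_None[of x] by (cases y) auto
    then have fy: "f y \<in> N2 - {None}" using f(1) that by blast
    show ?thesis
    proof (cases "x = None")
      case True
      have "lt2 None (f y)" using fy t2.lt_None by blast
      then show ?thesis using True y by (auto simp: g_def)
    next
      case False then show ?thesis using y f(2)[of x y] that by (auto simp: g_def)
    qed
  qed
  ultimately show ?thesis unfolding weakly_embeds_def by blast
qed

text \<open>Universality is tested on trees over \<open>'w\<close>, so the nodes other than the root
  are moved there by an injection of \<open>'w \<times> nat\<close>. Levels are countable because
  only the second coordinate varies on a level.\<close>

lemma (in normal_tree) aronszajn_copy:
  "\<exists>(S :: 'w set) ltS. aronszajn TYPE('w) S ltS \<and> weakly_embeds (N - {None}) lt S ltS"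
proof -
  obtain j :: "'w \<times> nat \<Rightarrow> 'w" where j: "inj j" using ex_inj_node by blast
  define S where "S = j ` {s. Some s \<in> N}"
  define ltS where "ltS a b \<longleftrightarrow> (\<exists>s t. a = j s \<and> b = j t \<and> lt (Some s) (Some t))" for a b
  have ltS: "ltS (j s) (j t) \<longleftrightarrow> lt (Some s) (Some t)" for s t
    using j by (auto simp: ltS_def inj_eq)
  have ltSE: "\<exists>s t. a = j s \<and> b = j t \<and> lt (Some s) (Some t)" if "ltS a b" for a b
    using that ltS_def by blast
  define lv where "lv a = fst (inv j a)" for a
  have lv: "lv (j s) = fst s" for s using j by (simp add: lv_def)
  have "tree_levels S ltS lv"
    unfolding tree_levels_def
  proof (intro conjI allI impI ballI)
    fix x y assume "ltS x y"
    then obtain s t where "x = j s" "y = j t" "lt (Some s) (Some t)" using ltSE by blast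
    then show "x \<in> S" "y \<in> S" "lv x < lv y" using lt_in lt_level lv by (auto simp: S_def)
  next
    fix x show "\<not> ltS x x" using ltSE lt_irrefl j by (metis inj_eq)
  next
    fix x y z assume xy: "ltS x y" and yz: "ltS y z"
    obtain s t where s: "x = j s" "y = j t" "lt (Some s) (Some t)" using ltSE[OF xy] by blast
    obtain u v where u: "y = j u" "z = j v" "lt (Some u) (Some v)" using ltSE[OF yz] by blast
    have "t = u" using s u j by (simp add: inj_eq)
    then show "ltS x z" using s u ltS lt_trans by blast
  next
    fix x y z assume yz: "ltS y x" "ltS z x"
    obtain s t where s: "y = j s" "x = j t" "lt (Some s) (Some t)" using ltSE[OF yz(1)] by blast
    obtain u v where u: "z = j u" "x = j v" "lt (Some u) (Some v)" using ltSE[OF yz(2)] by blast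
    have "t = v" using s u j by (simp add: inj_eq)
    then show "y = z \<or> ltS y z \<or> ltS z y" using s u lt_linear[of s "Some t" u] ltS by auto
  next
    fix x assume "x \<in> S"
    then obtain t where t: "x = j t" "Some t \<in> N" by (auto simp: S_def)
    show "bij_betw lv {y. ltS y x} {b. b < lv x}"
      unfolding bij_betw_def
    proof
      show "inj_on lv {y. ltS y x}"
      proof (rule inj_onI)
        fix y z assume yz: "y \<in> {y. ltS y x}" "z \<in> {y. ltS y x}" "lv y = lv z"
        then obtain s u where "y = j s" "z = j u" "lt (Some s) (Some t)" "lt (Some u) (Some t)"
          using ltSE ltS t by blast
        then show "y = z" using lt_linear lt_level yz(3) lv by (metis less_irrefl)
      qed
      show "lv ` {y. ltS y x} = {b. b < lv x}"
      proof (intro equalityI subsetI)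
        fix b assume "b \<in> lv ` {y. ltS y x}"
        then obtain s where "b = fst s" "lt (Some s) (Some t)" using ltSE ltS t lv by blast
        then show "b \<in> {b. b < lv x}" using lt_level t lv by simp
      next
        fix b assume "b \<in> {b. b < lv x}"
        then have "b < fst t" using t(1) lv by simp
        then obtain n where "lt (Some (b, n)) (Some t)" using lt_restrict[OF t(2)] by blast
        then show "b \<in> lv ` {y. ltS y x}" using ltS t(1) lv by (intro image_eqI[of _ _ "j (b, n)"]) auto
      qed
    qed
  qed
  moreover have "lv ` S = UNIV"
  proof -
    have "a \<in> lv ` S" for a
    proof -
      obtain n where "Some (a, n) \<in> N" using level_nonempty by blast
      then show ?thesis using lv by (intro image_eqI[of _ _ "j (a, n)"]) (auto simp: S_def)
    qed
    then show ?thesis by blast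
  qed
  moreover have "countable {x \<in> S. lv x = a}" for a
  proof (rule countable_subset)
    show "{x \<in> S. lv x = a} \<subseteq> range (\<lambda>n. j (a, n))" using lv by (auto simp: S_def)
  qed simp
  moreover have "countable B" if "is_branch S ltS B" for B
  proof -
    have ch: "is_chain S ltS B" using that by (simp add: is_branch_def)
    then have BS: "B \<subseteq> S" by (simp add: is_chain_def)
    then obtain C where C: "C \<subseteq> {s. Some s \<in> N}" "B = j ` C" unfolding S_def by (meson subset_imageE)
    have "countable C"
    proof (rule node_chain_countable)
      fix s t assume "s \<in> C" "t \<in> C"
      then show "Some s \<in> N \<and> (s \<preceq> t \<or> t \<preceq> s)"
        using ch C ltS j unfolding is_chain_def tle_def by (auto simp: inj_eq)
    qed
    then show ?thesis using C by simp
  qed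
  ultimately have "aronszajn TYPE('w) S ltS" unfolding aronszajn_def by blast
  moreover have "weakly_embeds (N - {None}) lt S ltS"
    unfolding weakly_embeds_def using ltS by (intro exI[of _ "\<lambda>x. j (the x)"]) (auto simp: S_def)
  ultimately show ?thesis by blast
qed

section \<open>Normalising an Aronszajn tree\<close>

locale levelled_tree =
  fixes U :: "'u set" and ltU and lv :: "'u \<Rightarrow> 'w::omega1"
  assumes levels: "tree_levels U ltU lv"
    and onto: "lv ` U = UNIV"
    and countable_level: "countable {x \<in> U. lv x = a}"
    and branch: "is_branch U ltU B \<Longrightarrow> countable B"
begin

lemma U_in: "\<forall>x y. ltU x y \<longrightarrow> x \<in> U \<and> y \<in> U"
  and U_irrefl: "\<forall>x. \<not> ltU x x"
  and U_trans: "\<forall>x y z. ltU x y \<longrightarrow> ltU y z \<longrightarrow> ltU x z"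
  and U_linear: "\<forall>x\<in>U. \<forall>y z. ltU y x \<longrightarrow> ltU z x \<longrightarrow> y = z \<or> ltU y z \<or> ltU z y"
  and U_level: "\<forall>x y. ltU x y \<longrightarrow> lv x < lv y"
  and U_bij: "\<forall>x\<in>U. bij_betw lv {y. ltU y x} {b. b < lv x}"
  by (insert levels, unfold tree_levels_def, elim conjE, assumption)+

text \<open>A node at level a of the normalised tree is an initial chain of order type a of the
form \<open>down x a\<close>; this inserts one new node below each set of nodes with the same
predecessors at a limit level.\<close>

definition down :: "'u \<Rightarrow> 'w \<Rightarrow> 'u set" where
  "down x a = {y \<in> U. (y = x \<or> ltU y x) \<and> lv y < a}"

definition chains :: "'w \<Rightarrow> 'u set set" where
  "chains a = {C. \<exists>x\<in>U. C = down x a \<and> lv ` C = {b. b < a}}"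

lemma chains_levels: "C \<in> chains a \<Longrightarrow> lv ` C = {b. b < a}"
  unfolding chains_def by blast

lemma chains_linear: "C \<in> chains a \<Longrightarrow> y \<in> C \<Longrightarrow> z \<in> C \<Longrightarrow> y = z \<or> ltU y z \<or> ltU z y"
  unfolding chains_def down_def using U_linear by blast

lemma chains_inj: "C \<in> chains a \<Longrightarrow> y \<in> C \<Longrightarrow> z \<in> C \<Longrightarrow> lv y = lv z \<Longrightarrow> y = z"
  using chains_linear[of C a y z] U_level by (metis less_irrefl)

lemma chains_restrict:
  assumes "C \<in> chains b" "a \<le> b"
  shows "{y \<in> C. lv y < a} \<in> chains a"
proof -
  obtain x where x: "x \<in> U" "C = down x b" "lv ` C = {c. c < b}" using assms(1) unfolding chains_def by blast
  have "{y \<in> C. lv y < a} = down x a" using x(2) assms(2) by (auto simp: down_def)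
  moreover have "lv ` {y \<in> C. lv y < a} = {c. c < a}"
  proof (intro equalityI subsetI)
    fix c assume c: "c \<in> {c. c < a}"
    then have "c \<in> lv ` C" using x(3) assms(2) by auto
    then show "c \<in> lv ` {y \<in> C. lv y < a}" using c by auto
  qed auto
  ultimately show ?thesis using x(1) unfolding chains_def by blast
qed

lemma chains_subset:
  assumes C: "C \<in> chains a" and D: "D \<in> chains b" and "C \<subseteq> D"
  shows "a \<le> b" "C = {y \<in> D. lv y < a}"
proof -
  have sub: "{c. c < a} \<subseteq> {c. c < b}"
    using image_mono[OF \<open>C \<subseteq> D\<close>, of lv] chains_levels C D by simp
  then show "a \<le> b" by (metis mem_Collect_eq not_le order_less_irrefl subsetD)
  show "C = {y \<in> D. lv y < a}"
  proof (intro equalityI subsetI)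
    fix y assume "y \<in> C"
    then show "y \<in> {y \<in> D. lv y < a}" using chains_levels[OF C] \<open>C \<subseteq> D\<close> by blast
  next
    fix y assume y: "y \<in> {y \<in> D. lv y < a}"
    then have "lv y \<in> lv ` C" using chains_levels[OF C] by blast
    then obtain z where "z \<in> C" "lv z = lv y" by (metis imageE)
    then show "y \<in> C" using chains_inj[OF D, of y z] y \<open>C \<subseteq> D\<close> by auto
  qed
qed

lemma chains_level_unique: "C \<in> chains a \<Longrightarrow> C \<in> chains b \<Longrightarrow> a = b"
  using chains_subset(1) by (meson antisym order_refl)

lemma chains_psubset: "C \<in> chains a \<Longrightarrow> D \<in> chains b \<Longrightarrow> C \<subset> D \<Longrightarrow> a < b"
  using chains_subset[of C a D b] chains_subset(2)[of D b D b] by (metis order_le_neq_trans order_refl psubsetE)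

lemma chains_comparable:
  assumes "C \<in> chains a" "C' \<in> chains a'" "D \<in> chains b" "C \<subseteq> D" "C' \<subseteq> D"
  shows "C \<subseteq> C' \<or> C' \<subseteq> C"
proof -
  have "C = {y \<in> D. lv y < a}" "C' = {y \<in> D. lv y < a'}" using chains_subset(2) assms by blast+
  then show ?thesis using linear[of a a'] by auto
qed

text \<open>If \<open>x\<close> is above level \<open>a\<close>, then \<open>down x a\<close> equals
  \<open>down z a\<close> for the predecessor \<open>z\<close> of \<open>x\<close> on level
  \<open>a\<close>; so the countably many nodes of level at most \<open>a\<close> produce all
  chains.\<close>

lemma countable_chains: "countable (chains a)"
proof (rule countable_subset)
  show "chains a \<subseteq> (\<lambda>x. down x a) ` (\<Union>b\<in>{b. b \<le> a}. {x \<in> U. lv x = b})"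
  proof
    fix C assume "C \<in> chains a"
    then obtain x where x: "x \<in> U" "C = down x a" unfolding chains_def by blast
    show "C \<in> (\<lambda>x. down x a) ` (\<Union>b\<in>{b. b \<le> a}. {x \<in> U. lv x = b})"
    proof (cases "lv x \<le> a")
      case True then show ?thesis using x by blast
    next
      case False
      then have "a \<in> lv ` {y. ltU y x}" using U_bij x(1) by (auto simp: bij_betw_def)
      then obtain z where z: "ltU z x" "lv z = a" by blast
      have "down x a = down z a"
      proof (intro equalityI subsetI)
        fix y assume y: "y \<in> down x a"
        then have "ltU y x" "lv y < a" "y \<in> U" using False by (auto simp: down_def)
        then have "y = z \<or> ltU y z \<or> ltU z y" using U_linear x(1) z(1) by blast
        then show "y \<in> down z a" using \<open>lv y < a\<close> \<open>y \<in> U\<close> z(2) U_level by (auto simp: down_def dest: order_less_asym)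
      next
        fix y assume "y \<in> down z a"
        then show "y \<in> down x a" using z(1) U_trans by (auto simp: down_def)
      qed
      moreover have "z \<in> U" using U_in z by blast
      ultimately show ?thesis using x(2) z(2) by blast
    qed
  qed
  show "countable ((\<lambda>x. down x a) ` (\<Union>b\<in>{b. b \<le> a}. {x \<in> U. lv x = b}))"
    by (intro countable_image countable_UN omega1_countable_atMost countable_level)
qed

definition code :: "'w \<Rightarrow> 'u set \<Rightarrow> 'w \<times> nat" where
  "code a C = (a, to_nat_on (chains a) C)"

definition decode :: "'w \<times> nat \<Rightarrow> 'u set" where
  "decode s = from_nat_into (chains (fst s)) (snd s)"

definition codes :: "('w \<times> nat) set" where
  "codes = {s. \<exists>a. \<exists>C\<in>chains a. s = code a C}"

definition nodesN :: "'w node set" where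
  "nodesN = insert None (Some ` codes)"

definition ltN :: "'w node \<Rightarrow> 'w node \<Rightarrow> bool" where
  "ltN x y \<longleftrightarrow> x \<in> nodesN \<and> y \<in> nodesN \<and> (case y of None \<Rightarrow> False
     | Some t \<Rightarrow> (case x of None \<Rightarrow> True | Some s \<Rightarrow> decode s \<subset> decode t))"

lemma code: "C \<in> chains a \<Longrightarrow> code a C \<in> codes \<and> fst (code a C) = a \<and> decode (code a C) = C"
  using countable_chains[of a] unfolding codes_def by (auto simp: code_def decode_def)

lemma decode: "s \<in> codes \<Longrightarrow> decode s \<in> chains (fst s) \<and> s = code (fst s) (decode s)"
  unfolding codes_def using code by force

lemma decode_inj: "s \<in> codes \<Longrightarrow> t \<in> codes \<Longrightarrow> decode s = decode t \<Longrightarrow> s = t"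
  using decode chains_level_unique by metis

lemma ltN_simps [simp]: "\<not> ltN x None" "ltN None (Some t) \<longleftrightarrow> t \<in> codes"
  "ltN (Some s) (Some t) \<longleftrightarrow> s \<in> codes \<and> t \<in> codes \<and> decode s \<subset> decode t"
  by (auto simp: ltN_def nodesN_def)

lemma nodesN_simps [simp]: "None \<in> nodesN" "Some s \<in> nodesN \<longleftrightarrow> s \<in> codes"
  by (auto simp: nodesN_def)

lemma decode_level: "s \<in> codes \<Longrightarrow> t \<in> codes \<Longrightarrow> decode s \<subset> decode t \<Longrightarrow> fst s < fst t"
  using decode chains_psubset by blast

lemma ltN_Some_left: "ltN (Some s) y \<Longrightarrow> \<exists>t. y = Some t \<and> s \<in> codes \<and> t \<in> codes \<and> decode s \<subset> decode t"
  by (cases y) auto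

lemma decode_restrict:
  assumes "t \<in> codes" "b < fst t"
  obtains s where "s \<in> codes" "fst s = b" "decode s \<subset> decode t" "decode s = {y \<in> decode t. lv y < b}"
proof -
  let ?C = "{y \<in> decode t. lv y < b}"
  have C: "?C \<in> chains b" using chains_restrict decode assms by (meson less_imp_le)
  have "b \<in> lv ` decode t" using chains_levels decode assms by blast
  then have "?C \<subset> decode t" by auto
  then show ?thesis using that[of "code b ?C"] code[OF C] by simp
qed

lemma ltN_levels: "tree_levels (nodesN - {None}) (\<lambda>x y. ltN x y \<and> x \<noteq> None) ht"
  unfolding tree_levels_def
proof (intro conjI allI impI ballI)
  fix x y assume "ltN x y \<and> x \<noteq> None"
  then obtain s t where "x = Some s" "y = Some t" "s \<in> codes" "t \<in> codes" "decode s \<subset> decode t"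
    using ltN_Some_left by (metis not_None_eq)
  then show "x \<in> nodesN - {None}" "y \<in> nodesN - {None}" "ht x < ht y" using decode_level by auto
next
  fix x show "\<not> (ltN x x \<and> x \<noteq> None)" by (cases x) auto
next
  fix x y z assume "ltN x y \<and> x \<noteq> None" "ltN y z \<and> y \<noteq> None"
  then show "ltN x z" by (cases x; cases y; cases z) auto
  show "x \<noteq> None" using \<open>ltN x y \<and> x \<noteq> None\<close> by simp
next
  fix x y z assume yz: "ltN y x \<and> y \<noteq> None" "ltN z x \<and> z \<noteq> None"
  then obtain s t u where x: "x = Some t" "y = Some s" "z = Some u"
    by (cases x; cases y; cases z) auto
  then have c: "s \<in> codes" "t \<in> codes" "u \<in> codes" "decode s \<subseteq> decode t" "decode u \<subseteq> decode t"
    using yz by auto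
  then have "decode s \<subseteq> decode u \<or> decode u \<subseteq> decode s"
    using chains_comparable[of "decode s" "fst s" "decode u" "fst u" "decode t" "fst t"] decode by simp
  then show "y = z \<or> ltN y z \<and> y \<noteq> None \<or> ltN z y \<and> z \<noteq> None"
    using x c decode_inj[of s u] by (simp add: psubset_eq) blast
next
  fix x :: "'w node" assume "x \<in> nodesN - {None}"
  then obtain t where t: "x = Some t" "t \<in> codes" by (cases x) auto
  show "bij_betw ht {y. ltN y x \<and> y \<noteq> None} {b. b < ht x}"
    unfolding bij_betw_def
  proof
    show "inj_on ht {y. ltN y x \<and> y \<noteq> None}"
    proof (rule inj_onI)
      fix y z assume yz: "y \<in> {y. ltN y x \<and> y \<noteq> None}" "z \<in> {y. ltN y x \<and> y \<noteq> None}" "ht y = ht z"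
      then obtain s u where s: "y = Some s" "z = Some u" by auto
      then have c: "s \<in> codes" "u \<in> codes" "decode s \<subseteq> decode t" "decode u \<subseteq> decode t" "fst s = fst u"
        using yz t by auto
      then have "decode s = decode u"
        using chains_subset(2)[of "decode s" "fst s" "decode t" "fst t"]
          chains_subset(2)[of "decode u" "fst u" "decode t" "fst t"]
          decode[OF c(1)] decode[OF c(2)] decode[OF t(2)] c(3-5) by simp
      then show "y = z" using s c decode_inj by blast
    qed
    show "ht ` {y. ltN y x \<and> y \<noteq> None} = {b. b < ht x}"
    proof (intro equalityI subsetI)
      fix b assume "b \<in> ht ` {y. ltN y x \<and> y \<noteq> None}"
      then obtain y where y: "b = ht y" "ltN y x" "y \<noteq> None" by blast
      then obtain s where "y = Some s" by blast
      then show "b \<in> {b. b < ht x}" using y decode_level[of s t] t by simp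
    next
      fix b assume "b \<in> {b. b < ht x}"
      then have "b < fst t" using t(1) by simp
      then obtain s where "s \<in> codes" "fst s = b" "decode s \<subset> decode t"
        using decode_restrict[OF t(2)] by metis
      then show "b \<in> ht ` {y. ltN y x \<and> y \<noteq> None}"
        using t by (intro image_eqI[of _ _ "Some s"]) auto
    qed
  qed
qed

text \<open>The union \<open>X\<close> of the coded chains is a chain of the original tree, hence
  countable and bounded in level by some \<open>u\<close>. A coded chain of order type above
  \<open>u\<close> would contain a node of level \<open>u\<close>, so the levels of the codes are
  bounded too.\<close>

lemma ltN_chain_countable:
  assumes B: "is_chain nodesN ltN B"
  shows "countable B"
proof -
  define B' where "B' = {s. Some s \<in> B}"
  have B': "s \<in> codes" if "s \<in> B'" for s using that B unfolding B'_def is_chain_def by auto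
  have lin: "s = t \<or> decode s \<subset> decode t \<or> decode t \<subset> decode s" if "s \<in> B'" "t \<in> B'" for s t
    using that B unfolding B'_def is_chain_def by fastforce
  define X where "X = (\<Union>s\<in>B'. decode s)"
  have "is_chain U ltU X"
    unfolding is_chain_def
  proof (intro conjI ballI)
    show "X \<subseteq> U" using decode B' unfolding X_def chains_def down_def by blast
    fix y z assume "y \<in> X" "z \<in> X"
    then obtain s t where st: "s \<in> B'" "y \<in> decode s" "t \<in> B'" "z \<in> decode t" unfolding X_def by blast
    then obtain u where "u \<in> B'" "y \<in> decode u" "z \<in> decode u" using lin by blast
    then show "y = z \<or> ltU y z \<or> ltU z y" using chains_linear decode B' by blast
  qed
  then have "countable X" using countable_chain[of U ltU] branch by blast
  then obtain u where u: "\<forall>b\<in>lv ` X. b < u" using countable_bounded[of "lv ` X"] by auto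
  have "fst s \<le> u" if s: "s \<in> B'" for s
  proof (rule ccontr)
    assume "\<not> fst s \<le> u"
    then have "u < fst s" by simp
    then have "u \<in> lv ` decode s" using chains_levels[of "decode s" "fst s"] decode B'[OF s] by simp
    then show False using u s unfolding X_def by blast
  qed
  then have "fst ` B' \<subseteq> {b. b \<le> u}" by blast
  then have "countable (fst ` B')" using omega1_countable_atMost by (rule countable_subset)
  moreover have "inj_on fst B'"
  proof (rule inj_onI)
    fix s t assume "s \<in> B'" "t \<in> B'" "fst s = fst t"
    then show "s = t" using lin[of s t] decode_level[of s t] decode_level[of t s] B' by auto
  qed
  ultimately have "countable B'" by (rule countable_image_inj_on)
  moreover have "B \<subseteq> insert None (Some ` B')"
  proof
    fix x assume "x \<in> B" then show "x \<in> insert None (Some ` B')" by (cases x) (auto simp: B'_def)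
  qed
  ultimately show ?thesis using countable_subset by (metis countable_image countable_insert)
qed

lemma in_A_ltN: "in_A nodesN ltN"
  unfolding in_A_def
proof (intro conjI allI ballI impI)
  show "x \<in> nodesN" "y \<in> nodesN" if "ltN x y" for x y using that by (simp_all add: ltN_def)
  show "\<not> ltN x x" for x by (cases x) auto
  show "ltN x z" if "ltN x y" "ltN y z" for x y z using that by (cases x; cases y; cases z) auto
  show "ltN None x" if "x \<in> nodesN" "x \<noteq> None" for x using that by (cases x) auto
  show "tree_levels (nodesN - {None}) (\<lambda>x y. ltN x y \<and> x \<noteq> None) ht" by (rule ltN_levels)
  show "countable B" if "is_branch nodesN ltN B" for B
    using that ltN_chain_countable unfolding is_branch_def by blast
  show "\<exists>n. Some (a, n) \<in> nodesN" for a
  proof -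
    \<comment> \<open>For \<open>x\<close> on level \<open>a\<close>, the strict predecessors form a
      chain of order type exactly \<open>a\<close>.\<close>
    obtain x where x: "x \<in> U" "lv x = a" using onto by (metis UNIV_I imageE)
    have "down x a = {y. ltU y x}" using x U_in U_level by (auto simp: down_def)
    then have "down x a \<in> chains a" using U_bij x by (auto simp: chains_def bij_betw_def)
    then show ?thesis using code by (metis nodesN_simps(2) prod.collapse)
  qed
  fix x y :: "'w node"
  assume xy: "x \<in> nodesN" "y \<in> nodesN"
    "x \<noteq> None \<and> y \<noteq> None \<and> ht x = ht y \<and> is_limit (ht x) \<and> x \<noteq> y"
  then obtain s t where "x = Some s" "y = Some t" by blast
  with xy have st: "x = Some s" "y = Some t" "s \<in> codes" "t \<in> codes" "fst s = fst t" "is_limit (fst s)" "s \<noteq> t"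
    by auto
  \<comment> \<open>At a limit level a chain is the union of its proper initial parts, each of them
    coded by a predecessor; hence the predecessors determine the chain, which is normality.\<close>
  have sub: "decode s \<subseteq> decode t"
    if cs: "s \<in> codes" and lim: "is_limit (fst s)" and "\<And>z. ltN z (Some s) \<Longrightarrow> ltN z (Some t)" for s t
  proof
    fix y assume y: "y \<in> decode s"
    then have "lv y < fst s" using chains_levels decode[OF that(1)] by blast
    then obtain c where c: "lv y < c" "c < fst s" using lim unfolding is_limit_def by blast
    obtain p where p: "p \<in> codes" "decode p \<subset> decode s" "decode p = {y \<in> decode s. lv y < c}"
      using decode_restrict[OF cs c(2)] by metis
    then have "ltN (Some p) (Some s)" using cs by simp
    then have "ltN (Some p) (Some t)" by (rule that(3))
    then show "y \<in> decode t" using p(3) y c by auto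
  qed
  show "{z. ltN z x} \<noteq> {z. ltN z y}"
  proof
    assume eq: "{z. ltN z x} = {z. ltN z y}"
    then have "ltN z (Some s) \<longleftrightarrow> ltN z (Some t)" for z using st(1,2) by blast
    then have "decode s = decode t" using sub[of s t] sub[of t s] st by auto
    then show False using decode_inj st by blast
  qed
qed auto

text \<open>A node goes to the chain of its weak predecessors, whose order type is the successor of
  its level; at a limit level this moves it above the inserted node.\<close>

lemma weakly_embeds_nodesN: "weakly_embeds U ltU (nodesN - {None}) ltN"
proof -
  define sc where "sc a = (LEAST c. a < c)" for a :: 'w
  have sc: "b < sc a \<longleftrightarrow> b \<le> a" for a b
  proof
    show "b \<le> a" if "b < sc a" using that not_less_Least unfolding sc_def by (metis not_le)
    have "a < sc a" unfolding sc_def using ex_greater by (rule LeastI_ex)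
    then show "b < sc a" if "b \<le> a" using that by simp
  qed
  define f where "f x = down x (sc (lv x))" for x
  have f_eq: "f x = insert x {y. ltU y x}" if "x \<in> U" for x
    using that U_in U_level sc unfolding f_def down_def by (auto intro: less_imp_le)
  have f: "f x \<in> chains (sc (lv x))" if x: "x \<in> U" for x
  proof -
    have "lv ` {y. ltU y x} = {b. b < lv x}" using U_bij x by (simp add: bij_betw_def)
    then have "lv ` f x = {b. b < sc (lv x)}" unfolding f_eq[OF x] sc by (auto simp: less_le)
    then show ?thesis using x unfolding f_def chains_def by blast
  qed
  define g where "g x = Some (code (sc (lv x)) (f x))" for x
  have "g x \<in> nodesN - {None}" if "x \<in> U" for x using code[OF f[OF that]] by (simp add: g_def)
  moreover have "ltN (g x) (g y)" if "x \<in> U" "y \<in> U" "ltU x y" for x y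
  proof -
    have "f x \<subseteq> f y" using f_eq[OF that(1)] f_eq[OF that(2)] that(3) U_trans by auto
    moreover have "y \<notin> f x"
    proof
      assume "y \<in> f x"
      then have "y = x \<or> ltU y x" using f_eq[OF that(1)] by simp
      then have "ltU x x" using that(3) U_trans by blast
      then show False using U_irrefl by blast
    qed
    moreover have "y \<in> f y" using f_eq[OF that(2)] by simp
    ultimately have "f x \<subset> f y" by blast
    then show ?thesis using code[OF f[OF that(1)]] code[OF f[OF that(2)]] by (simp add: g_def)
  qed
  ultimately show ?thesis unfolding weakly_embeds_def by blast
qed

end

lemma aronszajn_normalise:
  fixes U :: "'u set"
  assumes "aronszajn TYPE('w::omega1) U ltU"
  shows "\<exists>(N :: 'w node set) lt. in_A N lt \<and> weakly_embeds U ltU (N - {None}) lt"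
proof -
  obtain lv :: "'u \<Rightarrow> 'w" where "tree_levels U ltU lv" "lv ` U = UNIV"
    "\<forall>a. countable {x \<in> U. lv x = a}" "\<forall>B. is_branch U ltU B \<longrightarrow> countable B"
    using assms unfolding aronszajn_def by blast
  then interpret levelled_tree U ltU lv by unfold_locales blast+
  show ?thesis using in_A_ltN weakly_embeds_nodesN by blast
qed

section \<open>The generic family and non-universality\<close>

lemma (in normal_tree) generic_family:
  "\<exists>(P :: ('w \<times> nat) set set) le (D :: 'w \<Rightarrow> ('w \<times> nat) set set).
     forcing_notion P le \<and> ccc P le \<and> (\<forall>i. dense P le (D i)) \<and>
     (\<forall>G. is_filter P le G \<and> (\<forall>i. G \<inter> D i \<noteq> {}) \<longrightarrow>
        (\<exists>(Nstar :: 'w node set) ltstar c.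
           in_A Nstar ltstar \<and> A2sp Nstar ltstar N lt c \<and> \<not> weakly_embeds Nstar ltstar N lt))"
proof -
  have gen: "\<exists>(Nstar :: 'w node set) ltstar c.
      in_A Nstar ltstar \<and> A2sp Nstar ltstar N lt c \<and> \<not> weakly_embeds Nstar ltstar N lt"
    if "is_filter (Cond lt N) stronger H" "\<forall>i. H \<inter> generic_dense lt N i \<noteq> {}" for H
  proof -
    interpret generic_tree N lt H by unfold_locales (use that in blast)+
    show ?thesis using in_A_ltG A2sp_ltG A2sp_not_weakly_embeds by blast
  qed
  obtain e :: "'w cond \<Rightarrow> ('w \<times> nat) set" where e: "inj e" using ex_inj_cond by blast
  obtain s :: "'w \<Rightarrow> ('w \<times> nat) \<times> ('w \<times> nat) \<times> 'w" where s: "surj s" using ex_surj_index by blast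
  show ?thesis
    by (rule forcing_transfer[OF e s forcing_notion_Cond ccc_Cond dense_generic_dense gen])
qed

theorem theorem4p1:
  fixes w :: "'w::omega1 itself" and u :: "'u itself"
  shows
  "(\<forall>(N :: 'w node set) lt. in_A N lt \<longrightarrow>
      (\<exists>(P :: ('w \<times> nat) set set) le (D :: 'w \<Rightarrow> ('w \<times> nat) set set).
         forcing_notion P le \<and> ccc P le \<and> (\<forall>i. dense P le (D i)) \<and>
         (\<forall>G. is_filter P le G \<and> (\<forall>i. G \<inter> D i \<noteq> {}) \<longrightarrow>
            (\<exists>(Nstar :: 'w node set) ltstar c.
               in_A Nstar ltstar \<and> A2sp Nstar ltstar N lt c \<and>
               \<not> weakly_embeds Nstar ltstar N lt)))) \<and>
   (MA_omega1 TYPE(('w \<times> nat) set) TYPE('w) \<longrightarrow>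
      \<not> (\<exists>(U :: 'u set) ltU. aronszajn TYPE('w) U ltU \<and>
            (\<forall>(S :: 'w set) ltS. aronszajn TYPE('w) S ltS \<longrightarrow> weakly_embeds S ltS U ltU)))"
proof (intro conjI allI impI notI)
  fix N :: "'w node set" and lt assume "in_A N lt"
  then show "\<exists>(P :: ('w \<times> nat) set set) le (D :: 'w \<Rightarrow> ('w \<times> nat) set set).
     forcing_notion P le \<and> ccc P le \<and> (\<forall>i. dense P le (D i)) \<and>
     (\<forall>G. is_filter P le G \<and> (\<forall>i. G \<inter> D i \<noteq> {}) \<longrightarrow>
        (\<exists>(Nstar :: 'w node set) ltstar c.
           in_A Nstar ltstar \<and> A2sp Nstar ltstar N lt c \<and> \<not> weakly_embeds Nstar ltstar N lt))"
    by (intro normal_tree.generic_family normal_tree.intro)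
next
  assume MA: "MA_omega1 TYPE(('w \<times> nat) set) TYPE('w)"
  assume "\<exists>(U :: 'u set) ltU. aronszajn TYPE('w) U ltU \<and>
    (\<forall>(S :: 'w set) ltS. aronszajn TYPE('w) S ltS \<longrightarrow> weakly_embeds S ltS U ltU)"
  then obtain U :: "'u set" and ltU where U: "aronszajn TYPE('w) U ltU"
    "\<And>(S :: 'w set) ltS. aronszajn TYPE('w) S ltS \<Longrightarrow> weakly_embeds S ltS U ltU" by blast
  obtain N :: "'w node set" and lt where N: "in_A N lt" "weakly_embeds U ltU (N - {None}) lt"
    using aronszajn_normalise[OF U(1)] by blast
  interpret normal_tree N lt by unfold_locales (rule N)
  obtain P :: "('w \<times> nat) set set" and le and D :: "'w \<Rightarrow> ('w \<times> nat) set set" where P: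
    "forcing_notion P le" "ccc P le" "\<forall>i. dense P le (D i)"
    "\<forall>G. is_filter P le G \<and> (\<forall>i. G \<inter> D i \<noteq> {}) \<longrightarrow>
        (\<exists>(Nstar :: 'w node set) ltstar c.
           in_A Nstar ltstar \<and> A2sp Nstar ltstar N lt c \<and> \<not> weakly_embeds Nstar ltstar N lt)"
    using generic_family by blast
  obtain G where "is_filter P le G" "\<forall>i. G \<inter> D i \<noteq> {}"
    using MA P(1-3) unfolding MA_omega1_def by meson
  then obtain M :: "'w node set" and ltM where M: "in_A M ltM" "\<not> weakly_embeds M ltM N lt"
    using P(4) by blast
  \<comment> \<open>Universality of \<open>U\<close> would embed \<open>M\<close> without its root
    through \<open>S\<close> and \<open>U\<close> into \<open>N\<close>; restoring the roots
    contradicts the choice of \<open>M\<close>.\<close>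
  obtain S :: "'w set" and ltS where "aronszajn TYPE('w) S ltS" "weakly_embeds (M - {None}) ltM S ltS"
    using normal_tree.aronszajn_copy[OF normal_tree.intro[OF M(1)]] by blast
  then have "weakly_embeds (M - {None}) ltM (N - {None}) lt"
    using U(2) N(2) weakly_embeds_trans by metis
  then show False using weakly_embeds_add_root M N(1) by blast
qed

end
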